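(* Let $\mathcal{G}$ be a metric graph obtained from a compact core $\mathcal{K}$ by attaching $N\ge 1$ half-lines, as described in the context, and let $\mu>0$ and $2<p<6$. Then $$\inf_{u\in H^1_\mu(\mathcal{G})}E(u,\mathcal{G})\le 0 .$$ Moreover, if $$\inf_{u\in H^1_\mu(\mathcal{G})}E(u,\mathcal{G})<0,$$ then the infimum is attained (i.e. there is $u\in H^1_\mu(\mathcal{G})$ with $E(u,\mathcal{G})=\inf_{v\in H^1_\mu(\mathcal{G})}E(v,\mathcal{G})$) and, up to a change of sign, every minimizer is strictly positive on $\mathcal{G}$.
   Context: Graphs are multigraphs (multiple edges and self-loops are allowed, and there is no constraint on the degree of the vertices). A metric graph is a connected graph in which each edge $e$ of length $l_e$ is identified with an interval $I_e=[0,l_e]$ if $l_e<\infty$, and with $I_e=[0,+\infty)$ if $l_e=+\infty$; in the latter case $e$ is called a half-line and $x_e=0$ is its starting point. Let $\mathcal{K}=(\mathrm{V}_{\mathcal{K}},\mathrm{E}_{\mathcal{K}})$ be a nontrivial compact connected metric graph, i.e. one with finitely many vertices and edges, at least one edge, and all edges of finite positive length (no half-lines). Let $\mathcal{R}_1,\dots,\mathcal{R}_N$, $N\ge1$, be half-lines, each starting from a vertex of $\mathcal{K}$ (the starting vertices need not be distinct) and ending at distinct vertices at infinity. The graph $\mathcal{G}$ has vertices those of $\mathcal{K}$ together with the $N$ vertices at infinity, and edges $\mathrm{E}=\mathrm{E}_{\mathcal{K}}\cup\{\mathcal{R}_1,\dots,\mathcal{R}_N\}$. A function $u:\mathcal{G}\to\mathbb{R}$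 is a family $(u_e)_{e\in\mathrm{E}}$ with $u_e:I_e\to\mathbb{R}$. One sets $\|u\|_{L^q(\mathcal{G})}^q=\sum_{e\in\mathrm{E}}\|u_e\|_{L^q(I_e)}^q$ and $\|u\|_{L^q(\mathcal{K})}^q=\sum_{e\in\mathrm{E}_{\mathcal{K}}}\|u_e\|_{L^q(I_e)}^q$. The space $H^1(\mathcal{G})$ consists of the functions $u=(u_e)_{e\in\mathrm{E}}$ that are continuous on $\mathcal{G}$ (in particular at the vertices of $\mathcal{K}$) and satisfy $u_e\in H^1(I_e)$ for every $e\in\mathrm{E}$. For $\mu>0$, $H^1_\mu(\mathcal{G})=\{u\in H^1(\mathcal{G}):\|u\|_{L^2(\mathcal{G})}^2=\mu\}$. The energy functional is $$E(u,\mathcal{G})=\tfrac12\|u'\|_{L^2(\mathcal{G})}^2-\tfrac1p\|u\|_{L^p(\mathcal{K})}^p=\tfrac12\sum_{e\in\mathrm{E}}\int_{I_e}|u_e'|^2\,dx_e-\tfrac1p\sum_{e\in\mathrm{E}_{\mathcal{K}}}\int_{I_e}|u_e|^p\,dx_e .$$ *)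

theory Defs
  imports "HOL-Analysis.Analysis" "Graph_Theory.Digraph_Component"
begin

text \<open>
  Multigraphs are the multi-digraphs of \<^theory>\<open>Graph_Theory.Digraph\<close>. The direction of an arc
  carries no meaning beyond fixing the coordinate on the edge: the tail sits at \<open>0\<close>
  and the head at the other end of the interval (at infinity for a half-line).
\<close>

record ('v, 'e) metric_graph =
  skeleton :: "('v, 'e) pre_digraph"
  len :: "'e \<Rightarrow> ereal"

abbreviation vertices :: "('v, 'e) metric_graph \<Rightarrow> 'v set" where
  "vertices G \<equiv> verts (skeleton G)"

abbreviation edges :: "('v, 'e) metric_graph \<Rightarrow> 'e set" where
  "edges G \<equiv> arcs (skeleton G)"

definition is_metric_graph :: "('v, 'e) metric_graph \<Rightarrow> bool" where
  "is_metric_graph G \<longleftrightarrow>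
     wf_digraph (skeleton G) \<and> Digraph_Component.connected (skeleton G) \<and>
     (\<forall>e\<in>edges G. 0 < len G e)"

definition compact_metric_graph :: "('v, 'e) metric_graph \<Rightarrow> bool" where
  "compact_metric_graph G \<longleftrightarrow>
     is_metric_graph G \<and> finite (vertices G) \<and> finite (edges G) \<and>
     (\<forall>e\<in>edges G. len G e < \<infinity>)"

text \<open>
  Attaching \<open>N\<close> half-lines to \<open>K\<close>, the \<open>i\<close>-th one starting at the vertex \<open>s i\<close>:
  \<open>Inl\<close> tags the vertices and edges of \<open>K\<close>, and \<open>Inr i\<close> is the \<open>i\<close>-th half-line, respectively
  its vertex at infinity.
\<close>

definition attach_half_lines ::
  "('v, 'e) metric_graph \<Rightarrow> nat \<Rightarrow> (nat \<Rightarrow> 'v) \<Rightarrow> ('v + nat, 'e + nat) metric_graph" where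
  "attach_half_lines K N s =
     \<lparr> skeleton =
         \<lparr> verts = vertices K <+> {..<N},
           arcs = edges K <+> {..<N},
           tail = case_sum (\<lambda>e. Inl (tail (skeleton K) e)) (\<lambda>i. Inl (s i)),
           head = case_sum (\<lambda>e. Inl (head (skeleton K) e)) Inr \<rparr>,
       len = case_sum (len K) (\<lambda>i. \<infinity>) \<rparr>"

text \<open>This is \<open>[0, l]\<close> for an edge of finite length \<open>l\<close>, and \<open>[0, \<infinity>)\<close> for a half-line.\<close>

definition edge_interval :: "('v, 'e) metric_graph \<Rightarrow> 'e \<Rightarrow> real set" where
  "edge_interval G e = {x. 0 \<le> x \<and> ereal x \<le> len G e}"

definition Lq_on :: "real \<Rightarrow> real set \<Rightarrow> (real \<Rightarrow> real) \<Rightarrow> bool" where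
  "Lq_on q I f \<longleftrightarrow>
     set_borel_measurable lborel I f \<and> set_integrable lborel I (\<lambda>x. \<bar>f x\<bar> powr q)"

definition test_function :: "real set \<Rightarrow> (real \<Rightarrow> real) \<Rightarrow> bool" where
  "test_function I \<phi> \<longleftrightarrow>
     \<phi> C1_differentiable_on UNIV \<and>
     compact (closure {x. \<phi> x \<noteq> 0}) \<and> closure {x. \<phi> x \<noteq> 0} \<subseteq> interior I"

text \<open>
  The Sobolev space \<open>H\<^sup>1(I)\<close> of an interval is defined through weak derivatives in \<open>L\<^sup>2\<close>,
  tested against \<open>C\<^sup>1\<close> functions with compact support in the interior. Measurability is Borel;
  as every Lebesgue measurable function has a Borel representative, this does not affect
  which continuous functions lie in \<open>H\<^sup>1(I)\<close>.
\<close>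

definition has_weak_deriv :: "real set \<Rightarrow> (real \<Rightarrow> real) \<Rightarrow> (real \<Rightarrow> real) \<Rightarrow> bool" where
  "has_weak_deriv I f g \<longleftrightarrow>
     Lq_on 2 I g \<and>
     (\<forall>\<phi>. test_function I \<phi> \<longrightarrow>
        (LBINT x:I. f x * deriv \<phi> x) = - (LBINT x:I. g x * \<phi> x))"

definition H1_on :: "real set \<Rightarrow> (real \<Rightarrow> real) \<Rightarrow> bool" where
  "H1_on I f \<longleftrightarrow> Lq_on 2 I f \<and> (\<exists>g. has_weak_deriv I f g)"

text \<open>
  The weak derivative is determined only almost everywhere on \<open>I\<close>; the choice below
  is immaterial because it is used only under integrals over \<open>I\<close>.
\<close>

definition weak_deriv :: "real set \<Rightarrow> (real \<Rightarrow> real) \<Rightarrow> real \<Rightarrow> real" where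
  "weak_deriv I f = (SOME g. has_weak_deriv I f g)"

text \<open>
  A function on \<open>G\<close> is a family \<open>u\<close> for which only the values \<open>u e x\<close> with \<open>e\<close> an edge and \<open>x\<close>
  in its interval matter. It is continuous if every \<open>u e\<close> is, and if all edge ends meeting
  at a vertex \<open>v\<close> carry a common value \<open>w v\<close>. There is no condition at vertices at infinity.
\<close>

definition continuous_on_graph :: "('v, 'e) metric_graph \<Rightarrow> ('e \<Rightarrow> real \<Rightarrow> real) \<Rightarrow> bool" where
  "continuous_on_graph G u \<longleftrightarrow>
     (\<forall>e\<in>edges G. continuous_on (edge_interval G e) (u e)) \<and>
     (\<exists>w. \<forall>e\<in>edges G.
        u e 0 = w (tail (skeleton G) e) \<and>
        (len G e < \<infinity> \<longrightarrow> u e (real_of_ereal (len G e)) = w (head (skeleton G) e)))"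

definition H1_graph :: "('v, 'e) metric_graph \<Rightarrow> ('e \<Rightarrow> real \<Rightarrow> real) set" where
  "H1_graph G =
     {u. continuous_on_graph G u \<and> (\<forall>e\<in>edges G. H1_on (edge_interval G e) (u e))}"

text \<open>The \<open>q\<close>-th power of the \<open>L\<^sup>q\<close> norm over the part of \<open>G\<close> formed by the edges in \<open>F\<close>.\<close>

definition Lq_norm_pow ::
  "('v, 'e) metric_graph \<Rightarrow> 'e set \<Rightarrow> real \<Rightarrow> ('e \<Rightarrow> real \<Rightarrow> real) \<Rightarrow> real" where
  "Lq_norm_pow G F q u = (\<Sum>e\<in>F. LBINT x:edge_interval G e. \<bar>u e x\<bar> powr q)"

definition H1_mass :: "('v, 'e) metric_graph \<Rightarrow> real \<Rightarrow> ('e \<Rightarrow> real \<Rightarrow> real) set" where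
  "H1_mass G \<mu> = {u \<in> H1_graph G. Lq_norm_pow G (edges G) 2 u = \<mu>}"

text \<open>The set \<open>F\<close> collects the edges on which the nonlinearity acts (those of the compact core).\<close>

definition energy ::
  "('v, 'e) metric_graph \<Rightarrow> 'e set \<Rightarrow> real \<Rightarrow> ('e \<Rightarrow> real \<Rightarrow> real) \<Rightarrow> real" where
  "energy G F p u =
     1 / 2 * Lq_norm_pow G (edges G) 2 (\<lambda>e. weak_deriv (edge_interval G e) (u e))
     - 1 / p * Lq_norm_pow G F p u"

text \<open>
  The infimum is taken in the extended reals, so that unboundedness from below gives \<open>-\<infinity>\<close>
  and an empty set of competitors would give \<open>\<infinity>\<close>.
\<close>

definition ground_energy :: "('v, 'e) metric_graph \<Rightarrow> 'e set \<Rightarrow> real \<Rightarrow> real \<Rightarrow> ereal" where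
  "ground_energy G F p \<mu> = (INF u\<in>H1_mass G \<mu>. ereal (energy G F p u))"

definition is_minimizer ::
  "('v, 'e) metric_graph \<Rightarrow> 'e set \<Rightarrow> real \<Rightarrow> real \<Rightarrow> ('e \<Rightarrow> real \<Rightarrow> real) \<Rightarrow> bool" where
  "is_minimizer G F p \<mu> u \<longleftrightarrow>
     u \<in> H1_mass G \<mu> \<and> ereal (energy G F p u) = ground_energy G F p \<mu>"

definition strictly_positive :: "('v, 'e) metric_graph \<Rightarrow> ('e \<Rightarrow> real \<Rightarrow> real) \<Rightarrow> bool" where
  "strictly_positive G u \<longleftrightarrow> (\<forall>e\<in>edges G. \<forall>x\<in>edge_interval G e. 0 < u e x)"

end

theory Submission
  imports Defs "HOL-Complex_Analysis.Great_Picard" "HOL-Real_Asymp.Real_Asymp"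
begin

text \<open>
  Every function in \<open>H\<^sup>1\<close> of the graph is handled together with an \<open>L\<^sup>2\<close> function \<open>g\<close> of which it
  is the integral on each edge; such pairs are exactly the continuous functions with a weak
  derivative, and the derivative is unique almost everywhere.

  \<^emph>\<open>The level is at most zero.\<close> A function that lives on one half-line does not feel the
  nonlinearity, and spreading it out at constant mass sends its kinetic energy to zero
  (\<open>ground_energy_nonpos\<close>).

  \<^emph>\<open>Existence.\<close> On an edge of the core, \<open>sup u\<^sup>2\<close> is controlled by the mass plus the geometric
  mean of mass and kinetic energy, so that the potential energy grows at most like the power
  \<open>(p - 2) / 4\<close> of the kinetic energy. Since \<open>p < 6\<close> this power is below one and the energy is
  coercive (\<open>state_energy_coercive\<close>). If the level is negative, then rescaling a function of
  smaller mass up to mass \<open>\<mu>\<close> can only lower a negative energy, because the potential scales with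
  a higher power than the rest; hence no function of mass at most \<open>\<mu>\<close> has an energy below the
  level, and one of mass less than \<open>\<mu>\<close> has an energy strictly above it
  (\<open>level_le_subcritical_mass\<close>). Along a minimizing sequence the functions converge uniformly on
  the core after passing to a subsequence (Arzela--Ascoli), and the midpoint of two late members
  is an admissible competitor. The parallelogram law therefore makes their derivatives a Cauchy
  sequence in \<open>L\<^sup>2\<close>: if they were far apart, the midpoint would have an energy below the
  level. The limit has energy equal to the level and, by Fatou's lemma, mass at most \<open>\<mu>\<close>; the strict inequality above excludes a loss
  of mass to infinity (\<open>minimizer_exists\<close>).

  \<^emph>\<open>Sign.\<close> Let \<open>u\<close> be a minimizer and compare it with \<open>v = sqrt (u\<^sup>2 + t \<eta>\<^sup>2)\<close>, where \<open>\<eta>\<close> is \<open>1\<close> on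
  the core and \<open>exp (- x)\<close> on the half-lines. This competitor is continuous at the vertices, its
  mass is that of \<open>u\<close> plus \<open>t\<close> times that of \<open>\<eta>\<close>, its potential energy is not smaller, and
  \<open>v'\<^sup>2 = u'\<^sup>2 + t \<eta>'\<^sup>2 - t (\<eta> u' - u \<eta>')\<^sup>2 / v\<^sup>2\<close>. Minimality thus bounds the integral of
  \<open>(\<eta> u' - u \<eta>')\<^sup>2 / v\<^sup>2\<close> over the graph uniformly in \<open>t\<close>, which bounds the oscillation of
  \<open>ln ((u / \<eta>)\<^sup>2 + t)\<close> on bounded pieces of every edge. At a zero of \<open>u\<close> this function equals
  \<open>ln t\<close>; letting \<open>t\<close> tend to zero shows that \<open>u\<close> vanishes on the whole edge
  (\<open>minimizer_zero_spreads\<close>), and then everywhere by connectedness, contradicting its mass. A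
  function without zeros has a constant sign on a connected graph. This argument replaces the
  Euler--Lagrange equation with Kirchhoff conditions and a strong maximum principle.
\<close>

section \<open>Square integrable functions on a set of reals\<close>

lemma Lq_on_2_iff:
  "Lq_on 2 I f \<longleftrightarrow> set_borel_measurable lborel I f \<and> set_integrable lborel I (\<lambda>x. (f x)\<^sup>2)"
  by (simp add: Lq_on_def)

lemma set_borel_measurable_compose2:
  fixes f g :: "real \<Rightarrow> real"
  assumes "set_borel_measurable lborel I f" "set_borel_measurable lborel I g"
  shows "set_borel_measurable lborel I (\<lambda>x. f x * g x)"
    and "set_borel_measurable lborel I (\<lambda>x. f x + g x)"
proof -
  let ?f = "\<lambda>x. indicat_real I x *\<^sub>R f x" and ?g = "\<lambda>x. indicat_real I x *\<^sub>R g x"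
  have [measurable]: "?f \<in> borel_measurable borel" "?g \<in> borel_measurable borel"
    using assms by (auto simp: set_borel_measurable_def)
  have "(\<lambda>x. ?f x * ?g x) \<in> borel_measurable borel" "(\<lambda>x. ?f x + ?g x) \<in> borel_measurable borel"
    by measurable
  then show "set_borel_measurable lborel I (\<lambda>x. f x * g x)"
    and "set_borel_measurable lborel I (\<lambda>x. f x + g x)"
    by (auto simp: set_borel_measurable_def indicator_def of_bool_def if_distrib if_distribR cong: if_cong)
qed

lemma set_borel_measurable_cmult:
  fixes f :: "real \<Rightarrow> real"
  assumes "set_borel_measurable lborel I f"
  shows "set_borel_measurable lborel I (\<lambda>x. c * f x)"
proof -
  have "(\<lambda>x. c * (indicat_real I x *\<^sub>R f x)) \<in> borel_measurable lborel"
    using assms by (intro borel_measurable_times) (auto simp: set_borel_measurable_def)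
  then show ?thesis by (simp add: set_borel_measurable_def algebra_simps)
qed

lemma set_borel_measurable_mono:
  fixes f :: "real \<Rightarrow> real"
  assumes "set_borel_measurable lborel I f" "J \<subseteq> I" "J \<in> sets borel"
  shows "set_borel_measurable lborel J f"
proof -
  have "(\<lambda>x. indicat_real J x * (indicat_real I x *\<^sub>R f x)) \<in> borel_measurable lborel"
    using assms by (intro borel_measurable_times) (auto simp: set_borel_measurable_def)
  moreover have "(\<lambda>x. indicat_real J x * (indicat_real I x *\<^sub>R f x)) = (\<lambda>x. indicat_real J x *\<^sub>R f x)"
    using assms(2) by (auto simp: indicator_def fun_eq_iff)
  ultimately show ?thesis by (simp add: set_borel_measurable_def)
qed

lemma L2_mult_integrable:
  assumes f: "Lq_on 2 I f" and g: "Lq_on 2 I g"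
  shows "set_integrable lborel I (\<lambda>x. f x * g x)"
proof (rule set_integrable_bound)
  show "set_integrable lborel I (\<lambda>x. (f x)\<^sup>2 + (g x)\<^sup>2)"
    using assms by (simp add: Lq_on_2_iff)
  show "set_borel_measurable lborel I (\<lambda>x. f x * g x)"
    using assms by (intro set_borel_measurable_compose2) (auto simp: Lq_on_2_iff)
  have "\<bar>f x * g x\<bar> \<le> (f x)\<^sup>2 + (g x)\<^sup>2" for x
  proof -
    have "2 * \<bar>f x * g x\<bar> \<le> (f x)\<^sup>2 + (g x)\<^sup>2"
      using sum_squares_bound[of "\<bar>f x\<bar>" "\<bar>g x\<bar>"] by (simp add: abs_mult)
    then show ?thesis using abs_ge_zero[of "f x * g x"] by linarith
  qed
  then show "AE x in lborel. x \<in> I \<longrightarrow> norm (f x * g x) \<le> norm ((f x)\<^sup>2 + (g x)\<^sup>2)"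
    by auto
qed

lemma L2_integral_nonneg: "0 \<le> (LBINT x:I. (f x :: real)\<^sup>2)"
  by (auto simp: set_lebesgue_integral_def intro!: Bochner_Integration.integral_nonneg)

lemma L2_lincomb:
  assumes f: "Lq_on 2 I f" and g: "Lq_on 2 I g"
  shows "Lq_on 2 I (\<lambda>x. a * f x + b * g x)"
proof -
  have "(a * f x + b * g x)\<^sup>2 = a\<^sup>2 * (f x)\<^sup>2 + 2 * a * b * (f x * g x) + b\<^sup>2 * (g x)\<^sup>2" for x
    by (simp add: power2_eq_square algebra_simps)
  moreover have "set_integrable lborel I (\<lambda>x. a\<^sup>2 * (f x)\<^sup>2 + 2 * a * b * (f x * g x) + b\<^sup>2 * (g x)\<^sup>2)"
    using L2_mult_integrable[OF f g] f g
    by (intro set_integral_add set_integrable_mult_right) (auto simp: Lq_on_2_iff)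
  ultimately show ?thesis
    using f g by (auto simp: Lq_on_2_iff intro!: set_borel_measurable_compose2 set_borel_measurable_cmult)
qed

lemma L2_integral_lincomb:
  assumes f: "Lq_on 2 I f" and g: "Lq_on 2 I g"
  shows "(LBINT x:I. (a * f x + b * g x)\<^sup>2) =
    a\<^sup>2 * (LBINT x:I. (f x)\<^sup>2) + 2 * a * b * (LBINT x:I. f x * g x) + b\<^sup>2 * (LBINT x:I. (g x)\<^sup>2)"
proof -
  have "(LBINT x:I. (a * f x + b * g x)\<^sup>2) =
      (LBINT x:I. a\<^sup>2 * (f x)\<^sup>2 + 2 * a * b * (f x * g x) + b\<^sup>2 * (g x)\<^sup>2)"
    by (simp add: power2_eq_square algebra_simps)
  also have "\<dots> = (LBINT x:I. a\<^sup>2 * (f x)\<^sup>2 + 2 * a * b * (f x * g x)) + (LBINT x:I. b\<^sup>2 * (g x)\<^sup>2)"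
    using L2_mult_integrable[OF f g] f g
    by (intro set_integral_add set_integrable_mult_right) (auto simp: Lq_on_2_iff)
  also have "(LBINT x:I. a\<^sup>2 * (f x)\<^sup>2 + 2 * a * b * (f x * g x)) =
      (LBINT x:I. a\<^sup>2 * (f x)\<^sup>2) + (LBINT x:I. 2 * a * b * (f x * g x))"
    using L2_mult_integrable[OF f g] f g
    by (intro set_integral_add set_integrable_mult_right) (auto simp: Lq_on_2_iff)
  finally show ?thesis by simp
qed

lemma L2_cmult: "Lq_on 2 I f \<Longrightarrow> Lq_on 2 I (\<lambda>x. c * f x)"
  using L2_lincomb[of I f f c 0] by simp

lemma L2_diff: "Lq_on 2 I f \<Longrightarrow> Lq_on 2 I g \<Longrightarrow> Lq_on 2 I (\<lambda>x. f x - g x)"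
  using L2_lincomb[of I f g 1 "-1"] by simp

lemma L2_mono: "Lq_on 2 I f \<Longrightarrow> J \<subseteq> I \<Longrightarrow> J \<in> sets borel \<Longrightarrow> Lq_on 2 J f"
  by (auto simp: Lq_on_2_iff intro: set_borel_measurable_mono set_integrable_subset)

lemma L2_bound:
  assumes "Lq_on 2 I f" "set_borel_measurable lborel I h" "\<And>x. x \<in> I \<Longrightarrow> \<bar>h x\<bar> \<le> \<bar>f x\<bar>"
  shows "Lq_on 2 I h" and "(LBINT x:I. (h x)\<^sup>2) \<le> (LBINT x:I. (f x)\<^sup>2)"
proof -
  have le: "(h x)\<^sup>2 \<le> (f x)\<^sup>2" if "x \<in> I" for x
    using assms(3)[OF that] by (simp add: abs_le_square_iff)
  have "set_integrable lborel I (\<lambda>x. (h x)\<^sup>2)"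
  proof (rule set_integrable_bound)
    show "set_integrable lborel I (\<lambda>x. (f x)\<^sup>2)" using assms(1) by (simp add: Lq_on_2_iff)
    show "set_borel_measurable lborel I (\<lambda>x. (h x)\<^sup>2)"
      using set_borel_measurable_compose2(1)[OF assms(2,2)] by (simp only: power2_eq_square)
    show "AE x in lborel. x \<in> I \<longrightarrow> norm ((h x)\<^sup>2) \<le> norm ((f x)\<^sup>2)"
      using le by (intro AE_I2) simp
  qed
  moreover from this show "Lq_on 2 I h" using assms(2) by (simp add: Lq_on_2_iff)
  ultimately show "(LBINT x:I. (h x)\<^sup>2) \<le> (LBINT x:I. (f x)\<^sup>2)"
    using assms(1) le by (intro set_integral_mono) (simp_all only: Lq_on_2_iff)
qed

lemma L2_mono_integral:
  assumes "Lq_on 2 I f" "J \<subseteq> I" "J \<in> sets borel"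
  shows "(LBINT x:J. (f x)\<^sup>2) \<le> (LBINT x:I. (f x)\<^sup>2)"
  using L2_mono[OF assms] assms unfolding set_lebesgue_integral_def
  by (intro integral_mono) (auto simp: Lq_on_2_iff set_integrable_def indicator_def)

lemma L2_Cauchy_Schwarz:
  assumes f: "Lq_on 2 I f" and g: "Lq_on 2 I g"
  shows "\<bar>LBINT x:I. f x * g x\<bar> \<le> sqrt (LBINT x:I. (f x)\<^sup>2) * sqrt (LBINT x:I. (g x)\<^sup>2)"
proof -
  define A B C where "A = (LBINT x:I. (f x)\<^sup>2)" and "B = (LBINT x:I. (g x)\<^sup>2)"
    and "C = (LBINT x:I. f x * g x)"
  have A: "0 \<le> A" "0 \<le> B"
    unfolding A_def B_def by (rule L2_integral_nonneg)+
  have q: "0 \<le> s\<^sup>2 * A + 2 * s * C + B" for s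
    using L2_integral_lincomb[OF f g, of s 1] L2_integral_nonneg[of I "\<lambda>x. s * f x + 1 * g x"]
    by (simp add: A_def B_def C_def)
  have "C\<^sup>2 \<le> A * B"
  proof (cases "A = 0")
    case True
    have "C = 0"
    proof (rule ccontr)
      assume "C \<noteq> 0"
      with q[of "- (B + 1) / (2 * C)"] True show False by (simp add: field_simps)
    qed
    with A show ?thesis by simp
  next
    case False
    with A q[of "- C / A"] show ?thesis by (simp add: field_simps power2_eq_square)
  qed
  then have "sqrt (C\<^sup>2) \<le> sqrt (A * B)" by (rule real_sqrt_le_mono)
  then show ?thesis unfolding real_sqrt_abs real_sqrt_mult A_def B_def C_def .
qed

lemma L2_const: "Lq_on 2 {a..b} (\<lambda>x. c)"
  using borel_integrable_atLeastAtMost'[of a b "\<lambda>x. c\<^sup>2"]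
  by (simp add: Lq_on_2_iff set_borel_measurable_def)

lemma L2_integrable:
  assumes "Lq_on 2 {a..b} g"
  shows "set_integrable lborel {a..b} g"
  using L2_mult_integrable[OF L2_const[of a b 1] assms] by simp

lemma L2_integral_abs_le:
  assumes "Lq_on 2 {a..b} g" "a \<le> b"
  shows "(LBINT x:{a..b}. \<bar>g x\<bar>) \<le> sqrt (b - a) * sqrt (LBINT x:{a..b}. (g x)\<^sup>2)"
proof -
  have m: "set_borel_measurable lborel {a..b} g" using assms by (simp add: Lq_on_2_iff)
  have "(\<lambda>x. \<bar>indicat_real {a..b} x *\<^sub>R g x\<bar>) \<in> borel_measurable lborel"
    using m by (intro borel_measurable_abs) (auto simp: set_borel_measurable_def)
  then have "set_borel_measurable lborel {a..b} (\<lambda>x. \<bar>g x\<bar>)"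
    by (simp add: set_borel_measurable_def abs_mult)
  then have "Lq_on 2 {a..b} (\<lambda>x. \<bar>g x\<bar>)"
    using L2_bound(1)[OF assms(1)] by simp
  from L2_Cauchy_Schwarz[OF L2_const[of a b 1] this] assms(2)
  show ?thesis by (simp add: set_integral_const)
qed

text \<open>Fatou's lemma for a sum of integrals over several sets: all summands are moved onto one
  copy of the line, so that the bound on the sum, rather than on each summand, passes to
  the limit.\<close>

lemma L2_fatou_sum:
  fixes h :: "nat \<Rightarrow> 'e \<Rightarrow> real \<Rightarrow> real"
  assumes E: "finite E"
    and h: "\<And>n e. e \<in> E \<Longrightarrow> Lq_on 2 (I e) (h n e)"
    and f: "\<And>e. e \<in> E \<Longrightarrow> set_borel_measurable lborel (I e) (f e)"
    and lim: "\<And>e. e \<in> E \<Longrightarrow> AE x in lborel. x \<in> I e \<longrightarrow> (\<lambda>n. h n e x) \<longlonglongrightarrow> f e x"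
    and B: "\<And>n. (\<Sum>e\<in>E. LBINT x:I e. (h n e x)\<^sup>2) \<le> B"
  shows "\<And>e. e \<in> E \<Longrightarrow> Lq_on 2 (I e) (f e)"
    and "(\<Sum>e\<in>E. LBINT x:I e. (f e x)\<^sup>2) \<le> B"
proof -
  define H where "H n x = (\<Sum>e\<in>E. indicat_real (I e) x *\<^sub>R (h n e x)\<^sup>2)" for n x
  define F where "F x = (\<Sum>e\<in>E. indicat_real (I e) x *\<^sub>R (f e x)\<^sup>2)" for x
  have ih: "integrable lborel (\<lambda>x. indicat_real (I e) x *\<^sub>R (h n e x)\<^sup>2)" if "e \<in> E" for e n
    using h[OF that, of n] by (simp only: Lq_on_2_iff set_integrable_def)
  have mf: "(\<lambda>x. indicat_real (I e) x *\<^sub>R (f e x)\<^sup>2) \<in> borel_measurable lborel" if "e \<in> E" for e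
    using set_borel_measurable_compose2(1)[OF f[OF that] f[OF that]]
    by (simp only: set_borel_measurable_def power2_eq_square)
  have mH [measurable]: "H n \<in> borel_measurable lborel" for n
    unfolding H_def[abs_def] by (intro borel_measurable_sum borel_measurable_integrable ih)
  have mF [measurable]: "F \<in> borel_measurable lborel"
    unfolding F_def[abs_def] by (intro borel_measurable_sum mf)
  have B0: "0 \<le> B" by (rule order_trans[OF sum_nonneg B[of 0]]) (rule L2_integral_nonneg)
  have Hint: "integrable lborel (H n)" and HB: "integral\<^sup>L lborel (H n) \<le> B" for n
  proof -
    show "integrable lborel (H n)"
      unfolding H_def[abs_def] by (intro Bochner_Integration.integrable_sum ih)
    have "integral\<^sup>L lborel (H n) = (\<Sum>e\<in>E. LBINT x:I e. (h n e x)\<^sup>2)"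
      unfolding H_def[abs_def] set_lebesgue_integral_def
      by (rule Bochner_Integration.integral_sum) (rule ih)
    then show "integral\<^sup>L lborel (H n) \<le> B" using B by simp
  qed
  have "AE x in lborel. \<forall>e\<in>E. x \<in> I e \<longrightarrow> (\<lambda>n. h n e x) \<longlonglongrightarrow> f e x"
    using lim by (intro AE_finite_allI[OF E])
  then have ae: "AE x in lborel. (\<lambda>n. H n x) \<longlonglongrightarrow> F x"
  proof eventually_elim
    case (elim x)
    then show ?case
      unfolding H_def F_def
    proof (intro tendsto_sum)
      fix e assume "e \<in> E"
      with elim show "(\<lambda>n. indicat_real (I e) x *\<^sub>R (h n e x)\<^sup>2) \<longlonglongrightarrow> indicat_real (I e) x *\<^sub>R (f e x)\<^sup>2"
        by (cases "x \<in> I e") (auto intro!: tendsto_power)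
    qed
  qed
  have "(\<integral>\<^sup>+x. ennreal (F x) \<partial>lborel) = (\<integral>\<^sup>+x. liminf (\<lambda>n. ennreal (H n x)) \<partial>lborel)"
  proof (rule nn_integral_cong_AE)
    show "AE x in lborel. ennreal (F x) = liminf (\<lambda>n. ennreal (H n x))"
      using ae
    proof eventually_elim
      case (elim x)
      then have "(\<lambda>n. ennreal (H n x)) \<longlonglongrightarrow> ennreal (F x)" by (rule tendsto_ennrealI)
      then show ?case by (simp add: lim_imp_Liminf)
    qed
  qed
  also have "\<dots> \<le> liminf (\<lambda>n. \<integral>\<^sup>+x. ennreal (H n x) \<partial>lborel)"
    by (rule nn_integral_liminf) simp
  also have "\<dots> \<le> liminf (\<lambda>n. ennreal B)"
  proof (rule Liminf_mono, rule always_eventually, rule allI)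
    fix n
    have "(\<integral>\<^sup>+x. ennreal (H n x) \<partial>lborel) = ennreal (integral\<^sup>L lborel (H n))"
      by (rule nn_integral_eq_integral[OF Hint]) (auto simp: H_def intro!: sum_nonneg)
    then show "(\<integral>\<^sup>+x. ennreal (H n x) \<partial>lborel) \<le> ennreal B" using HB by (simp add: ennreal_leI)
  qed
  also have "\<dots> = ennreal B" by (simp add: Liminf_const)
  finally have le: "(\<integral>\<^sup>+x. ennreal (F x) \<partial>lborel) \<le> ennreal B" .
  have F0: "0 \<le> F x" for x by (auto simp: F_def intro!: sum_nonneg)
  have Fint: "integrable lborel F"
    using le F0 by (auto simp: integrable_iff_bounded le_less_trans[OF _ ennreal_less_top])
  have FB: "integral\<^sup>L lborel F \<le> B"
    using le F0 B0 nn_integral_eq_integral[OF Fint] by simp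
  have i: "integrable lborel (\<lambda>x. indicat_real (I e) x *\<^sub>R (f e x)\<^sup>2)" if "e \<in> E" for e
  proof (rule Bochner_Integration.integrable_bound[OF Fint mf[OF that]])
    have "indicat_real (I e) x *\<^sub>R (f e x)\<^sup>2 \<le> F x" for x
      unfolding F_def using that E by (intro member_le_sum) auto
    then show "AE x in lborel. norm (indicat_real (I e) x *\<^sub>R (f e x)\<^sup>2) \<le> norm (F x)"
      using F0 by simp
  qed
  then show "Lq_on 2 (I e) (f e)" if "e \<in> E" for e
    using that f by (simp add: Lq_on_2_iff set_integrable_def)
  have "integral\<^sup>L lborel F = (\<Sum>e\<in>E. LBINT x:I e. (f e x)\<^sup>2)"
    unfolding F_def[abs_def] set_lebesgue_integral_def
    by (rule Bochner_Integration.integral_sum) (rule i)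
  with FB show "(\<Sum>e\<in>E. LBINT x:I e. (f e x)\<^sup>2) \<le> B" by simp
qed

lemma half_line_integral_FTC:
  fixes f :: "real \<Rightarrow> real"
  assumes c: "continuous_on UNIV f"
    and d: "\<And>x. 0 \<le> x \<Longrightarrow> DERIV F x :> f x"
    and nonneg: "\<And>x. 0 \<le> x \<Longrightarrow> 0 \<le> f x"
    and lim: "(F \<longlongrightarrow> T) at_top"
  shows "set_integrable lborel {0..} f" and "(LBINT x:{0..}. f x) = T - F 0"
proof -
  have m: "f \<in> borel_measurable borel" using c by (rule borel_measurable_continuous_onI)
  have FT: "F 0 \<le> T"
  proof (rule tendsto_lowerbound[OF lim])
    show "\<forall>\<^sub>F x in at_top. F 0 \<le> F x"
      using eventually_ge_at_top[of 0]
      by eventually_elim (auto intro!: DERIV_nonneg_imp_nondecreasing[of 0 _ F] exI[of _ "f _"] d nonneg)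
  qed simp
  have "(\<integral>\<^sup>+x. ennreal (f x) * indicator {0..} x \<partial>lborel) = ennreal (T - F 0)"
    by (rule nn_integral_FTC_atLeast[OF m d nonneg lim])
  also have "(\<integral>\<^sup>+x. ennreal (f x) * indicator {0..} x \<partial>lborel) =
      (\<integral>\<^sup>+x. ennreal (indicat_real {0..} x *\<^sub>R f x) \<partial>lborel)"
    by (intro nn_integral_cong) (simp add: indicator_def)
  finally have "has_bochner_integral lborel (\<lambda>x. indicat_real {0..} x *\<^sub>R f x) (T - F 0)"
    using FT nonneg m by (intro has_bochner_integral_nn_integral) (auto simp: indicator_def)
  then show "set_integrable lborel {0..} f" and "(LBINT x:{0..}. f x) = T - F 0"
    by (auto simp: has_bochner_integral_iff set_integrable_def set_lebesgue_integral_def)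
qed

lemma exp_decay_L2:
  shows "Lq_on 2 {0..} (\<lambda>x. exp (- x))" and "(LBINT x:{0..}. (exp (- x))\<^sup>2 :: real) = 1 / 2"
proof -
  have lim: "((\<lambda>x::real. - exp (- 2 * x) / 2) \<longlongrightarrow> 0) at_top" by real_asymp
  have e: "(exp (- x))\<^sup>2 = exp (- 2 * x)" for x :: real
    by (simp add: power2_eq_square flip: exp_add)
  have d: "DERIV (\<lambda>x. - exp (- 2 * x) / 2) x :> (exp (- x))\<^sup>2" for x :: real
    unfolding e by (auto intro!: derivative_eq_intros)
  have c: "continuous_on UNIV (\<lambda>x::real. (exp (- x))\<^sup>2)" by (intro continuous_intros)
  show "Lq_on 2 {0..} (\<lambda>x. exp (- x))"
    using half_line_integral_FTC(1)[OF c d _ lim]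
    by (auto simp: Lq_on_2_iff set_borel_measurable_def)
  show "(LBINT x:{0..}. (exp (- x))\<^sup>2 :: real) = 1 / 2"
    using half_line_integral_FTC(2)[OF c d _ lim] by simp
qed

text \<open>Completeness. The weight \<open>exp (- x)\<close> turns a Cauchy sequence in \<open>L\<^sup>2\<close> into one in \<open>L\<^sup>1\<close>,
  even on sets of infinite measure; an almost everywhere convergent subsequence then provides
  the limit, and Fatou's lemma shows that the convergence is in \<open>L\<^sup>2\<close>.\<close>

lemma L2_complete:
  fixes g :: "nat \<Rightarrow> real \<Rightarrow> real"
  assumes I: "I \<in> sets borel" "I \<subseteq> {0..}"
    and g: "\<And>n. Lq_on 2 I (g n)"
    and cauchy: "\<And>e. 0 < e \<Longrightarrow> \<exists>N. \<forall>m\<ge>N. \<forall>n\<ge>N. (LBINT x:I. (g m x - g n x)\<^sup>2) < e"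
  obtains G where "Lq_on 2 I G" "(\<lambda>n. LBINT x:I. (g n x - G x)\<^sup>2) \<longlonglongrightarrow> 0"
proof -
  let ?w = "\<lambda>x::real. exp (- x)"
  have w: "Lq_on 2 I ?w" using L2_mono[OF exp_decay_L2(1) I(2,1)] .
  define W where "W = sqrt (LBINT x:I. (?w x)\<^sup>2)"
  define h where "h n x = indicat_real I x *\<^sub>R (exp (- x) * g n x)" for n x
  have hint: "integrable lborel (h n)" for n
    using L2_mult_integrable[OF w g[of n]] by (simp add: h_def[abs_def] set_integrable_def)
  have hdiff: "(LINT x|lborel. norm (h m x - h n x)) \<le> W * sqrt (LBINT x:I. (g m x - g n x)\<^sup>2)" for m n
  proof -
    have d: "Lq_on 2 I (\<lambda>x. g m x - g n x)" by (rule L2_diff[OF g g])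
    have "(\<lambda>x. \<bar>indicat_real I x *\<^sub>R (g m x - g n x)\<bar>) \<in> borel_measurable lborel"
      using d by (intro borel_measurable_abs) (auto simp: Lq_on_2_iff set_borel_measurable_def)
    then have "set_borel_measurable lborel I (\<lambda>x. \<bar>g m x - g n x\<bar>)"
      by (simp add: set_borel_measurable_def abs_mult)
    then have a: "Lq_on 2 I (\<lambda>x. \<bar>g m x - g n x\<bar>)" using L2_bound(1)[OF d] by simp
    have "(LINT x|lborel. norm (h m x - h n x)) = (LBINT x:I. exp (- x) * \<bar>g m x - g n x\<bar>)"
      unfolding set_lebesgue_integral_def
      by (intro Bochner_Integration.integral_cong refl)
         (simp add: h_def indicator_def abs_mult flip: right_diff_distrib)
    also have "\<dots> \<le> W * sqrt (LBINT x:I. \<bar>g m x - g n x\<bar>\<^sup>2)"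
      using L2_Cauchy_Schwarz[OF w a] unfolding W_def by (rule order_trans[OF abs_ge_self])
    finally show ?thesis by simp
  qed
  have W0: "0 \<le> W" unfolding W_def by (intro real_sqrt_ge_zero L2_integral_nonneg)
  have hC: "\<exists>N. \<forall>i\<ge>N. \<forall>j\<ge>N. (LINT x|lborel. norm (h i x - h j x)) < e" if "0 < e" for e
  proof -
    have "0 < (e / (W + 1))\<^sup>2" using that W0 by simp
    from cauchy[OF this] obtain N
      where N: "\<And>m n. N \<le> m \<Longrightarrow> N \<le> n \<Longrightarrow> (LBINT x:I. (g m x - g n x)\<^sup>2) < (e / (W + 1))\<^sup>2"
      by blast
    have "(LINT x|lborel. norm (h i x - h j x)) < e" if "N \<le> i" "N \<le> j" for i j
    proof -
      have "sqrt (LBINT x:I. (g i x - g j x)\<^sup>2) \<le> e / (W + 1)"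
        using N[OF that] W0 \<open>0 < e\<close> by (intro real_le_lsqrt) auto
      then have "(LINT x|lborel. norm (h i x - h j x)) \<le> W * (e / (W + 1))"
        using order_trans[OF hdiff[of i j] mult_left_mono[OF _ W0]] by blast
      also have "\<dots> < e" using W0 \<open>0 < e\<close> by (simp add: pos_divide_less_eq algebra_simps)
      finally show ?thesis .
    qed
    then show ?thesis by (intro exI[of _ N] allI impI)
  qed
  obtain r where r: "strict_mono r" and ae: "AE x in lborel. Cauchy (\<lambda>i. h (r i) x)"
    by (rule cauchy_L1_AE_cauchy_subseq[OF hint hC])
  define G where "G x = exp x * lim (\<lambda>i. h (r i) x)" for x
  have "G \<in> borel_measurable lborel"
    unfolding G_def[abs_def] using borel_measurable_integrable[OF hint]
    by (intro borel_measurable_times borel_measurable_lim_metric) auto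
  then have "(\<lambda>x. indicat_real I x *\<^sub>R G x) \<in> borel_measurable lborel"
    using I(1) by (intro borel_measurable_scaleR) auto
  then have mG: "set_borel_measurable lborel I G"
    by (simp only: set_borel_measurable_def)
  have lim: "AE x in lborel. x \<in> I \<longrightarrow> (\<lambda>i. g (r i) x) \<longlonglongrightarrow> G x"
    using ae
  proof eventually_elim
    case (elim x)
    show ?case
    proof
      assume x: "x \<in> I"
      have "(\<lambda>i. h (r i) x) \<longlonglongrightarrow> lim (\<lambda>i. h (r i) x)"
        by (rule convergent_LIMSEQ_iff[THEN iffD1, OF real_Cauchy_convergent[OF elim]])
      then have "(\<lambda>i. exp x * h (r i) x) \<longlonglongrightarrow> G x"
        unfolding G_def by (intro tendsto_mult tendsto_const)
      moreover have "exp x * h (r i) x = g (r i) x" for i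
      proof -
        have "exp x * h (r i) x = (exp x * exp (- x)) * g (r i) x"
          using x by (simp only: h_def mult.assoc) simp
        then show ?thesis by (simp add: exp_minus)
      qed
      ultimately show "(\<lambda>i. g (r i) x) \<longlonglongrightarrow> G x" by simp
    qed
  qed
  have key: "Lq_on 2 I (\<lambda>x. g n x - G x) \<and> (LBINT x:I. (g n x - G x)\<^sup>2) \<le> e"
    if N: "\<And>m n. N \<le> m \<Longrightarrow> N \<le> n \<Longrightarrow> (LBINT x:I. (g m x - g n x)\<^sup>2) < e" and n: "N \<le> n" for N e n
  proof -
    have m1: "set_borel_measurable lborel I (\<lambda>x. g n x - G x)"
      using set_borel_measurable_compose2(2)[OF _ set_borel_measurable_cmult[OF mG, of "-1"], of "g n"] g[of n]
      by (simp add: Lq_on_2_iff)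
    have a1: "AE x in lborel. x \<in> I \<longrightarrow> (\<lambda>k. g n x - g (r (k + N)) x) \<longlonglongrightarrow> g n x - G x"
      using lim
    proof eventually_elim
      case (elim x)
      then show ?case
        using LIMSEQ_ignore_initial_segment[of "\<lambda>k. g (r k) x" "G x" N] by (auto intro!: tendsto_intros)
    qed
    have b1: "(LBINT x:I. (g n x - g (r (k + N)) x)\<^sup>2) \<le> e" for k
      using N[OF n, of "r (k + N)"] seq_suble[OF r, of "k + N"] by simp
    show ?thesis
      using L2_fatou_sum[of "{()}" "\<lambda>_. I" "\<lambda>k _ x. g n x - g (r (k + N)) x" "\<lambda>_ x. g n x - G x" e]
        L2_diff[OF g g] m1 a1 b1 by simp
  qed
  show ?thesis
  proof
    obtain N where "\<And>m n. N \<le> m \<Longrightarrow> N \<le> n \<Longrightarrow> (LBINT x:I. (g m x - g n x)\<^sup>2) < 1"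
      using cauchy[of 1] by auto
    from key[OF this order_refl] have "Lq_on 2 I (\<lambda>x. g N x - G x)" by simp
    from L2_diff[OF g this, of N] show "Lq_on 2 I G" by simp
    show "(\<lambda>n. LBINT x:I. (g n x - G x)\<^sup>2) \<longlonglongrightarrow> 0"
    proof (rule LIMSEQ_I)
      fix e :: real assume "0 < e"
      then obtain N where "\<And>m n. N \<le> m \<Longrightarrow> N \<le> n \<Longrightarrow> (LBINT x:I. (g m x - g n x)\<^sup>2) < e / 2"
        using cauchy[of "e / 2"] by auto
      from key[OF this] have "(LBINT x:I. (g n x - G x)\<^sup>2) \<le> e / 2" if "N \<le> n" for n
        using that by blast
      moreover have "0 \<le> (LBINT x:I. (g n x - G x)\<^sup>2)" for n by (rule L2_integral_nonneg)
      ultimately show "\<exists>no. \<forall>n\<ge>no. norm ((LBINT x:I. (g n x - G x)\<^sup>2) - 0) < e"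
        using \<open>0 < e\<close> by (force intro!: exI[of _ N])
    qed
  qed
qed

section \<open>Absolutely continuous functions\<close>

text \<open>Local absolute continuity on an interval, in the form of the fundamental theorem of
  calculus: \<open>g\<close> is a version of the derivative of \<open>f\<close>.\<close>

definition AC_on :: "real set \<Rightarrow> (real \<Rightarrow> real) \<Rightarrow> (real \<Rightarrow> real) \<Rightarrow> bool" where
  "AC_on I f g \<longleftrightarrow>
     (\<forall>x\<in>I. \<forall>y\<in>I. x \<le> y \<longrightarrow> set_integrable lborel {x..y} g \<and> f y - f x = (LBINT t:{x..y}. g t))"

lemma AC_onD:
  assumes "AC_on I f g" "x \<in> I" "y \<in> I" "x \<le> y"
  shows "set_integrable lborel {x..y} g" "f y - f x = (LBINT t:{x..y}. g t)"
  using assms by (auto simp: AC_on_def)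

lemma set_integral_Icc_combine:
  fixes g :: "real \<Rightarrow> real"
  assumes "set_integrable lborel {a..c} g" "a \<le> b" "b \<le> c"
  shows "(LBINT t:{a..c}. g t) = (LBINT t:{a..b}. g t) + (LBINT t:{b..c}. g t)"
proof -
  have i: "set_integrable lborel {a..b} g" "set_integrable lborel {b..c} g"
    using assms by (auto intro: set_integrable_subset)
  have "integral {a..c} g = integral {a..b} g + integral {b..c} g"
    by (rule Henstock_Kurzweil_Integration.integral_combine[symmetric, OF assms(2,3)
          set_borel_integral_eq_integral(1)[OF assms(1)]])
  then show ?thesis
    using i assms(1) by (simp add: set_borel_integral_eq_integral(2))
qed

lemma set_integral_abs_le:
  fixes g :: "real \<Rightarrow> real"
  assumes "set_integrable lborel I g"
  shows "\<bar>LBINT t:I. g t\<bar> \<le> (LBINT t:I. \<bar>g t\<bar>)"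
  using integral_abs_bound[of lborel "\<lambda>t. indicat_real I t *\<^sub>R g t"]
  by (simp add: set_lebesgue_integral_def abs_mult)

lemma AC_on_from_0:
  assumes "\<And>x. x \<in> I \<Longrightarrow> 0 \<le> x \<and> set_integrable lborel {0..x} g \<and> f x = f 0 + (LBINT t:{0..x}. g t)"
  shows "AC_on I f g"
  unfolding AC_on_def
proof (intro ballI impI conjI)
  fix x y assume xy: "x \<in> I" "y \<in> I" "x \<le> y"
  show "set_integrable lborel {x..y} g"
    using assms[OF xy(1)] assms[OF xy(2)] by (auto intro: set_integrable_subset)
  show "f y - f x = (LBINT t:{x..y}. g t)"
    using assms[OF xy(1)] assms[OF xy(2)] set_integral_Icc_combine[of 0 y g x] xy(3) by simp
qed

lemma AC_continuous:
  assumes "AC_on I f g" "x \<in> I" "y \<in> I" "x \<le> y" "{x..y} \<subseteq> I"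
  shows "continuous_on {x..y} f"
proof -
  have i: "g integrable_on {x..y}"
    using AC_onD(1)[OF assms(1-4)] by (rule set_borel_integral_eq_integral(1))
  have "continuous_on {x..y} (\<lambda>t. f x + integral {x..t} g)"
    by (intro continuous_intros indefinite_integral_continuous_1 i)
  moreover have "f x + integral {x..t} g = f t" if "t \<in> {x..y}" for t
    using AC_onD[OF assms(1,2), of t] that assms(5)
    by (auto simp: set_borel_integral_eq_integral(2))
  ultimately show ?thesis by (rule continuous_on_eq)
qed

lemma continuous_mult_integrable:
  fixes k g :: "real \<Rightarrow> real"
  assumes k: "continuous_on {a..b} k" and g: "set_integrable lborel {a..b} g"
  shows "set_integrable lborel {a..b} (\<lambda>t. k t * g t)"
proof -
  obtain M where M: "\<And>t. t \<in> {a..b} \<Longrightarrow> \<bar>k t\<bar> \<le> M"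
    using compact_imp_bounded[OF compact_continuous_image[OF k compact_Icc]]
    unfolding bounded_iff by fastforce
  have mk: "set_borel_measurable lborel {a..b} k"
    using borel_measurable_continuous_on_indicator[OF _ k] by (simp add: set_borel_measurable_def)
  have mg: "set_borel_measurable lborel {a..b} g"
    using g unfolding set_integrable_def set_borel_measurable_def by (rule borel_measurable_integrable)
  show ?thesis
  proof (rule set_integrable_bound)
    show "set_integrable lborel {a..b} (\<lambda>t. M * g t)" using g by simp
    show "set_borel_measurable lborel {a..b} (\<lambda>t. k t * g t)"
      by (rule set_borel_measurable_compose2(1)[OF mk mg])
    have "\<bar>k t\<bar> * \<bar>g t\<bar> \<le> \<bar>M\<bar> * \<bar>g t\<bar>" if "t \<in> {a..b}" for t
      using M[OF that] by (intro mult_right_mono) auto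
    then show "AE t in lborel. t \<in> {a..b} \<longrightarrow> norm (k t * g t) \<le> norm (M * g t)"
      by (auto simp: abs_mult)
  qed
qed

text \<open>A local-to-global principle: the defect \<open>h d - h c - \<integral> k\<close> is an additive interval
  function, so the local bounds by \<open>e \<integral> w\<close> add up to the same bound on \<open>{a..b}\<close>, and \<open>e\<close> is
  arbitrary. This yields the chain rule below without differentiating integrals at almost
  every point.\<close>

lemma increment_eq_integral:
  fixes h k w :: "real \<Rightarrow> real"
  assumes ab: "a \<le> b" and k: "set_integrable lborel {a..b} k" and w: "set_integrable lborel {a..b} w"
    and loc: "\<And>e x. 0 < e \<Longrightarrow> x \<in> {a..b} \<Longrightarrow>
      \<exists>\<delta>>0. \<forall>c d. a \<le> c \<and> c \<le> x \<and> x \<le> d \<and> d \<le> b \<and> d - c < \<delta> \<longrightarrow>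
        \<bar>h d - h c - (LBINT t:{c..d}. k t)\<bar> \<le> e * (LBINT t:{c..d}. w t)"
  shows "h b - h a = (LBINT t:{a..b}. k t)"
proof -
  have *: "\<bar>h b - h a - (LBINT t:{a..b}. k t)\<bar> \<le> e * (LBINT t:{a..b}. w t)" if e: "0 < e" for e
  proof -
    let ?P = "\<lambda>c d. a \<le> c \<longrightarrow> d \<le> b \<longrightarrow>
        \<bar>h d - h c - (LBINT t:{c..d}. k t)\<bar> \<le> e * (LBINT t:{c..d}. w t)"
    have "?P a b"
    proof (rule Bolzano[OF ab, of ?P])
      fix c m d :: real assume P: "?P c m" "?P m d" "c \<le> m" "m \<le> d"
      show "?P c d"
      proof (intro impI)
        assume cd: "a \<le> c" "d \<le> b"
        have "set_integrable lborel {c..d} k" "set_integrable lborel {c..d} w"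
          using cd k w by (auto intro: set_integrable_subset)
        then have "(LBINT t:{c..d}. k t) = (LBINT t:{c..m}. k t) + (LBINT t:{m..d}. k t)"
          "(LBINT t:{c..d}. w t) = (LBINT t:{c..m}. w t) + (LBINT t:{m..d}. w t)"
          using P by (auto intro: set_integral_Icc_combine)
        with P cd show "\<bar>h d - h c - (LBINT t:{c..d}. k t)\<bar> \<le> e * (LBINT t:{c..d}. w t)"
          by (simp add: distrib_left)
      qed
    next
      fix x assume "a \<le> x" "x \<le> b"
      with loc[OF e, of x] show "\<exists>\<delta>>0. \<forall>c d. c \<le> x \<and> x \<le> d \<and> d - c < \<delta> \<longrightarrow> ?P c d"
        by (simp del: mult_le_0_iff) blast
    qed
    then show ?thesis by simp
  qed
  show ?thesis
  proof (rule ccontr)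
    let ?v = "\<bar>h b - h a - (LBINT t:{a..b}. k t)\<bar>" and ?W = "\<bar>LBINT t:{a..b}. w t\<bar>"
    assume "h b - h a \<noteq> (LBINT t:{a..b}. k t)"
    then have v: "0 < ?v" by simp
    define e where "e = ?v / (2 * (?W + 1))"
    have e: "0 < e" using v by (simp add: e_def)
    have "?v \<le> e * ?W"
      using *[OF e] e by (meson abs_ge_self mult_left_mono order_less_imp_le order_trans)
    also have "e * ?W < e * (2 * (?W + 1))" using e by (intro mult_strict_left_mono) auto
    also have "\<dots> = ?v"
    proof -
      have "0 < 2 * (?W + 1)" by (intro mult_pos_pos add_nonneg_pos) auto
      then have "2 * (?W + 1) \<noteq> 0" by (rule less_imp_neq[symmetric])
      then show ?thesis unfolding e_def by (rule nonzero_eq_divide_eq[THEN iffD1]) (rule refl)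
    qed
    finally show False by (rule less_irrefl[THEN notE])
  qed
qed

text \<open>By the mean value theorem and the continuity of \<open>f\<close>, an increment of \<open>F \<circ> f\<close> over \<open>{c..d}\<close> is
  \<open>F' (f s)\<close> times the integral of \<open>g\<close> for some \<open>s\<close> in \<open>{c..d}\<close>; replacing \<open>F' (f s)\<close> by
  \<open>F' (f t)\<close> under the integral costs a small multiple of the integral of \<open>\<bar>g\<bar>\<close>.\<close>

lemma AC_chain:
  assumes I: "is_interval I" and f: "AC_on I f g"
    and F: "\<And>x. x \<in> I \<Longrightarrow> (F has_real_derivative F' (f x)) (at (f x))"
    and F': "continuous_on (f ` I) F'"
  shows "AC_on I (\<lambda>x. F (f x)) (\<lambda>x. F' (f x) * g x)"
  unfolding AC_on_def
proof (intro ballI impI)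
  fix a b assume ab: "a \<in> I" "b \<in> I" "a \<le> b"
  have sub: "{a..b} \<subseteq> I" using I ab by (meson atLeastAtMost_iff mem_is_interval_1_I subsetI)
  have cf: "continuous_on {a..b} f" by (rule AC_continuous[OF f ab sub])
  have cF: "continuous_on {a..b} (\<lambda>t. F' (f t))"
    by (rule continuous_on_compose2[OF F' cf]) (use sub in auto)
  have g: "set_integrable lborel {a..b} g" by (rule AC_onD(1)[OF f ab])
  have k: "set_integrable lborel {a..b} (\<lambda>t. F' (f t) * g t)"
    by (rule continuous_mult_integrable[OF cF g])
  have incr: "\<exists>s\<in>{c..d}. F (f d) - F (f c) = F' (f s) * (f d - f c)" if cd: "a \<le> c" "c \<le> d" "d \<le> b" for c d
  proof -
    have "is_interval (f ` {c..d})"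
      unfolding is_interval_connected_1
      by (intro connected_continuous_image continuous_on_subset[OF cf]) (use cd in auto)
    then have btw: "z \<in> f ` {c..d}" if "min (f c) (f d) \<le> z" "z \<le> max (f c) (f d)" for z
      using mem_is_interval_1_I[of "f ` {c..d}" "min (f c) (f d)" "max (f c) (f d)" z] that cd
      by (auto simp: min_def max_def)
    have D: "(F has_real_derivative F' z) (at z)" if "min (f c) (f d) \<le> z" "z \<le> max (f c) (f d)" for z
    proof -
      obtain s where "s \<in> {c..d}" "z = f s" using btw[OF \<open>min (f c) (f d) \<le> z\<close> \<open>z \<le> max (f c) (f d)\<close>] by auto
      moreover from this have "s \<in> I" using sub cd by (intro subsetD[OF sub]) auto
      ultimately show ?thesis using F[of s] by simp
    qed
    consider "f c = f d" | "f c < f d" | "f d < f c" by linarith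
    then show ?thesis
    proof cases
      case 1 then show ?thesis using cd by (auto intro!: bexI[of _ c])
    next
      case 2
      then obtain z where z: "f c < z" "z < f d" "F (f d) - F (f c) = (f d - f c) * F' z"
        using MVT2[of "f c" "f d" F F'] D by auto
      with btw[of z] 2 show ?thesis by (auto simp: mult.commute)
    next
      case 3
      then obtain z where z: "f d < z" "z < f c" "F (f c) - F (f d) = (f c - f d) * F' z"
        using MVT2[of "f d" "f c" F F'] D by auto
      then have "F (f d) - F (f c) = F' z * (f d - f c)" by (simp add: algebra_simps)
      with btw[of z] 3 z(1,2) show ?thesis by auto
    qed
  qed
  have "F (f b) - F (f a) = (LBINT t:{a..b}. F' (f t) * g t)"
  proof (rule increment_eq_integral[OF ab(3) k set_integrable_abs[OF g]])
    fix e x :: real assume e: "0 < e" and x: "x \<in> {a..b}"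
    obtain \<delta> where \<delta>: "0 < \<delta>" "\<And>t. t \<in> {a..b} \<Longrightarrow> \<bar>t - x\<bar> < \<delta> \<Longrightarrow> \<bar>F' (f t) - F' (f x)\<bar> < e / 2"
      using cF[unfolded continuous_on_iff, rule_format, OF x, of "e / 2"] e by (auto simp: dist_real_def)
    show "\<exists>\<delta>>0. \<forall>c d. a \<le> c \<and> c \<le> x \<and> x \<le> d \<and> d \<le> b \<and> d - c < \<delta> \<longrightarrow>
        \<bar>F (f d) - F (f c) - (LBINT t:{c..d}. F' (f t) * g t)\<bar> \<le> e * (LBINT t:{c..d}. \<bar>g t\<bar>)"
    proof (intro exI[of _ \<delta>] conjI allI impI \<delta>(1))
      fix c d assume cd: "a \<le> c \<and> c \<le> x \<and> x \<le> d \<and> d \<le> b \<and> d - c < \<delta>"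
      then obtain s where s: "s \<in> {c..d}" "F (f d) - F (f c) = F' (f s) * (f d - f c)"
        using incr[of c d] by auto
      have gi: "set_integrable lborel {c..d} g" and ki: "set_integrable lborel {c..d} (\<lambda>t. F' (f t) * g t)"
        using cd g k by (auto intro: set_integrable_subset)
      have "f d - f c = (LBINT t:{c..d}. g t)"
        using sub cd by (intro AC_onD(2)[OF f]) auto
      then have "F (f d) - F (f c) - (LBINT t:{c..d}. F' (f t) * g t) =
          (LBINT t:{c..d}. F' (f s) * g t - F' (f t) * g t)"
        using gi ki s(2) by (subst set_integral_diff) auto
      also have "\<bar>\<dots>\<bar> \<le> (LBINT t:{c..d}. \<bar>F' (f s) * g t - F' (f t) * g t\<bar>)"
        by (rule set_integral_abs_le) (use gi ki in auto)
      also have "\<dots> \<le> (LBINT t:{c..d}. e * \<bar>g t\<bar>)"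
      proof (rule set_integral_mono)
        show "set_integrable lborel {c..d} (\<lambda>t. \<bar>F' (f s) * g t - F' (f t) * g t\<bar>)"
          using gi ki by (intro set_integrable_abs) auto
        show "set_integrable lborel {c..d} (\<lambda>t. e * \<bar>g t\<bar>)"
          using set_integrable_abs[OF gi] by simp
        fix t assume t: "t \<in> {c..d}"
        have "\<bar>F' (f t) - F' (f x)\<bar> < e / 2" "\<bar>F' (f s) - F' (f x)\<bar> < e / 2"
          by (rule \<delta>(2); use cd t s(1) in auto)+
        then have "\<bar>F' (f s) - F' (f t)\<bar> \<le> e" by linarith
        then show "\<bar>F' (f s) * g t - F' (f t) * g t\<bar> \<le> e * \<bar>g t\<bar>"
          by (simp add: abs_mult mult_right_mono flip: left_diff_distrib)
      qed
      finally show "\<bar>F (f d) - F (f c) - (LBINT t:{c..d}. F' (f t) * g t)\<bar> \<le> e * (LBINT t:{c..d}. \<bar>g t\<bar>)"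
        by simp
    qed
  qed
  with k show "set_integrable lborel {a..b} (\<lambda>t. F' (f t) * g t) \<and>
      F (f b) - F (f a) = (LBINT t:{a..b}. F' (f t) * g t)" by simp
qed

lemma AC_lincomb:
  assumes "AC_on I f g" "AC_on I h k"
  shows "AC_on I (\<lambda>x. a * f x + b * h x) (\<lambda>x. a * g x + b * k x)"
  unfolding AC_on_def
proof (intro ballI impI conjI)
  fix x y assume xy: "x \<in> I" "y \<in> I" "x \<le> y"
  note D = AC_onD[OF assms(1) xy] AC_onD[OF assms(2) xy]
  show "set_integrable lborel {x..y} (\<lambda>x. a * g x + b * k x)" using D by simp
  have "(LBINT t:{x..y}. a * g t + b * k t) = (LBINT t:{x..y}. a * g t) + (LBINT t:{x..y}. b * k t)"
    using D by (intro set_integral_add) auto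
  then show "a * f y + b * h y - (a * f x + b * h x) = (LBINT t:{x..y}. a * g t + b * k t)"
    using D by (simp add: algebra_simps)
qed

lemma AC_square:
  assumes "is_interval I" "AC_on I f g"
  shows "AC_on I (\<lambda>x. (f x)\<^sup>2) (\<lambda>x. 2 * f x * g x)"
  by (rule AC_chain[OF assms, of "\<lambda>x. x\<^sup>2" "\<lambda>x. 2 * x"])
     (auto intro!: derivative_eq_intros continuous_intros)

text \<open>Polarization reduces products to squares.\<close>

lemma AC_mult:
  assumes I: "is_interval I" and f: "AC_on I f g" and h: "AC_on I h k"
  shows "AC_on I (\<lambda>x. f x * h x) (\<lambda>x. f x * k x + g x * h x)"
proof -
  have "AC_on I (\<lambda>x. (1/4) * (1 * f x + 1 * h x)\<^sup>2 + (- 1/4) * (1 * f x + (- 1) * h x)\<^sup>2)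
     (\<lambda>x. (1/4) * (2 * (1 * f x + 1 * h x) * (1 * g x + 1 * k x)) +
          (- 1/4) * (2 * (1 * f x + (- 1) * h x) * (1 * g x + (- 1) * k x)))"
    by (intro AC_lincomb AC_square I f h)
  moreover have "(1/4) * (1 * f x + 1 * h x)\<^sup>2 + (- 1/4) * (1 * f x + (- 1) * h x)\<^sup>2 = f x * h x" for x
    by (simp add: power2_eq_square algebra_simps)
  moreover have "(1/4) * (2 * (1 * f x + 1 * h x) * (1 * g x + 1 * k x)) +
          (- 1/4) * (2 * (1 * f x + (- 1) * h x) * (1 * g x + (- 1) * k x)) = f x * k x + g x * h x" for x
    by (simp add: algebra_simps)
  ultimately show ?thesis by simp
qed

lemma AC_of_continuous_deriv:
  assumes "\<And>x. (f has_real_derivative f' x) (at x)" "continuous_on UNIV f'"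
  shows "AC_on I f f'"
  unfolding AC_on_def
proof (intro ballI impI conjI)
  fix x y :: real assume xy: "x \<le> y"
  have c: "continuous_on {x..y} f'" using assms(2) by (rule continuous_on_subset) simp
  show "set_integrable lborel {x..y} f'" by (rule borel_integrable_atLeastAtMost'[OF c])
  have "(f has_vector_derivative f' t) (at t within {x..y})" for t
    using assms(1) by (simp add: has_real_derivative_iff_has_vector_derivative has_vector_derivative_at_within)
  from integral_FTC_atLeastAtMost[OF xy this c]
  show "f y - f x = (LBINT t:{x..y}. f' t)" by (simp add: set_lebesgue_integral_def)
qed

subsection \<open>Sobolev functions\<close>

text \<open>The pairs of a function in \<open>H\<^sup>1(I)\<close>, in its continuous version, and a weak derivative.\<close>

definition H1_pair :: "real set \<Rightarrow> (real \<Rightarrow> real) \<Rightarrow> (real \<Rightarrow> real) \<Rightarrow> bool" where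
  "H1_pair I f g \<longleftrightarrow> AC_on I f g \<and> Lq_on 2 I f \<and> Lq_on 2 I g"

lemma H1_pair_lincomb:
  "H1_pair I f g \<Longrightarrow> H1_pair I h k \<Longrightarrow> H1_pair I (\<lambda>x. a * f x + b * h x) (\<lambda>x. a * g x + b * k x)"
  by (simp add: H1_pair_def AC_lincomb L2_lincomb)

lemma H1_pair_cmult: "H1_pair I f g \<Longrightarrow> H1_pair I (\<lambda>x. a * f x) (\<lambda>x. a * g x)"
  using H1_pair_lincomb[of I f g f g a 0] by simp

lemma L2_integral_abs_le_mono:
  assumes "Lq_on 2 I g" "{x..y} \<subseteq> I" "x \<le> y"
  shows "\<bar>LBINT t:{x..y}. g t\<bar> \<le> sqrt (y - x) * sqrt (LBINT t:I. (g t)\<^sup>2)"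
proof -
  have g: "Lq_on 2 {x..y} g" using L2_mono[OF assms(1,2)] by simp
  have "\<bar>LBINT t:{x..y}. g t\<bar> \<le> (LBINT t:{x..y}. \<bar>g t\<bar>)"
    by (rule set_integral_abs_le[OF L2_integrable[OF g]])
  also have "\<dots> \<le> sqrt (y - x) * sqrt (LBINT t:{x..y}. (g t)\<^sup>2)"
    by (rule L2_integral_abs_le[OF g assms(3)])
  also have "\<dots> \<le> sqrt (y - x) * sqrt (LBINT t:I. (g t)\<^sup>2)"
    using L2_mono_integral[OF assms(1,2)] assms(3) by (intro mult_left_mono) auto
  finally show ?thesis .
qed

lemma is_interval_Icc_subset:
  fixes I :: "real set"
  assumes "is_interval I" "x \<in> I" "y \<in> I"
  shows "{x..y} \<subseteq> I"
  using assms by (meson atLeastAtMost_iff mem_is_interval_1_I subsetI)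

lemma AC_holder:
  assumes I: "is_interval I" and f: "AC_on I f g" "Lq_on 2 I g" and xy: "x \<in> I" "y \<in> I"
  shows "\<bar>f y - f x\<bar> \<le> sqrt \<bar>y - x\<bar> * sqrt (LBINT t:I. (g t)\<^sup>2)"
proof -
  have *: "\<bar>f y - f x\<bar> \<le> sqrt (y - x) * sqrt (LBINT t:I. (g t)\<^sup>2)" if "x \<in> I" "y \<in> I" "x \<le> y" for x y
    using AC_onD(2)[OF f(1) that] L2_integral_abs_le_mono[OF f(2) is_interval_Icc_subset[OF I that(1,2)] that(3)]
    by simp
  show ?thesis
    using *[OF xy] *[OF xy(2,1)] by (cases "x \<le> y") (auto simp: abs_minus_commute)
qed

lemma AC_L2_continuous:
  assumes I: "is_interval I" and f: "AC_on I f g" "Lq_on 2 I g"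
  shows "continuous_on I f"
  unfolding continuous_on_iff
proof (intro ballI allI impI)
  fix x e :: real assume x: "x \<in> I" and e: "0 < e"
  define D where "D = sqrt (LBINT t:I. (g t)\<^sup>2) + 1"
  have D: "1 \<le> D" by (simp add: D_def L2_integral_nonneg)
  show "\<exists>d>0. \<forall>y\<in>I. dist y x < d \<longrightarrow> dist (f y) (f x) < e"
  proof (intro exI[of _ "(e / D)\<^sup>2"] conjI ballI impI)
    show "0 < (e / D)\<^sup>2" using e D by simp
    fix y assume y: "y \<in> I" and d: "dist y x < (e / D)\<^sup>2"
    have "\<bar>f y - f x\<bar> \<le> sqrt \<bar>y - x\<bar> * sqrt (LBINT t:I. (g t)\<^sup>2)"
      by (rule AC_holder[OF I f x y])
    also have "\<dots> \<le> sqrt \<bar>y - x\<bar> * D" by (intro mult_left_mono) (auto simp: D_def)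
    also have "sqrt \<bar>y - x\<bar> < e / D"
      using d e D by (intro real_less_lsqrt) (auto simp: dist_real_def)
    then have "sqrt \<bar>y - x\<bar> * D < e" using D by (simp add: field_simps)
    finally show "dist (f y) (f x) < e" by (simp add: dist_real_def)
  qed
qed

text \<open>The one-dimensional Gagliardo--Nirenberg inequality on a bounded interval: \<open>f\<^sup>2\<close> has the
  integrable derivative \<open>2 f g\<close> and is at some point no larger than its mean.\<close>

lemma H1_pair_sup_bound:
  assumes l: "0 < l" and f: "H1_pair {0..l} f g" and x: "x \<in> {0..l}"
  shows "(f x)\<^sup>2 \<le> (LBINT t:{0..l}. (f t)\<^sup>2) / l
    + 2 * sqrt (LBINT t:{0..l}. (f t)\<^sup>2) * sqrt (LBINT t:{0..l}. (g t)\<^sup>2)"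
proof -
  let ?I = "{0..l}"
  have I: "is_interval ?I" by simp
  have AC: "AC_on ?I f g" and L: "Lq_on 2 ?I f" "Lq_on 2 ?I g" using f by (auto simp: H1_pair_def)
  have c: "continuous_on ?I f" by (rule AC_L2_continuous[OF I AC L(2)])
  obtain y where y: "y \<in> ?I" "\<And>t. t \<in> ?I \<Longrightarrow> (f y)\<^sup>2 \<le> (f t)\<^sup>2"
    using continuous_attains_inf[of ?I "\<lambda>t. (f t)\<^sup>2"] continuous_on_power[OF c, of 2] l
    by (auto simp del: atLeastAtMost_iff)
  have "(LBINT t:?I. (f y)\<^sup>2) \<le> (LBINT t:?I. (f t)\<^sup>2)"
    using L L2_const[of 0 l "f y"] y(2) by (intro set_integral_mono) (auto simp: Lq_on_2_iff)
  then have m: "(f y)\<^sup>2 \<le> (LBINT t:?I. (f t)\<^sup>2) / l"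
    using l by (simp add: set_integral_const field_simps)
  have AC2: "AC_on ?I (\<lambda>t. (f t)\<^sup>2) (\<lambda>t. 2 * f t * g t)" by (rule AC_square[OF I AC])
  have *: "\<bar>(f b)\<^sup>2 - (f a)\<^sup>2\<bar> \<le> 2 * sqrt (LBINT t:?I. (f t)\<^sup>2) * sqrt (LBINT t:?I. (g t)\<^sup>2)"
    if ab: "a \<in> ?I" "b \<in> ?I" "a \<le> b" for a b
  proof -
    have s: "{a..b} \<subseteq> ?I" using ab by auto
    have L': "Lq_on 2 {a..b} f" "Lq_on 2 {a..b} g" using L2_mono[OF L(1) s] L2_mono[OF L(2) s] by auto
    have "\<bar>(f b)\<^sup>2 - (f a)\<^sup>2\<bar> = 2 * \<bar>LBINT t:{a..b}. f t * g t\<bar>"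
      using AC_onD(2)[OF AC2 ab] by (simp add: mult.assoc abs_mult)
    also have "\<dots> \<le> 2 * (sqrt (LBINT t:{a..b}. (f t)\<^sup>2) * sqrt (LBINT t:{a..b}. (g t)\<^sup>2))"
      using L2_Cauchy_Schwarz[OF L'] by simp
    also have "\<dots> \<le> 2 * (sqrt (LBINT t:?I. (f t)\<^sup>2) * sqrt (LBINT t:?I. (g t)\<^sup>2))"
      using L2_mono_integral[OF L(1) s] L2_mono_integral[OF L(2) s]
      by (intro mult_left_mono mult_mono) (auto simp: L2_integral_nonneg)
    finally show ?thesis by simp
  qed
  have "\<bar>(f x)\<^sup>2 - (f y)\<^sup>2\<bar> \<le> 2 * sqrt (LBINT t:?I. (f t)\<^sup>2) * sqrt (LBINT t:?I. (g t)\<^sup>2)"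
    using *[OF x y(1)] *[OF y(1) x] by (cases "x \<le> y") (auto simp: abs_minus_commute)
  with m show ?thesis by linarith
qed

section \<open>Weak derivatives\<close>

definition ray_or_segment :: "real set \<Rightarrow> bool" where
  "ray_or_segment I \<longleftrightarrow> I = {0..} \<or> (\<exists>l>0. I = {0..l})"

lemma ray_or_segmentD:
  assumes "ray_or_segment I"
  shows "is_interval I" "I \<in> sets borel" "I \<subseteq> {0..}" "0 \<in> I" "closure (interior I) = I"
proof -
  show "is_interval I" "I \<in> sets borel" "I \<subseteq> {0..}" "0 \<in> I"
    using assms by (auto simp: ray_or_segment_def)
  show "closure (interior I) = I"
    using assms by (auto simp: ray_or_segment_def)
qed

lemma ray_or_segment_prefix: "ray_or_segment I \<Longrightarrow> x \<in> I \<Longrightarrow> {0..x} \<subseteq> I"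
  using is_interval_Icc_subset ray_or_segmentD by blast

lemma test_function_deriv:
  assumes \<phi>: "test_function I \<phi>"
  shows "(\<phi> has_real_derivative deriv \<phi> x) (at x)" and "continuous_on UNIV (deriv \<phi>)"
proof -
  obtain D where D: "\<And>x. (\<phi> has_vector_derivative D x) (at x)" "continuous_on UNIV D"
    using \<phi> by (auto simp: test_function_def C1_differentiable_on_def)
  have D': "(\<phi> has_real_derivative D x) (at x)" for x
    using D(1) by (simp add: has_real_derivative_iff_has_vector_derivative)
  have "deriv \<phi> = D" by (intro ext DERIV_imp_deriv D')
  with D' D(2) show "(\<phi> has_real_derivative deriv \<phi> x) (at x)" "continuous_on UNIV (deriv \<phi>)"
    by simp_all
qed

text \<open>A test function is supported in a compact piece \<open>{0..X}\<close> of \<open>I\<close>, so that integrals against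
  it reduce to integrals over \<open>{0..X}\<close>.\<close>

lemma test_function_support:
  assumes I: "ray_or_segment I" and \<phi>: "test_function I \<phi>"
  shows "\<phi> 0 = 0" and "\<exists>X\<in>I. \<phi> X = 0 \<and> (\<forall>t\<in>I. X < t \<longrightarrow> \<phi> t = 0 \<and> deriv \<phi> t = 0)"
proof -
  define S where "S = closure {x. \<phi> x \<noteq> 0}"
  have S: "compact S" "S \<subseteq> interior I" using \<phi> by (auto simp: test_function_def S_def)
  have vanish: "\<phi> t = 0" if "t \<notin> S" for t
    using that closure_subset[of "{x. \<phi> x \<noteq> 0}"] by (auto simp: S_def)
  have zero: "deriv \<phi> t = 0" if "t \<notin> S" for t
  proof -
    have "(\<phi> has_real_derivative 0) (at t)"
    proof (rule has_field_derivative_transform_within_open[where f = "\<lambda>_. 0" and S = "- S"])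
      show "0 = \<phi> x" if "x \<in> - S" for x
        using that by (intro vanish[symmetric] ComplD)
    qed (use that in \<open>auto simp: S_def\<close>)
    then show ?thesis by (rule DERIV_imp_deriv)
  qed
  have "\<exists>X\<in>I. X \<notin> S \<and> (\<forall>t\<in>I. X < t \<longrightarrow> t \<notin> S)"
    using I unfolding ray_or_segment_def
  proof (elim disjE exE conjE)
    assume r: "I = {0..}"
    obtain B where B: "\<And>t. t \<in> S \<Longrightarrow> \<bar>t\<bar> \<le> B"
      using compact_imp_bounded[OF S(1)] unfolding bounded_iff real_norm_def by blast
    have "t \<notin> S" if "\<bar>B\<bar> + 1 \<le> t" for t
      using B[of t] that by auto
    then show ?thesis using r by (intro bexI[of _ "\<bar>B\<bar> + 1"]) auto
  next
    fix l assume l: "0 < l" "I = {0..l}"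
    have "l \<notin> S" using S(2) l by auto
    then show ?thesis using l by (intro bexI[of _ l]) auto
  qed
  then show "\<exists>X\<in>I. \<phi> X = 0 \<and> (\<forall>t\<in>I. X < t \<longrightarrow> \<phi> t = 0 \<and> deriv \<phi> t = 0)"
    using vanish zero by blast
  have "0 \<notin> S" using S(2) I by (auto simp: ray_or_segment_def)
  then show "\<phi> 0 = 0" by (rule vanish)
qed

lemma indicator_eq_on_prefix:
  fixes k :: "real \<Rightarrow> real"
  assumes I: "ray_or_segment I" and X: "X \<in> I" and k: "\<And>t. t \<in> I \<Longrightarrow> X < t \<Longrightarrow> k t = 0"
  shows "indicat_real I t *\<^sub>R k t = indicat_real {0..X} t *\<^sub>R k t"
proof (cases "t \<in> I")
  case True
  then show ?thesis using k[OF True] ray_or_segmentD(3)[OF I] by (cases "X < t") auto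
next
  case False
  then have "t \<notin> {0..X}" using ray_or_segment_prefix[OF I X] by blast
  with False show ?thesis by simp
qed

lemma AC_integration_by_parts:
  assumes I: "ray_or_segment I" and f: "AC_on I f g" and \<phi>: "test_function I \<phi>"
  shows "set_integrable lborel I (\<lambda>x. f x * deriv \<phi> x)"
    and "(LBINT x:I. f x * deriv \<phi> x) = - (LBINT x:I. g x * \<phi> x)"
proof -
  note d = test_function_deriv(1)[OF \<phi>] and c = test_function_deriv(2)[OF \<phi>]
  obtain X where X: "X \<in> I" "\<phi> X = 0" "\<forall>t\<in>I. X < t \<longrightarrow> \<phi> t = 0 \<and> deriv \<phi> t = 0"
    using test_function_support(2)[OF I \<phi>] by (elim bexE conjE)
  have X0: "0 \<in> I" "0 \<le> X" using ray_or_segmentD[OF I] X(1) by auto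
  have sub: "{0..X} \<subseteq> I" by (rule ray_or_segment_prefix[OF I X(1)])
  have c\<phi>: "continuous_on {0..X} \<phi>"
    by (intro continuous_at_imp_continuous_on ballI) (rule DERIV_isCont[OF d])
  have i1: "set_integrable lborel {0..X} (\<lambda>x. f x * deriv \<phi> x)"
    by (intro continuous_mult_integrable borel_integrable_atLeastAtMost' AC_continuous[OF f X0(1) X(1) X0(2) sub]
        continuous_on_subset[OF c]) auto
  have i2: "set_integrable lborel {0..X} (\<lambda>x. g x * \<phi> x)"
    using continuous_mult_integrable[OF c\<phi> AC_onD(1)[OF f X0(1) X(1) X0(2)]] by (simp only: mult.commute)
  have "AC_on I (\<lambda>x. f x * \<phi> x) (\<lambda>x. f x * deriv \<phi> x + g x * \<phi> x)"
    by (rule AC_mult[OF ray_or_segmentD(1)[OF I] f AC_of_continuous_deriv[OF d c]])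
  from AC_onD(2)[OF this X0(1) X(1) X0(2)]
  have "0 = (LBINT x:{0..X}. f x * deriv \<phi> x + g x * \<phi> x)" using X test_function_support(1)[OF I \<phi>] by simp
  also have "\<dots> = (LBINT x:{0..X}. f x * deriv \<phi> x) + (LBINT x:{0..X}. g x * \<phi> x)"
    by (rule set_integral_add[OF i1 i2])
  finally have eq: "(LBINT x:{0..X}. f x * deriv \<phi> x) = - (LBINT x:{0..X}. g x * \<phi> x)" by simp
  have r1: "indicat_real I t *\<^sub>R (f t * deriv \<phi> t) = indicat_real {0..X} t *\<^sub>R (f t * deriv \<phi> t)" for t
    by (rule indicator_eq_on_prefix[OF I X(1)]) (simp add: X(3))
  have r2: "indicat_real I t *\<^sub>R (g t * \<phi> t) = indicat_real {0..X} t *\<^sub>R (g t * \<phi> t)" for t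
    by (rule indicator_eq_on_prefix[OF I X(1)]) (simp add: X(3))
  show "set_integrable lborel I (\<lambda>x. f x * deriv \<phi> x)"
    using i1 unfolding set_integrable_def r1 .
  show "(LBINT x:I. f x * deriv \<phi> x) = - (LBINT x:I. g x * \<phi> x)"
    using eq unfolding set_lebesgue_integral_def r1 r2 .
qed

lemma continuous_mult_deriv_integrable:
  assumes I: "ray_or_segment I" and f: "continuous_on I f" and \<phi>: "test_function I \<phi>"
  shows "set_integrable lborel I (\<lambda>x. f x * deriv \<phi> x)"
proof -
  note d = test_function_deriv(1)[OF \<phi>] and c = test_function_deriv(2)[OF \<phi>]
  obtain X where X: "X \<in> I" "\<phi> X = 0" "\<forall>t\<in>I. X < t \<longrightarrow> \<phi> t = 0 \<and> deriv \<phi> t = 0"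
    using test_function_support(2)[OF I \<phi>] by (elim bexE conjE)
  have sub: "{0..X} \<subseteq> I" by (rule ray_or_segment_prefix[OF I X(1)])
  have "indicat_real I t *\<^sub>R (f t * deriv \<phi> t) = indicat_real {0..X} t *\<^sub>R (f t * deriv \<phi> t)"
    for t by (rule indicator_eq_on_prefix[OF I X(1)]) (simp add: X(3))
  moreover have "set_integrable lborel {0..X} (\<lambda>x. f x * deriv \<phi> x)"
    by (intro borel_integrable_atLeastAtMost' continuous_on_mult continuous_on_subset[OF f sub]
        continuous_on_subset[OF c]) auto
  ultimately show ?thesis by (simp only: set_integrable_def)
qed

text \<open>Du Bois-Reymond's lemma. If \<open>F a < m < F b\<close>, then the difference of two equal bumps around
  \<open>b\<close> and \<open>a\<close> is the derivative of a test function, and its product with \<open>F - m\<close> is nonnegative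
  and positive at \<open>b\<close>.\<close>

lemma weakly_constant_aux:
  assumes I: "ray_or_segment I" and F: "continuous_on I F"
    and weak: "\<And>\<phi>. test_function I \<phi> \<Longrightarrow> (LBINT x:I. F x * deriv \<phi> x) = 0"
    and ab: "a \<in> interior I" "b \<in> interior I"
  shows "\<not> F a < F b"
proof
  assume less: "F a < F b"
  define m where "m = (F a + F b) / 2"
  have m: "F a < m" "m < F b" using less by (auto simp: m_def)
  have Fo: "continuous_on (interior I) F" using F interior_subset by (rule continuous_on_subset)
  have o: "open (interior I \<inter> F -` {..<m})" "open (interior I \<inter> F -` {m<..})"
    by (rule continuous_open_preimage[OF Fo]; simp)+
  have mem: "a \<in> interior I \<inter> F -` {..<m}" "b \<in> interior I \<inter> F -` {m<..}"
    using m ab by auto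
  obtain d1 where d1: "0 < d1" "ball a d1 \<subseteq> interior I \<inter> F -` {..<m}"
    by (rule openE[OF o(1) mem(1)])
  obtain d2 where d2: "0 < d2" "ball b d2 \<subseteq> interior I \<inter> F -` {m<..}"
    by (rule openE[OF o(2) mem(2)])
  define \<epsilon> where "\<epsilon> = min d1 d2 / 2"
  have e: "0 < \<epsilon>" "\<epsilon> < d1" "\<epsilon> < d2" using d1(1) d2(1) by (auto simp: \<epsilon>_def min_def)
  have na: "x \<in> interior I \<and> F x < m" if "\<bar>x - a\<bar> \<le> \<epsilon>" for x
  proof -
    have "x \<in> ball a d1" using that e by (simp add: dist_real_def)
    from subsetD[OF d1(2) this] show ?thesis by simp
  qed
  have nb: "x \<in> interior I \<and> m < F x" if "\<bar>x - b\<bar> \<le> \<epsilon>" for x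
  proof -
    have "x \<in> ball b d2" using that e by (simp add: dist_real_def)
    from subsetD[OF d2(2) this] show ?thesis by simp
  qed
  define T where "T x = max 0 (\<epsilon> - \<bar>x\<bar>)" for x :: real
  have cT: "continuous_on UNIV T" unfolding T_def[abs_def] by (intro continuous_intros)
  have "\<exists>A. \<forall>x :: real. - \<infinity> < ereal x \<longrightarrow> ereal x < \<infinity> \<longrightarrow> (A has_vector_derivative T x) (at x)"
    using cT by (intro einterval_antiderivative) (auto simp: continuous_on_eq_continuous_at)
  then obtain A where A: "\<And>x. (A has_real_derivative T x) (at x)"
    by (auto simp: has_real_derivative_iff_has_vector_derivative)
  have A_const: "A x = A y" if "\<And>z. x < z \<Longrightarrow> z < y \<Longrightarrow> T z = 0" "x \<le> y" for x y
  proof (cases "x = y")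
    case False
    with that(2) obtain z where "x < z" "z < y" "A y - A x = (y - x) * T z"
      using MVT2[of x y A T] A by auto
    with that(1) show ?thesis by simp
  qed simp
  define \<phi> where "\<phi> x = A (x - b) - A (x - a)" for x
  define h where "h x = T (x - b) - T (x - a)" for x
  have \<phi>': "(\<phi> has_real_derivative h x) (at x)" for x
    unfolding \<phi>_def[abs_def] h_def
    by (intro DERIV_diff; rule DERIV_shift[THEN iffD1, of A _ _ "- _", simplified, OF A])
  have ch: "continuous_on UNIV h"
    unfolding h_def[abs_def] by (intro continuous_intros continuous_on_compose2[OF cT]) auto
  have dh: "deriv \<phi> = h" by (intro ext DERIV_imp_deriv \<phi>')
  have out: "\<phi> x = 0" if "x \<notin> {min a b - \<epsilon>..max a b + \<epsilon>}" for x
  proof (cases "x < min a b - \<epsilon>")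
    case True
    have "A (min (x - a) (x - b)) = A (max (x - a) (x - b))"
      by (rule A_const) (use True in \<open>auto simp: T_def\<close>)
    then show ?thesis by (auto simp: \<phi>_def min_def max_def split: if_splits)
  next
    case False
    with that have "max a b + \<epsilon> < x" by auto
    then have "A (min (x - a) (x - b)) = A (max (x - a) (x - b))"
      by (intro A_const) (auto simp: T_def)
    then show ?thesis by (auto simp: \<phi>_def min_def max_def split: if_splits)
  qed
  have test: "test_function I \<phi>"
    unfolding test_function_def
  proof (intro conjI)
    show "\<phi> C1_differentiable_on UNIV"
      using \<phi>' ch by (auto simp: C1_differentiable_on_def has_real_derivative_iff_has_vector_derivative)
    have sub: "closure {x. \<phi> x \<noteq> 0} \<subseteq> {min a b - \<epsilon>..max a b + \<epsilon>}"
    proof (rule closure_minimal)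
      show "{x. \<phi> x \<noteq> 0} \<subseteq> {min a b - \<epsilon>..max a b + \<epsilon>}"
        using out by (intro subsetI) (metis mem_Collect_eq)
    qed simp
    show "compact (closure {x. \<phi> x \<noteq> 0})"
      unfolding compact_eq_bounded_closed by (intro conjI closed_closure bounded_subset[OF _ sub]) simp
    have "min a b - \<epsilon> \<in> interior I" "max a b + \<epsilon> \<in> interior I"
      using na[of "a - \<epsilon>"] na[of "a + \<epsilon>"] nb[of "b - \<epsilon>"] nb[of "b + \<epsilon>"] e
      by (auto simp: min_def max_def)
    then have "{min a b - \<epsilon>..max a b + \<epsilon>} \<subseteq> interior I"
      using I by (auto simp: ray_or_segment_def)
    with sub show "closure {x. \<phi> x \<noteq> 0} \<subseteq> interior I" by (rule subset_trans)
  qed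
  define k where "k x = (F x - m) * h x" for x
  have ck: "continuous_on I k"
    unfolding k_def[abs_def]
    by (intro continuous_on_mult continuous_on_diff continuous_on_const F continuous_on_subset[OF ch]) auto
  have "AC_on I (\<lambda>x. 1) (\<lambda>x. 0)"
    by (rule AC_of_continuous_deriv) auto
  from AC_integration_by_parts(2)[OF I this test]
  have h0: "(LBINT x:I. h x) = 0" by (simp add: dh)
  have Fh: "set_integrable lborel I (\<lambda>x. F x * h x)"
    using continuous_mult_deriv_integrable[OF I F test] by (simp add: dh)
  have hh: "set_integrable lborel I h"
    using continuous_mult_deriv_integrable[OF I continuous_on_const test, of 1] by (simp add: dh)
  have ki: "set_integrable lborel I k"
    using set_integral_diff(1)[OF Fh set_integrable_mult_right[OF hh, of m]]
    by (simp add: k_def[abs_def] left_diff_distrib)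
  have "(LBINT x:I. k x) = (LBINT x:I. F x * h x) - (LBINT x:I. m * h x)"
    unfolding k_def left_diff_distrib by (intro set_integral_diff(2) Fh) (use hh in simp)
  also have "\<dots> = 0" using weak[OF test] h0 by (simp add: dh)
  finally have k0: "(LBINT x:I. k x) = 0" .
  have kpos: "0 \<le> k x" for x
  proof -
    have "0 \<le> (F x - m) * T (x - b)" using nb[of x] by (auto simp: T_def max_def)
    moreover have "0 \<le> (F x - m) * - T (x - a)"
      using na[of x] by (auto simp: T_def max_def mult_nonpos_nonneg)
    ultimately show ?thesis by (simp add: k_def h_def algebra_simps)
  qed
  let ?J = "{b - \<epsilon>..b + \<epsilon>}"
  have J: "?J \<subseteq> I" using nb interior_subset by (fastforce simp: abs_le_iff)
  have kJ: "set_integrable lborel ?J k" by (rule set_integrable_subset[OF ki _ J]) simp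
  have "(LBINT x:?J. k x) \<le> (LBINT x:I. k x)"
    using kJ ki kpos J unfolding set_lebesgue_integral_def set_integrable_def
    by (intro integral_mono) (auto simp: indicator_def)
  moreover have "0 \<le> (LBINT x:?J. k x)"
    unfolding set_lebesgue_integral_def using kpos by (intro Bochner_Integration.integral_nonneg) simp
  ultimately have "(LBINT x:?J. k x) = 0" using k0 by simp
  then have "(k has_integral 0) ?J"
    using set_borel_integral_eq_integral[OF kJ] by (simp add: has_integral_iff)
  moreover have "continuous_on ?J k" using ck J by (rule continuous_on_subset)
  ultimately have "k b = 0"
    using has_integral_0_cbox_imp_0[of "b - \<epsilon>" "b + \<epsilon>" k b] kpos e by simp
  moreover have "T (b - a) = 0" using na[of b] m by (auto simp: T_def max_def)
  ultimately show False using m e by (simp add: k_def h_def T_def)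
qed

lemma weakly_constant:
  assumes I: "ray_or_segment I" and F: "continuous_on I F"
    and weak: "\<And>\<phi>. test_function I \<phi> \<Longrightarrow> (LBINT x:I. F x * deriv \<phi> x) = 0"
    and x: "x \<in> I"
  shows "F x = F 0"
proof -
  have no: "\<not> F a < F b" if "a \<in> interior I" "b \<in> interior I" for a b
    by (rule weakly_constant_aux[OF I F _ that]) (rule weak)
  have "interior I \<noteq> {}" using ray_or_segmentD(4,5)[OF I] by auto
  then obtain c where c: "c \<in> interior I" by blast
  have eq: "F t = F c" if "t \<in> interior I" for t
    using no[OF that c] no[OF c that] by linarith
  have "F t = F c" if "t \<in> I" for t
    by (rule continuous_constant_on_closure[of "interior I" F "F c" t])
       (use that eq F ray_or_segmentD(5)[OF I] in auto)
  then show ?thesis using x ray_or_segmentD(4)[OF I] by simp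
qed

text \<open>Both \<open>f\<close> and the integral of \<open>g\<close> have the weak derivative \<open>g\<close>, so their difference is
  constant.\<close>

lemma AC_of_weak_deriv:
  assumes I: "ray_or_segment I" and f: "continuous_on I f" and g: "has_weak_deriv I f g"
  shows "AC_on I f g"
proof -
  have L: "Lq_on 2 I g" using g by (simp add: has_weak_deriv_def)
  define G where "G x = (LBINT t:{0..x}. g t)" for x
  have gi: "set_integrable lborel {0..x} g" if "x \<in> I" for x
    by (intro L2_integrable L2_mono[OF L ray_or_segment_prefix[OF I that]]) simp
  have G0: "G 0 = 0"
    using set_integral_Icc_combine[of 0 0 g 0] gi[OF ray_or_segmentD(4)[OF I]] by (simp add: G_def)
  have G: "AC_on I G g"
    by (rule AC_on_from_0) (use gi ray_or_segmentD(3)[OF I] G0 in \<open>auto simp: G_def\<close>)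
  have cG: "continuous_on I G" by (rule AC_L2_continuous[OF ray_or_segmentD(1)[OF I] G L])
  have "f x - G x = f 0 - G 0" if "x \<in> I" for x
  proof (rule weakly_constant[OF I _ _ that])
    show "continuous_on I (\<lambda>x. f x - G x)" by (intro continuous_intros f cG)
    fix \<phi> assume \<phi>: "test_function I \<phi>"
    have "(LBINT x:I. (f x - G x) * deriv \<phi> x) = (LBINT x:I. f x * deriv \<phi> x) - (LBINT x:I. G x * deriv \<phi> x)"
      unfolding left_diff_distrib
      by (intro set_integral_diff continuous_mult_deriv_integrable[OF I _ \<phi>] f cG)
    also have "\<dots> = 0"
      using g \<phi> AC_integration_by_parts(2)[OF I G \<phi>] by (simp add: has_weak_deriv_def)
    finally show "(LBINT x:I. (f x - G x) * deriv \<phi> x) = 0" .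
  qed
  then show ?thesis
    using gi ray_or_segmentD(3)[OF I] G0
    by (intro AC_on_from_0) (auto simp: G_def algebra_simps)
qed

text \<open>An integrable function whose integrals over all intervals \<open>{x..b}\<close> vanish is zero almost
  everywhere, because its positive and negative parts are densities of the same measure.\<close>

lemma AE_zero_if_integrals_zero:
  fixes d :: "real \<Rightarrow> real"
  assumes d: "set_integrable lborel {a..b} d"
    and z: "\<And>x. a \<le> x \<Longrightarrow> x \<le> b \<Longrightarrow> (LBINT t:{x..b}. d t) = 0"
  shows "AE x in lborel. x \<in> {a..b} \<longrightarrow> d x = 0"
proof -
  define D where "D x = indicat_real {a..b} x *\<^sub>R d x" for x
  have Di: "integrable lborel D" using d by (simp add: D_def[abs_def] set_integrable_def)
  then have [measurable]: "D \<in> borel_measurable borel" using borel_measurable_integrable by auto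
  define P where "P x = max 0 (D x)" for x
  define N where "N x = max 0 (- D x)" for x
  have PN: "integrable lborel P" "integrable lborel N" "P \<in> borel_measurable borel" "N \<in> borel_measurable borel"
    using Di by (auto simp: P_def[abs_def] N_def[abs_def])
  note [measurable] = PN(3,4)
  have em: "emeasure (density lborel (\<lambda>x. ennreal (Q x))) {x<..} = ennreal (\<integral>y. Q y * indicat_real {x<..} y \<partial>lborel)"
    if Q: "integrable lborel Q" "Q \<in> borel_measurable borel" "\<And>y. 0 \<le> Q y" for Q and x :: real
  proof -
    have "emeasure (density lborel (\<lambda>x. ennreal (Q x))) {x<..} = (\<integral>\<^sup>+ y. ennreal (Q y) * indicator {x<..} y \<partial>lborel)"
      using Q(2) by (subst emeasure_density) auto
    also have "\<dots> = (\<integral>\<^sup>+ y. ennreal (Q y * indicat_real {x<..} y) \<partial>lborel)"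
      by (intro nn_integral_cong) (auto simp: indicator_def)
    also have "\<dots> = ennreal (\<integral>y. Q y * indicat_real {x<..} y \<partial>lborel)"
      using Q by (intro nn_integral_eq_integral integrable_real_mult_indicator) auto
    finally show ?thesis .
  qed
  have zero: "(\<integral>y. D y * indicat_real {x<..} y \<partial>lborel) = 0" for x
  proof -
    have "(\<integral>y. D y * indicat_real {x<..} y \<partial>lborel) = (LBINT t:{max a x..b}. d t)"
      unfolding set_lebesgue_integral_def
    proof (rule integral_cong_AE)
      show "AE y in lborel. D y * indicat_real {x<..} y = indicat_real {max a x..b} y *\<^sub>R d y"
        using AE_lborel_singleton[of x]
        by eventually_elim (auto simp: D_def indicator_def)
      have "(\<lambda>y. indicat_real {max a x..b} y *\<^sub>R D y) \<in> borel_measurable lborel" by measurable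
      moreover have "(\<lambda>y. indicat_real {max a x..b} y *\<^sub>R D y) = (\<lambda>y. indicat_real {max a x..b} y *\<^sub>R d y)"
        by (auto simp: D_def indicator_def fun_eq_iff)
      ultimately show "(\<lambda>y. indicat_real {max a x..b} y *\<^sub>R d y) \<in> borel_measurable lborel"
        by (simp only:)
    qed measurable
    also have "\<dots> = 0"
    proof (cases "a \<le> b \<and> x \<le> b")
      case True then show ?thesis by (intro z) auto
    next
      case False
      then have "{max a x..b} = {}" by auto
      then show ?thesis by (simp add: set_lebesgue_integral_def)
    qed
    finally show ?thesis .
  qed
  have PeqN: "(\<integral>y. P y * indicat_real {x<..} y \<partial>lborel) = (\<integral>y. N y * indicat_real {x<..} y \<partial>lborel)" for x
  proof -
    have "(\<integral>y. P y * indicat_real {x<..} y \<partial>lborel) - (\<integral>y. N y * indicat_real {x<..} y \<partial>lborel) =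
        (\<integral>y. P y * indicat_real {x<..} y - N y * indicat_real {x<..} y \<partial>lborel)"
      by (intro Bochner_Integration.integral_diff[symmetric] integrable_real_mult_indicator PN) auto
    also have "\<dots> = (\<integral>y. D y * indicat_real {x<..} y \<partial>lborel)"
      by (intro Bochner_Integration.integral_cong refl) (auto simp: P_def N_def max_def)
    finally show ?thesis using zero by simp
  qed
  have "density lborel (\<lambda>x. ennreal (P x)) = density lborel (\<lambda>x. ennreal (N x))"
  proof (rule measure_eqI_lessThan)
    show "emeasure (density lborel (\<lambda>x. ennreal (P x))) {x<..} < \<infinity>" for x
      by (subst em) (auto simp: PN P_def)
    show "emeasure (density lborel (\<lambda>x. ennreal (P x))) {x<..} = emeasure (density lborel (\<lambda>x. ennreal (N x))) {x<..}" for x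
      using em[OF PN(1,3)] em[OF PN(2,4)] PeqN by (simp add: P_def N_def)
  qed auto
  then have "AE x in lborel. ennreal (P x) = ennreal (N x)"
    by (intro sigma_finite_measure.density_unique[OF lborel.sigma_finite_measure_axioms]) auto
  then show ?thesis
  proof eventually_elim
    case (elim x)
    then have "P x = N x" by (simp add: P_def N_def)
    then have "D x = 0" by (auto simp: P_def N_def max_def split: if_splits)
    then show ?case by (auto simp: D_def)
  qed
qed

lemma AC_deriv_unique:
  assumes I: "ray_or_segment I" and f: "AC_on I f g" "AC_on I f h"
  shows "AE x in lborel. x \<in> I \<longrightarrow> g x = h x"
proof -
  have seg: "AE x in lborel. x \<in> {0..b} \<longrightarrow> g x = h x" if b: "b \<in> I" for b
  proof -
    have s: "{0..b} \<subseteq> I" by (rule ray_or_segment_prefix[OF I b])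
    have b0: "0 \<le> b" using ray_or_segmentD(3)[OF I] b by auto
    note i = AC_onD[OF f(1) _ b] AC_onD[OF f(2) _ b]
    have "AE x in lborel. x \<in> {0..b} \<longrightarrow> g x - h x = 0"
    proof (rule AE_zero_if_integrals_zero)
      show "set_integrable lborel {0..b} (\<lambda>x. g x - h x)"
        using i(1,3)[OF ray_or_segmentD(4)[OF I] b0] by simp
      fix x assume x: "0 \<le> x" "x \<le> b"
      then have "x \<in> I" using s by auto
      with i[OF this x(2)] show "(LBINT t:{x..b}. g t - h t) = 0"
        by (subst set_integral_diff) auto
    qed
    then show ?thesis by simp
  qed
  show ?thesis
    using I unfolding ray_or_segment_def
  proof (elim disjE exE conjE)
    assume r: "I = {0..}"
    have "AE x in lborel. \<forall>n::nat. x \<in> {0..real n} \<longrightarrow> g x = h x"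
      unfolding AE_all_countable by (intro allI seg) (simp add: r)
    then show ?thesis
    proof eventually_elim
      case (elim x)
      show ?case
      proof
        assume "x \<in> I"
        moreover obtain n :: nat where "x \<le> real n" using real_arch_simple by blast
        ultimately show "g x = h x" using elim[rule_format, of n] r by simp
      qed
    qed
  next
    fix l assume "0 < l" "I = {0..l}"
    then show ?thesis using seg[of l] by simp
  qed
qed

lemma H1_pair_has_weak_deriv:
  assumes "ray_or_segment I" "H1_pair I f g"
  shows "has_weak_deriv I f g"
  unfolding has_weak_deriv_def
proof (intro conjI allI impI)
  show "Lq_on 2 I g" using assms(2) by (simp add: H1_pair_def)
  show "(LBINT x:I. f x * deriv \<phi> x) = - (LBINT x:I. g x * \<phi> x)" if "test_function I \<phi>" for \<phi>
    by (rule AC_integration_by_parts(2)[OF assms(1) _ that]) (use assms(2) in \<open>simp add: H1_pair_def\<close>)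
qed

lemma H1_pair_continuous: "ray_or_segment I \<Longrightarrow> H1_pair I f g \<Longrightarrow> continuous_on I f"
  unfolding H1_pair_def by (elim conjE) (rule AC_L2_continuous[OF ray_or_segmentD(1)])

lemma H1_on_imp_pair:
  assumes I: "ray_or_segment I" and f: "continuous_on I f" "H1_on I f"
  shows "H1_pair I f (weak_deriv I f)"
proof -
  have w: "has_weak_deriv I f (weak_deriv I f)"
    unfolding weak_deriv_def by (rule someI_ex[OF f(2)[unfolded H1_on_def, THEN conjunct2]])
  have "Lq_on 2 I f" "Lq_on 2 I (weak_deriv I f)"
    using f(2)[unfolded H1_on_def, THEN conjunct1] w[unfolded has_weak_deriv_def, THEN conjunct1] .
  with AC_of_weak_deriv[OF I f(1) w] show ?thesis
    unfolding H1_pair_def by (intro conjI)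
qed

lemma H1_pair_imp_H1_on:
  assumes I: "ray_or_segment I" and f: "H1_pair I f g"
  shows "H1_on I f" and "(LBINT x:I. (weak_deriv I f x)\<^sup>2) = (LBINT x:I. (g x)\<^sup>2)"
proof -
  show H: "H1_on I f"
    using H1_pair_has_weak_deriv[OF I f] f unfolding H1_on_def H1_pair_def by blast
  have w: "H1_pair I f (weak_deriv I f)"
    by (rule H1_on_imp_pair[OF I H1_pair_continuous[OF I f] H])
  have ae: "AE x in lborel. x \<in> I \<longrightarrow> weak_deriv I f x = g x"
    by (rule AC_deriv_unique[OF I, where f = f]) (use w f in \<open>simp_all only: H1_pair_def\<close>)
  have m: "set_borel_measurable lborel I (\<lambda>x. (k x)\<^sup>2)" if "Lq_on 2 I k" for k
    using that set_borel_measurable_compose2(1)[of I k k] by (simp add: Lq_on_2_iff power2_eq_square)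
  show "(LBINT x:I. (weak_deriv I f x)\<^sup>2) = (LBINT x:I. (g x)\<^sup>2)"
    unfolding set_lebesgue_integral_def
  proof (rule integral_cong_AE)
    show "(\<lambda>x. indicat_real I x *\<^sub>R (weak_deriv I f x)\<^sup>2) \<in> borel_measurable lborel"
      using m[of "weak_deriv I f"] w by (simp only: H1_pair_def set_borel_measurable_def)
    show "(\<lambda>x. indicat_real I x *\<^sub>R (g x)\<^sup>2) \<in> borel_measurable lborel"
      using m[of g] f by (simp only: H1_pair_def set_borel_measurable_def)
    show "AE x in lborel. indicat_real I x *\<^sub>R (weak_deriv I f x)\<^sup>2 = indicat_real I x *\<^sub>R (g x)\<^sup>2"
      using ae by eventually_elim (auto simp: indicator_def)
  qed
qed

section \<open>Estimates on one edge\<close>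

lemma H1_pair_mono:
  assumes "H1_pair I f g" "J \<subseteq> I" "J \<in> sets borel"
  shows "H1_pair J f g"
  using assms L2_mono[OF _ assms(2,3)] unfolding H1_pair_def AC_on_def by blast

lemma abs_powr_integrable:
  fixes f :: "real \<Rightarrow> real"
  assumes "continuous_on {0..l} f" "0 < p"
  shows "set_integrable lborel {0..l} (\<lambda>x. \<bar>f x\<bar> powr p)"
  by (intro borel_integrable_atLeastAtMost' continuous_on_powr' continuous_on_rabs continuous_on_const assms(1))
     (use assms(2) in auto)

lemma H1_pair_Lp_bound:
  assumes l: "0 < l" and f: "H1_pair {0..l} f g" and p: "2 < p"
  shows "(LBINT x:{0..l}. \<bar>f x\<bar> powr p) \<le>
    ((LBINT x:{0..l}. (f x)\<^sup>2) / l + 2 * sqrt (LBINT x:{0..l}. (f x)\<^sup>2) * sqrt (LBINT x:{0..l}. (g x)\<^sup>2))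
      powr ((p - 2) / 2) * (LBINT x:{0..l}. (f x)\<^sup>2)"
proof -
  let ?S = "(LBINT x:{0..l}. (f x)\<^sup>2) / l + 2 * sqrt (LBINT x:{0..l}. (f x)\<^sup>2) * sqrt (LBINT x:{0..l}. (g x)\<^sup>2)"
  have c: "continuous_on {0..l} f"
    by (rule H1_pair_continuous[OF _ f]) (use l in \<open>auto simp: ray_or_segment_def\<close>)
  have L: "set_integrable lborel {0..l} (\<lambda>x. (f x)\<^sup>2)"
    using f by (simp add: H1_pair_def Lq_on_2_iff)
  have "(LBINT x:{0..l}. \<bar>f x\<bar> powr p) \<le> (LBINT x:{0..l}. ?S powr ((p - 2) / 2) * (f x)\<^sup>2)"
  proof (rule set_integral_mono)
    show "set_integrable lborel {0..l} (\<lambda>x. \<bar>f x\<bar> powr p)"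
      using abs_powr_integrable[OF c] p by simp
    show "set_integrable lborel {0..l} (\<lambda>x. ?S powr ((p - 2) / 2) * (f x)\<^sup>2)" using L by simp
    fix x assume x: "x \<in> {0..l}"
    have "\<bar>f x\<bar> powr p = \<bar>f x\<bar> powr (p - 2) * \<bar>f x\<bar> powr 2"
      by (simp only: powr_add[symmetric]) simp
    also have "\<dots> = ((f x)\<^sup>2) powr ((p - 2) / 2) * (f x)\<^sup>2"
    proof -
      have "2 * ((p - 2) / 2) = p - 2" by simp
      then have "\<bar>f x\<bar> powr (p - 2) = (\<bar>f x\<bar> powr 2) powr ((p - 2) / 2)" by (simp only: powr_powr)
      then show ?thesis by simp
    qed
    also have "\<dots> \<le> ?S powr ((p - 2) / 2) * (f x)\<^sup>2"
      using H1_pair_sup_bound[OF l f x] p by (intro mult_right_mono powr_mono2) auto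
    finally show "\<bar>f x\<bar> powr p \<le> ?S powr ((p - 2) / 2) * (f x)\<^sup>2" .
  qed
  then show ?thesis by simp
qed

text \<open>The two sides of \<open>y powr \<theta> \<le> \<delta> * y\<^sup>2\<close> agree at \<open>y = \<delta> powr (- 1 / (2 - \<theta>))\<close>; beyond this
  point the square dominates, before it the power is at most the constant.\<close>

lemma powr_le_small_square:
  fixes \<theta> \<delta> y :: real
  assumes \<theta>: "0 < \<theta>" "\<theta> < 2" and \<delta>: "0 < \<delta>" and y: "0 \<le> y"
  shows "y powr \<theta> \<le> \<delta> * y\<^sup>2 + (\<delta> powr (- 1 / (2 - \<theta>))) powr \<theta>"
proof -
  define T where "T = \<delta> powr (- 1 / (2 - \<theta>))"
  have T: "0 < T" using \<delta> by (simp add: T_def)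
  show ?thesis
  proof (cases "y \<le> T")
    case True
    then have "y powr \<theta> \<le> T powr \<theta>" using \<theta> y by (intro powr_mono2) auto
    then show ?thesis using \<delta> by (simp add: T_def add_increasing)
  next
    case False
    then have "T \<le> y" by simp
    then have "y powr (\<theta> - 2) \<le> T powr (\<theta> - 2)" using \<theta> T by (intro powr_mono2') auto
    also have "T powr (\<theta> - 2) = \<delta>"
    proof -
      have "- 1 / (2 - \<theta>) * (\<theta> - 2) = 1" using \<theta> by (simp add: field_simps)
      then show ?thesis using \<delta> by (simp only: T_def powr_powr) simp
    qed
    finally have "y powr (\<theta> - 2) * y powr 2 \<le> \<delta> * y powr 2" by (rule mult_right_mono) simp
    then have "y powr (\<theta> - 2 + 2) \<le> \<delta> * y powr 2" by (simp only: powr_add)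
    then have "y powr \<theta> \<le> \<delta> * y\<^sup>2" using False T by simp
    then show ?thesis using T by (simp add: T_def add_increasing2)
  qed
qed

lemma affine_powr_le_small_square:
  fixes a b \<theta> \<epsilon> :: real
  assumes \<theta>: "0 < \<theta>" "\<theta> < 2" and ab: "0 \<le> a" "0 \<le> b" and \<epsilon>: "0 < \<epsilon>"
  shows "\<exists>C. \<forall>x\<ge>0. (a + b * x) powr \<theta> \<le> \<epsilon> * x\<^sup>2 + C"
proof -
  define \<delta> where "\<delta> = \<epsilon> / (2 * (b\<^sup>2 + 1))"
  define C where "C = \<delta> * (2 * a\<^sup>2) + (\<delta> powr (- 1 / (2 - \<theta>))) powr \<theta>"
  have b1: "0 < b\<^sup>2 + 1" by (simp add: add_nonneg_pos)
  have \<delta>: "0 < \<delta>" using \<epsilon> b1 by (simp add: \<delta>_def)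
  have \<delta>b: "\<delta> * (2 * b\<^sup>2) \<le> \<epsilon>"
  proof -
    have "\<delta> * (2 * b\<^sup>2) \<le> \<delta> * (2 * (b\<^sup>2 + 1))" using \<delta> by (intro mult_left_mono) auto
    also have "\<dots> = \<epsilon>" using b1 by (simp add: \<delta>_def)
    finally show ?thesis .
  qed
  have "(a + b * x) powr \<theta> \<le> \<epsilon> * x\<^sup>2 + C" if x: "0 \<le> x" for x
  proof -
    have "(a + b * x) powr \<theta> \<le> \<delta> * (a + b * x)\<^sup>2 + (\<delta> powr (- 1 / (2 - \<theta>))) powr \<theta>"
      using powr_le_small_square[OF \<theta> \<delta>] ab x by simp
    also have "\<delta> * (a + b * x)\<^sup>2 \<le> \<delta> * (2 * a\<^sup>2 + 2 * b\<^sup>2 * x\<^sup>2)"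
    proof (intro mult_left_mono)
      have "0 \<le> (a - b * x)\<^sup>2" by simp
      then show "(a + b * x)\<^sup>2 \<le> 2 * a\<^sup>2 + 2 * b\<^sup>2 * x\<^sup>2"
        by (simp add: power2_eq_square algebra_simps)
    qed (use \<delta> in simp)
    also have "\<delta> * (2 * a\<^sup>2 + 2 * b\<^sup>2 * x\<^sup>2) = \<delta> * (2 * a\<^sup>2) + \<delta> * (2 * b\<^sup>2) * x\<^sup>2"
      by (simp add: algebra_simps)
    also have "\<delta> * (2 * b\<^sup>2) * x\<^sup>2 \<le> \<epsilon> * x\<^sup>2" using \<delta>b by (intro mult_right_mono) auto
    finally show ?thesis by (simp add: C_def)
  qed
  then show ?thesis by blast
qed

lemma Lp_integral_continuous:
  fixes h :: "real \<Rightarrow> real"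
  assumes l: "0 < l" and h: "continuous_on {0..l} h" and p: "0 < p" and \<epsilon>: "0 < \<epsilon>"
  shows "\<exists>\<delta>>0. \<forall>f. continuous_on {0..l} f \<and> (\<forall>x\<in>{0..l}. \<bar>f x - h x\<bar> < \<delta>) \<longrightarrow>
    \<bar>(LBINT x:{0..l}. \<bar>f x\<bar> powr p) - (LBINT x:{0..l}. \<bar>h x\<bar> powr p)\<bar> \<le> \<epsilon>"
proof -
  obtain M where M: "\<forall>x\<in>{0..l}. \<bar>h x\<bar> \<le> M"
    using compact_imp_bounded[OF compact_continuous_image[OF h compact_Icc]]
    unfolding bounded_iff by auto
  let ?J = "{- M - 1..M + 1}"
  have "uniformly_continuous_on ?J (\<lambda>y. \<bar>y\<bar> powr p)"
    by (intro compact_uniformly_continuous continuous_on_powr' continuous_on_rabs continuous_on_const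
        continuous_on_id) (use p in auto)
  moreover have "0 < \<epsilon> / l" using \<epsilon> l by simp
  ultimately obtain d where d: "0 < d"
      "\<forall>y\<in>?J. \<forall>z\<in>?J. dist z y < d \<longrightarrow> dist (\<bar>z\<bar> powr p) (\<bar>y\<bar> powr p) < \<epsilon> / l"
    unfolding uniformly_continuous_on_def by blast
  show ?thesis
  proof (intro exI[of _ "min d 1"] conjI allI impI)
    show "0 < min d 1" using d by simp
    fix f assume f: "continuous_on {0..l} f \<and> (\<forall>x\<in>{0..l}. \<bar>f x - h x\<bar> < min d 1)"
    have i: "set_integrable lborel {0..l} (\<lambda>x. \<bar>f x\<bar> powr p)" "set_integrable lborel {0..l} (\<lambda>x. \<bar>h x\<bar> powr p)"
      using f h p by (auto intro: abs_powr_integrable)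
    have "\<bar>(LBINT x:{0..l}. \<bar>f x\<bar> powr p) - (LBINT x:{0..l}. \<bar>h x\<bar> powr p)\<bar>
        = \<bar>LBINT x:{0..l}. \<bar>f x\<bar> powr p - \<bar>h x\<bar> powr p\<bar>"
      using i by (subst set_integral_diff) auto
    also have "\<dots> \<le> (LBINT x:{0..l}. \<bar>\<bar>f x\<bar> powr p - \<bar>h x\<bar> powr p\<bar>)"
      using i by (intro set_integral_abs_le) auto
    also have "\<dots> \<le> (LBINT x:{0..l}. \<epsilon> / l)"
    proof (rule set_integral_mono)
      show "set_integrable lborel {0..l} (\<lambda>x. \<bar>\<bar>f x\<bar> powr p - \<bar>h x\<bar> powr p\<bar>)"
        using i by (intro set_integrable_abs) auto
      show "set_integrable lborel {0..l} (\<lambda>x. \<epsilon> / l)"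
        by (intro borel_integrable_atLeastAtMost' continuous_on_const)
      fix x assume x: "x \<in> {0..l}"
      have "\<bar>f x - h x\<bar> < d" "\<bar>f x - h x\<bar> < 1" "\<bar>h x\<bar> \<le> M" using f x M by auto
      then have "f x \<in> ?J" "h x \<in> ?J" "dist (f x) (h x) < d" by (auto simp: dist_real_def)
      with d(2) show "\<bar>\<bar>f x\<bar> powr p - \<bar>h x\<bar> powr p\<bar> \<le> \<epsilon> / l"
        by (auto simp: dist_real_def intro: less_imp_le)
    qed
    also have "\<dots> = \<epsilon>" using l by (simp add: set_integral_const)
    finally show "\<bar>(LBINT x:{0..l}. \<bar>f x\<bar> powr p) - (LBINT x:{0..l}. \<bar>h x\<bar> powr p)\<bar> \<le> \<epsilon>" .
  qed
qed

lemma L2_norm_tendsto: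
  assumes g: "\<And>n. Lq_on 2 I (g n)" and G: "Lq_on 2 I G"
    and lim: "(\<lambda>n. LBINT x:I. (g n x - G x)\<^sup>2) \<longlonglongrightarrow> 0"
  shows "(\<lambda>n. LBINT x:I. (g n x)\<^sup>2) \<longlonglongrightarrow> (LBINT x:I. (G x)\<^sup>2)"
proof -
  let ?d = "\<lambda>n. LBINT x:I. (g n x - G x)\<^sup>2" and ?c = "\<lambda>n. LBINT x:I. G x * (g n x - G x)"
  have eq: "(LBINT x:I. (g n x)\<^sup>2) = (LBINT x:I. (G x)\<^sup>2) + 2 * ?c n + ?d n" for n
    using L2_integral_lincomb[OF G L2_diff[OF g G], of 1 1 n] by simp
  have "\<bar>?c n\<bar> \<le> sqrt (LBINT x:I. (G x)\<^sup>2) * sqrt (?d n)" for n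
    by (rule L2_Cauchy_Schwarz[OF G L2_diff[OF g G]])
  moreover have "(\<lambda>n. sqrt (LBINT x:I. (G x)\<^sup>2) * sqrt (?d n)) \<longlonglongrightarrow> sqrt (LBINT x:I. (G x)\<^sup>2) * sqrt 0"
    by (intro tendsto_mult tendsto_const tendsto_real_sqrt lim)
  ultimately have c: "?c \<longlonglongrightarrow> 0"
    by (intro Lim_null_comparison[of ?c]) auto
  have "(\<lambda>n. (LBINT x:I. (G x)\<^sup>2) + 2 * ?c n + ?d n) \<longlonglongrightarrow> (LBINT x:I. (G x)\<^sup>2) + 2 * 0 + 0"
    by (intro tendsto_add tendsto_mult tendsto_const c lim)
  then show ?thesis by (simp add: eq)
qed

subsection \<open>Compactness\<close>

text \<open>Boundedness in \<open>H\<^sup>1\<close> gives uniform bounds and equicontinuity of order one half, so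
  that the theorem of Arzela and Ascoli applies.\<close>

lemma H1_bounded_uniform_subsequence:
  fixes u g :: "nat \<Rightarrow> real \<Rightarrow> real"
  assumes b: "0 < b" and u: "\<And>n. H1_pair {0..b} (u n) (g n)"
    and m: "\<And>n. (LBINT x:{0..b}. (u n x)\<^sup>2) \<le> m" and d: "\<And>n. (LBINT x:{0..b}. (g n x)\<^sup>2) \<le> d"
  shows "\<exists>h k. continuous_on {0..b} h \<and> strict_mono (k :: nat \<Rightarrow> nat) \<and>
    (\<forall>e>0. \<exists>N. \<forall>n x. n \<ge> N \<and> x \<in> {0..b} \<longrightarrow> \<bar>u (k n) x - h x\<bar> < e)"
proof -
  have I: "is_interval {0..b}" by simp
  have m0: "0 \<le> m" and d0: "0 \<le> d"
    using order_trans[OF L2_integral_nonneg m] order_trans[OF L2_integral_nonneg d] by auto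
  define B where "B = m / b + 2 * sqrt m * sqrt d"
  have bound: "norm (u n x) \<le> sqrt B" if x: "x \<in> {0..b}" for n x
  proof -
    have "(u n x)\<^sup>2 \<le> B"
    proof (rule order_trans[OF H1_pair_sup_bound[OF b u x]])
      show "(LBINT x:{0..b}. (u n x)\<^sup>2) / b + 2 * sqrt (LBINT x:{0..b}. (u n x)\<^sup>2) * sqrt (LBINT x:{0..b}. (g n x)\<^sup>2) \<le> B"
        unfolding B_def using b m[of n] d[of n] m0 d0
        by (intro add_mono divide_right_mono mult_mono real_sqrt_le_mono) (auto simp: L2_integral_nonneg)
    qed
    then show ?thesis by (auto intro: real_le_rsqrt)
  qed
  have equi: "\<exists>\<delta>. 0 < \<delta> \<and> (\<forall>n y. y \<in> {0..b} \<and> norm (x - y) < \<delta> \<longrightarrow> norm (u n x - u n y) < e)"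
    if x: "x \<in> {0..b}" and e: "0 < e" for x e
  proof (intro exI[of _ "(e / (sqrt d + 1))\<^sup>2"] conjI allI impI)
    have s: "0 < sqrt d + 1" using d0 by (simp add: add_nonneg_pos)
    then show "0 < (e / (sqrt d + 1))\<^sup>2" using e by simp
    fix n y assume y: "y \<in> {0..b} \<and> norm (x - y) < (e / (sqrt d + 1))\<^sup>2"
    have "AC_on {0..b} (u n) (g n)" "Lq_on 2 {0..b} (g n)" using u[of n] by (auto simp: H1_pair_def)
    from AC_holder[OF I this _ x, of y]
    have "\<bar>u n x - u n y\<bar> \<le> sqrt \<bar>x - y\<bar> * sqrt (LBINT t:{0..b}. (g n t)\<^sup>2)" using y by simp
    also have "\<dots> \<le> sqrt \<bar>x - y\<bar> * (sqrt d + 1)"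
    proof (rule mult_left_mono)
      show "sqrt (LBINT t:{0..b}. (g n t)\<^sup>2) \<le> sqrt d + 1"
        using real_sqrt_le_mono[OF d[of n]] by linarith
    qed simp
    also have "sqrt \<bar>x - y\<bar> < e / (sqrt d + 1)"
      using y e s by (intro real_less_lsqrt) auto
    then have "sqrt \<bar>x - y\<bar> * (sqrt d + 1) < e" using s by (simp add: pos_less_divide_eq)
    finally show "norm (u n x - u n y) < e" by simp
  qed
  obtain h k where "continuous_on {0..b} h" "strict_mono (k :: nat \<Rightarrow> nat)"
      "\<And>e. 0 < e \<Longrightarrow> \<exists>N. \<forall>n x. n \<ge> N \<and> x \<in> {0..b} \<longrightarrow> norm (u (k n) x - h x) < e"
    using Arzela_Ascoli[OF compact_Icc bound equi] by blast
  then show ?thesis unfolding real_norm_def by (intro exI[of _ h] exI[of _ k] conjI allI impI)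
qed

lemma H1_bounded_uniform_subsequence_family:
  fixes u g :: "nat \<Rightarrow> 'e \<Rightarrow> real \<Rightarrow> real"
  assumes "finite F" and b: "\<And>e. e \<in> F \<Longrightarrow> 0 < b e"
    and u: "\<And>n e. e \<in> F \<Longrightarrow> H1_pair {0..b e} (u n e) (g n e)"
    and m: "\<And>n e. e \<in> F \<Longrightarrow> (LBINT x:{0..b e}. (u n e x)\<^sup>2) \<le> m"
    and d: "\<And>n e. e \<in> F \<Longrightarrow> (LBINT x:{0..b e}. (g n e x)\<^sup>2) \<le> d"
  shows "\<exists>k h. strict_mono (k :: nat \<Rightarrow> nat) \<and> (\<forall>e\<in>F. continuous_on {0..b e} (h e) \<and>
    (\<forall>\<epsilon>>0. \<exists>N. \<forall>n x. n \<ge> N \<and> x \<in> {0..b e} \<longrightarrow> \<bar>u (k n) e x - h e x\<bar> < \<epsilon>))"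
  using assms
proof (induction F rule: finite_induct)
  case empty
  show ?case by (intro exI[of _ id]) (simp add: strict_mono_def)
next
  case (insert e F)
  obtain k h where k: "strict_mono (k :: nat \<Rightarrow> nat)"
    and h: "\<And>e'. e' \<in> F \<Longrightarrow> continuous_on {0..b e'} (h e')"
      "\<And>e' \<epsilon>. e' \<in> F \<Longrightarrow> 0 < \<epsilon> \<Longrightarrow> \<exists>N. \<forall>n x. n \<ge> N \<and> x \<in> {0..b e'} \<longrightarrow> \<bar>u (k n) e' x - h e' x\<bar> < \<epsilon>"
  proof -
    have "\<exists>k h. strict_mono (k :: nat \<Rightarrow> nat) \<and> (\<forall>e\<in>F. continuous_on {0..b e} (h e) \<and>
        (\<forall>\<epsilon>>0. \<exists>N. \<forall>n x. n \<ge> N \<and> x \<in> {0..b e} \<longrightarrow> \<bar>u (k n) e x - h e x\<bar> < \<epsilon>))"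
      by (intro insert.IH insert.prems insertI2)
    then show ?thesis using that by blast
  qed
  obtain h0 k0 where k0: "strict_mono (k0 :: nat \<Rightarrow> nat)" and h0: "continuous_on {0..b e} h0"
      "\<forall>\<epsilon>>0. \<exists>N. \<forall>n x. n \<ge> N \<and> x \<in> {0..b e} \<longrightarrow> \<bar>u (k (k0 n)) e x - h0 x\<bar> < \<epsilon>"
    using H1_bounded_uniform_subsequence[of "b e" "\<lambda>n. u (k n) e" "\<lambda>n. g (k n) e" m d,
        OF insert.prems[OF insertI1]] by (elim exE conjE)
  show ?case
  proof (intro exI[of _ "k \<circ> k0"] exI[of _ "h(e := h0)"] conjI ballI allI impI)
    show "strict_mono (k \<circ> k0)" using k k0 by (rule strict_mono_o)
    fix e' assume e': "e' \<in> insert e F"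
    show "continuous_on {0..b e'} ((h(e := h0)) e')"
      using h(1) h0(1) e' by (cases "e' = e") simp_all
    fix \<epsilon> :: real assume \<epsilon>: "0 < \<epsilon>"
    show "\<exists>N. \<forall>n x. n \<ge> N \<and> x \<in> {0..b e'} \<longrightarrow> \<bar>u ((k \<circ> k0) n) e' x - (h(e := h0)) e' x\<bar> < \<epsilon>"
    proof (cases "e' = e")
      case True
      with h0(2)[rule_format, OF \<epsilon>] show ?thesis by simp
    next
      case False
      with e' have "e' \<in> F" by simp
      from h(2)[OF this \<epsilon>] obtain N
        where N: "\<And>n x. n \<ge> N \<Longrightarrow> x \<in> {0..b e'} \<Longrightarrow> \<bar>u (k n) e' x - h e' x\<bar> < \<epsilon>"
        by blast
      have "\<bar>u (k (k0 n)) e' x - h e' x\<bar> < \<epsilon>" if "n \<ge> N" "x \<in> {0..b e'}" for n x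
        using N[of "k0 n" x] seq_suble[OF k0, of n] that by simp
      with False show ?thesis by (intro exI[of _ N]) simp
    qed
  qed
qed

subsection \<open>The competitor \<open>sqrt (f\<^sup>2 + t \<eta>\<^sup>2)\<close>\<close>

text \<open>Here \<open>\<eta> x = exp (- k x)\<close>. The square of the derivative of \<open>sqrt (f\<^sup>2 + t \<eta>\<^sup>2)\<close> falls short of
  \<open>g\<^sup>2 + t \<eta>'\<^sup>2\<close> by exactly \<open>t\<close> times the square of the following defect.\<close>

definition defect :: "real \<Rightarrow> real \<Rightarrow> (real \<Rightarrow> real) \<Rightarrow> (real \<Rightarrow> real) \<Rightarrow> real \<Rightarrow> real" where
  "defect k t f g x = exp (- (k * x)) * (g x + k * f x) / sqrt ((f x)\<^sup>2 + t * (exp (- (k * x)))\<^sup>2)"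

lemma competitor_AC:
  assumes I: "is_interval I" and f: "AC_on I f g" and t: "0 < t"
  shows "AC_on I (\<lambda>x. (f x)\<^sup>2 + t * (exp (- (k * x)))\<^sup>2)
    (\<lambda>x. 2 * (f x * g x - t * k * (exp (- (k * x)))\<^sup>2))"
proof -
  have e: "AC_on I (\<lambda>x. exp (- (k * x))) (\<lambda>x. - k * exp (- (k * x)))"
    by (rule AC_of_continuous_deriv) (auto intro!: derivative_eq_intros continuous_intros)
  have "AC_on I (\<lambda>x. 1 * (f x)\<^sup>2 + t * (exp (- (k * x)))\<^sup>2)
      (\<lambda>x. 1 * (2 * f x * g x) + t * (2 * exp (- (k * x)) * (- k * exp (- (k * x)))))"
    by (intro AC_lincomb AC_square I f e)
  then show ?thesis by (simp add: power2_eq_square algebra_simps)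
qed

lemma competitor_H1_pair:
  assumes I: "ray_or_segment I" and f: "H1_pair I f g" and t: "0 < t"
    and \<eta>: "Lq_on 2 I (\<lambda>x. exp (- (k * x)))"
  defines "v \<equiv> \<lambda>x. sqrt ((f x)\<^sup>2 + t * (exp (- (k * x)))\<^sup>2)"
  shows "\<exists>v'. H1_pair I v v' \<and> (LBINT x:I. (v' x)\<^sup>2) =
      (LBINT x:I. (g x)\<^sup>2) + t * k\<^sup>2 * (LBINT x:I. (exp (- (k * x)))\<^sup>2) - t * (LBINT x:I. (defect k t f g x)\<^sup>2)"
    and "(LBINT x:I. (v x)\<^sup>2) = (LBINT x:I. (f x)\<^sup>2) + t * (LBINT x:I. (exp (- (k * x)))\<^sup>2)"
    and "Lq_on 2 I (defect k t f g)"
proof -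
  let ?\<eta> = "\<lambda>x. exp (- (k * x))"
  define W where "W x = (f x)\<^sup>2 + t * (?\<eta> x)\<^sup>2" for x
  have W: "0 < W x" for x unfolding W_def using t by (intro add_nonneg_pos) auto
  have Wne: "W x \<noteq> 0" for x using W[of x] by simp
  have vW: "v x = sqrt (W x)" for x by (simp add: v_def W_def)
  have v2: "(v x)\<^sup>2 = W x" and v0: "0 < v x" for x
    using W[of x] by (simp_all add: vW)
  have vne: "v x \<noteq> 0" for x using v0[of x] by simp
  have iI: "is_interval I" and bI: "I \<in> sets borel" using ray_or_segmentD[OF I] by auto
  have AC: "AC_on I f g" and L: "Lq_on 2 I f" "Lq_on 2 I g" using f by (auto simp: H1_pair_def)
  have cf: "continuous_on I f" by (rule H1_pair_continuous[OF I f])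
  have c\<eta>: "continuous_on I ?\<eta>" by (intro continuous_intros)
  have cW: "continuous_on I W" unfolding W_def[abs_def] by (intro continuous_intros cf)
  have cv: "continuous_on I v"
    unfolding vW by (intro continuous_intros cW)
  have meas: "set_borel_measurable lborel I c" if "continuous_on I c" for c :: "real \<Rightarrow> real"
    using borel_measurable_continuous_on_indicator[OF bI that] by (simp add: set_borel_measurable_def)
  \<comment> \<open>This is \<open>(f f' + t \<eta> \<eta>') / v\<close>, since \<open>\<eta>' = - k \<eta>\<close>.\<close>
  define v' where "v' x = (f x * g x - t * k * (?\<eta> x)\<^sup>2) / v x" for x
  have ACW: "AC_on I W (\<lambda>x. 2 * (f x * g x - t * k * (?\<eta> x)\<^sup>2))"
    unfolding W_def[abs_def] by (rule competitor_AC[OF iI AC t])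
  have "AC_on I (\<lambda>x. sqrt (W x)) (\<lambda>x. inverse (sqrt (W x)) / 2 * (2 * (f x * g x - t * k * (?\<eta> x)\<^sup>2)))"
  proof (rule AC_chain[OF iI ACW])
    show "(sqrt has_real_derivative inverse (sqrt (W x)) / 2) (at (W x))" for x
      by (rule DERIV_real_sqrt[OF W])
    show "continuous_on (W ` I) (\<lambda>y. inverse (sqrt y) / 2)"
      by (intro continuous_on_divide continuous_on_inverse continuous_on_real_sqrt
          continuous_on_id continuous_on_const) (auto simp: Wne)
  qed
  moreover have "inverse (sqrt (W x)) / 2 * (2 * (f x * g x - t * k * (?\<eta> x)\<^sup>2)) = v' x" for x
  proof -
    have "inverse r / 2 * (2 * n) = n / r" for r n :: real
      by (cases "r = 0") (auto simp: field_simps)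
    then show ?thesis unfolding v'_def vW .
  qed
  ultimately have ACv: "AC_on I v v'" unfolding vW[symmetric] by (simp only:)
  have sw: "(f x)\<^sup>2 \<le> (v x)\<^sup>2" "t * (?\<eta> x)\<^sup>2 \<le> (v x)\<^sup>2" for x
    using t by (simp_all add: v2 W_def)
  have q: "Lq_on 2 I (\<lambda>x. 1 * g x + k * f x)" by (rule L2_lincomb[OF L(2,1)])
  have dm: "set_borel_measurable lborel I (defect k t f g)"
  proof -
    have "set_borel_measurable lborel I (\<lambda>x. ?\<eta> x / v x * (1 * g x + k * f x))"
    proof (rule set_borel_measurable_compose2(1))
      show "set_borel_measurable lborel I (\<lambda>x. ?\<eta> x / v x)"
        by (rule meas[OF continuous_on_divide[OF c\<eta> cv]]) (simp add: vne)
      show "set_borel_measurable lborel I (\<lambda>x. 1 * g x + k * f x)" using q by (simp only: Lq_on_2_iff)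
    qed
    then show ?thesis by (simp add: defect_def[abs_def] vW W_def)
  qed
  have "\<bar>defect k t f g x\<bar> \<le> \<bar>(1 / sqrt t) * (1 * g x + k * f x)\<bar>" for x
  proof -
    have "sqrt t * ?\<eta> x \<le> v x"
    proof (rule power2_le_imp_le)
      show "(sqrt t * ?\<eta> x)\<^sup>2 \<le> (v x)\<^sup>2"
        unfolding power_mult_distrib real_sqrt_pow2[OF less_imp_le[OF t]] by (rule sw(2))
    qed (rule less_imp_le[OF v0])
    moreover have "a / c \<le> 1 / b" if "b * a \<le> c" "0 < b" "0 < c" for a b c :: real
      using that by (simp add: field_simps)
    ultimately have "?\<eta> x / v x \<le> 1 / sqrt t" using t v0[of x] by simp
    then have "?\<eta> x / v x * \<bar>g x + k * f x\<bar> \<le> 1 / sqrt t * \<bar>g x + k * f x\<bar>"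
      by (rule mult_right_mono) simp
    then show ?thesis using v0[of x] t by (simp add: defect_def W_def[symmetric] vW[symmetric] abs_mult)
  qed
  then show dL: "Lq_on 2 I (defect k t f g)"
    by (rule L2_bound(1)[OF L2_cmult[OF q] dm])
  have id: "(v' x)\<^sup>2 = (g x)\<^sup>2 + t * k\<^sup>2 * (?\<eta> x)\<^sup>2 - t * (defect k t f g x)\<^sup>2" for x
  proof -
    have "(v' x)\<^sup>2 * W x = (f x * g x - t * k * (?\<eta> x)\<^sup>2)\<^sup>2"
      using v0[of x] by (simp add: v'_def power_divide flip: v2)
    moreover have "(defect k t f g x)\<^sup>2 * W x = (?\<eta> x)\<^sup>2 * (g x + k * f x)\<^sup>2"
      using W[of x] by (simp add: defect_def power_divide power_mult_distrib W_def[symmetric])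
    ultimately have "(v' x)\<^sup>2 * W x = ((g x)\<^sup>2 + t * k\<^sup>2 * (?\<eta> x)\<^sup>2 - t * (defect k t f g x)\<^sup>2) * W x"
      unfolding left_diff_distrib mult.assoc
      by (simp add: W_def power2_eq_square algebra_simps)
    then show ?thesis using W[of x] by simp
  qed
  have int: "set_integrable lborel I (\<lambda>x. (g x)\<^sup>2)" "set_integrable lborel I (\<lambda>x. (?\<eta> x)\<^sup>2)"
      "set_integrable lborel I (\<lambda>x. (defect k t f g x)\<^sup>2)" "set_integrable lborel I (\<lambda>x. (f x)\<^sup>2)"
    using L \<eta> dL by (simp_all only: Lq_on_2_iff)
  have Lv: "Lq_on 2 I v"
    unfolding Lq_on_2_iff v2 W_def using meas[OF cv] int by (intro conjI set_integral_add(1)) auto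
  have mv': "set_borel_measurable lborel I v'"
  proof -
    have "set_borel_measurable lborel I (\<lambda>x. (f x / v x) * g x + - t * k * (?\<eta> x)\<^sup>2 / v x)"
    proof (intro set_borel_measurable_compose2)
      show "set_borel_measurable lborel I (\<lambda>x. f x / v x)"
        by (rule meas[OF continuous_on_divide[OF cf cv]]) (simp add: vne)
      show "set_borel_measurable lborel I g" using L by (simp only: Lq_on_2_iff)
      show "set_borel_measurable lborel I (\<lambda>x. - t * k * (?\<eta> x)\<^sup>2 / v x)"
        by (rule meas[OF continuous_on_divide[OF continuous_on_mult[OF continuous_on_const
                continuous_on_power[OF c\<eta>]] cv]]) (simp add: vne)
    qed
    then show ?thesis by (simp add: v'_def[abs_def] diff_divide_distrib)
  qed
  have Lv': "Lq_on 2 I v'"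
    unfolding Lq_on_2_iff id using mv' int by (intro conjI set_integral_add(1) set_integral_diff(1)) auto
  have "(LBINT x:I. (v' x)\<^sup>2) = (LBINT x:I. (g x)\<^sup>2 + t * k\<^sup>2 * (?\<eta> x)\<^sup>2) - (LBINT x:I. t * (defect k t f g x)\<^sup>2)"
    unfolding id using int by (intro set_integral_diff(2) set_integral_add(1)) auto
  also have "(LBINT x:I. (g x)\<^sup>2 + t * k\<^sup>2 * (?\<eta> x)\<^sup>2) = (LBINT x:I. (g x)\<^sup>2) + (LBINT x:I. t * k\<^sup>2 * (?\<eta> x)\<^sup>2)"
    using int by (intro set_integral_add(2)) auto
  finally have "(LBINT x:I. (v' x)\<^sup>2) =
      (LBINT x:I. (g x)\<^sup>2) + t * k\<^sup>2 * (LBINT x:I. (?\<eta> x)\<^sup>2) - t * (LBINT x:I. (defect k t f g x)\<^sup>2)"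
    by simp
  with ACv Lv Lv' show "\<exists>v'. H1_pair I v v' \<and> (LBINT x:I. (v' x)\<^sup>2) =
      (LBINT x:I. (g x)\<^sup>2) + t * k\<^sup>2 * (LBINT x:I. (?\<eta> x)\<^sup>2) - t * (LBINT x:I. (defect k t f g x)\<^sup>2)"
    by (intro exI[of _ v']) (simp add: H1_pair_def)
  have "(LBINT x:I. (f x)\<^sup>2 + t * (?\<eta> x)\<^sup>2) = (LBINT x:I. (f x)\<^sup>2) + (LBINT x:I. t * (?\<eta> x)\<^sup>2)"
    using int by (intro set_integral_add(2)) auto
  then show "(LBINT x:I. (v x)\<^sup>2) = (LBINT x:I. (f x)\<^sup>2) + t * (LBINT x:I. (?\<eta> x)\<^sup>2)"
    unfolding v2 W_def by simp
qed

text \<open>If the defects stay bounded in \<open>L\<^sup>2\<close> as \<open>t \<rightarrow> 0\<close>, then the functions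
  \<open>ln ((f / \<eta>)\<^sup>2 + t)\<close>, whose derivatives are at most \<open>2 / \<eta>\<close> times the defects, have bounded
  oscillation. At a zero of \<open>f\<close> their value is \<open>ln t\<close>, so that \<open>f\<close> vanishes everywhere.\<close>

lemma zero_spreads:
  assumes I: "ray_or_segment I" and f: "H1_pair I f g" and k: "0 \<le> k"
    and dL: "\<And>t. 0 < t \<Longrightarrow> Lq_on 2 I (defect k t f g)"
    and dC: "\<And>t. 0 < t \<Longrightarrow> (LBINT x:I. (defect k t f g x)\<^sup>2) \<le> C"
    and ab: "a \<in> I" "b \<in> I" and a: "f a = 0"
  shows "f b = 0"
proof -
  let ?\<eta> = "\<lambda>x. exp (- (k * x))"
  have iI: "is_interval I" using ray_or_segmentD[OF I] by auto
  have AC: "AC_on I f g" using f by (simp add: H1_pair_def)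
  define X where "X = max a b"
  define B where "B = 2 * exp (k * X) * (sqrt \<bar>b - a\<bar> * sqrt C)"
  \<comment> \<open>The bound on the oscillation of \<open>ln (W x) + 2 k x = ln ((f x / \<eta> x)\<^sup>2 + t)\<close> between \<open>a\<close> and
    \<open>b\<close>, exponentiated.\<close>
  have osc: "(f b)\<^sup>2 * exp (2 * k * b) + t \<le> t * exp B" if t: "0 < t" for t
  proof -
    define W where "W x = (f x)\<^sup>2 + t * (?\<eta> x)\<^sup>2" for x
    have W: "0 < W x" for x unfolding W_def using t by (intro add_nonneg_pos) auto
  have Wne: "W x \<noteq> 0" for x using W[of x] by simp
    have ACW: "AC_on I W (\<lambda>x. 2 * (f x * g x - t * k * (?\<eta> x)\<^sup>2))"
      unfolding W_def[abs_def] by (rule competitor_AC[OF iI AC t])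
    have "AC_on I (\<lambda>x. ln (W x)) (\<lambda>x. inverse (W x) * (2 * (f x * g x - t * k * (?\<eta> x)\<^sup>2)))"
    proof (rule AC_chain[OF iI ACW])
      show "(ln has_real_derivative inverse (W x)) (at (W x))" for x
        using DERIV_ln[OF W] .
      show "continuous_on (W ` I) inverse"
        by (intro continuous_on_inverse continuous_on_id) (auto simp: Wne)
    qed
    moreover have "AC_on I (\<lambda>x. 2 * k * x) (\<lambda>x. 2 * k)"
      by (rule AC_of_continuous_deriv) (auto intro!: derivative_eq_intros)
    ultimately have "AC_on I (\<lambda>x. 1 * ln (W x) + 1 * (2 * k * x))
        (\<lambda>x. 1 * (inverse (W x) * (2 * (f x * g x - t * k * (?\<eta> x)\<^sup>2))) + 1 * (2 * k))"
      by (rule AC_lincomb)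
    moreover have "1 * (inverse (W x) * (2 * (f x * g x - t * k * (?\<eta> x)\<^sup>2))) + 1 * (2 * k)
        = 2 * f x * (g x + k * f x) / W x" for x
      using W[of x] by (simp add: field_simps W_def power2_eq_square)
    ultimately have ACL: "AC_on I (\<lambda>x. ln (W x) + 2 * k * x) (\<lambda>x. 2 * f x * (g x + k * f x) / W x)"
      by simp
    have le: "\<bar>2 * f x * (g x + k * f x) / W x\<bar> \<le> 2 * exp (k * X) * \<bar>defect k t f g x\<bar>" if "x \<le> X" for x
    proof -
      have s: "0 < sqrt (W x)" "W x = sqrt (W x) * sqrt (W x)" using W[of x] by auto
      have "(f x)\<^sup>2 \<le> W x" using t by (simp add: W_def)
      then have fW: "\<bar>f x\<bar> \<le> sqrt (W x)" using real_sqrt_le_mono by fastforce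
      have e1: "1 \<le> exp (k * X) * ?\<eta> x"
        using mult_left_mono[OF that k] by (simp add: exp_minus field_simps)
      have "\<bar>2 * f x * (g x + k * f x) / W x\<bar> = 2 * \<bar>f x\<bar> * \<bar>g x + k * f x\<bar> / (sqrt (W x) * sqrt (W x))"
        using W[of x] by (simp add: abs_mult)
      also have "\<dots> \<le> 2 * sqrt (W x) * \<bar>g x + k * f x\<bar> / (sqrt (W x) * sqrt (W x))"
        using fW s(1) by (intro divide_right_mono mult_right_mono mult_left_mono) auto
      also have "\<dots> = 2 * 1 * (\<bar>g x + k * f x\<bar> / sqrt (W x))"
      proof -
        have "2 * r * n / (r * r) = 2 * 1 * (n / r)" if "0 < r" for r n :: real using that by simp
        then show ?thesis using s(1) .
      qed
      also have "\<dots> \<le> 2 * (exp (k * X) * ?\<eta> x) * (\<bar>g x + k * f x\<bar> / sqrt (W x))"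
        using s(1) e1 by (intro mult_right_mono mult_left_mono) auto
      also have "\<dots> = 2 * exp (k * X) * \<bar>defect k t f g x\<bar>"
        using s(1) by (simp add: defect_def W_def[symmetric] abs_mult)
      finally show ?thesis .
    qed
    have osc2: "\<bar>(ln (W y) + 2 * k * y) - (ln (W x) + 2 * k * x)\<bar> \<le> 2 * exp (k * X) * (sqrt (y - x) * sqrt C)"
      if xy: "x \<in> I" "y \<in> I" "x \<le> y" "y \<le> X" for x y
    proof -
      have s: "{x..y} \<subseteq> I" by (rule is_interval_Icc_subset[OF iI xy(1,2)])
      have i: "set_integrable lborel {x..y} (\<lambda>x. 2 * f x * (g x + k * f x) / W x)"
        by (rule AC_onD(1)[OF ACL xy(1-3)])
      have dxy: "Lq_on 2 {x..y} (defect k t f g)" by (rule L2_mono[OF dL[OF t] s]) simp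
      have "\<bar>(ln (W y) + 2 * k * y) - (ln (W x) + 2 * k * x)\<bar> = \<bar>LBINT x:{x..y}. 2 * f x * (g x + k * f x) / W x\<bar>"
        using AC_onD(2)[OF ACL xy(1-3)] by simp
      also have "\<dots> \<le> (LBINT x:{x..y}. \<bar>2 * f x * (g x + k * f x) / W x\<bar>)"
        by (rule set_integral_abs_le[OF i])
      also have "\<dots> \<le> (LBINT x:{x..y}. 2 * exp (k * X) * \<bar>defect k t f g x\<bar>)"
        using i L2_integrable[OF dxy] xy(4) le
        by (intro set_integral_mono set_integrable_mult_right set_integrable_abs) auto
      also have "\<dots> \<le> 2 * exp (k * X) * (sqrt (y - x) * sqrt (LBINT x:{x..y}. (defect k t f g x)\<^sup>2))"
        using L2_integral_abs_le[OF dxy xy(3)] by simp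
      also have "\<dots> \<le> 2 * exp (k * X) * (sqrt (y - x) * sqrt C)"
        using order_trans[OF L2_mono_integral[OF dL[OF t] s] dC[OF t]] xy(3)
        by (intro mult_left_mono real_sqrt_le_mono) auto
      finally show ?thesis .
    qed
    have "(ln (W b) + 2 * k * b) - (ln (W a) + 2 * k * a) \<le> B"
      using osc2[of a b] osc2[of b a] ab by (cases "a \<le> b") (auto simp: B_def X_def abs_minus_commute)
    moreover have "ln (W a) + 2 * k * a = ln t"
    proof -
      have "W a = t * exp (2 * - (k * a))" using a by (simp only: W_def exp_double) simp
      then have "ln (W a) = ln t + 2 * - (k * a)" using t by (simp only: ln_mult_pos exp_gt_zero ln_exp)
      then show ?thesis by simp
    qed
    ultimately have "ln (W b) + 2 * k * b \<le> ln t + B" by simp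
    then have "exp (ln (W b) + 2 * k * b) \<le> exp (ln t + B)" by simp
    then have "W b * exp (2 * k * b) \<le> t * exp B" using W[of b] t by (simp add: exp_add)
    moreover have "W b * exp (2 * k * b) = (f b)\<^sup>2 * exp (2 * k * b) + t"
    proof -
      have "(?\<eta> b)\<^sup>2 * exp (2 * k * b) = exp (2 * - (k * b)) * exp (2 * k * b)"
        by (simp only: exp_double)
      also have "\<dots> = exp (2 * - (k * b) + 2 * k * b)" by (simp only: exp_add)
      also have "2 * - (k * b) + 2 * k * b = 0" by simp
      also have "exp (0 :: real) = 1" by (rule exp_zero)
      finally have one: "(?\<eta> b)\<^sup>2 * exp (2 * k * b) = 1" .
      have "W b * exp (2 * k * b) = (f b)\<^sup>2 * exp (2 * k * b) + t * ((?\<eta> b)\<^sup>2 * exp (2 * k * b))"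
        by (simp only: W_def distrib_right mult.assoc)
      then show ?thesis by (simp only: one mult_1_right)
    qed
    ultimately show ?thesis by simp
  qed
  show ?thesis
  proof (rule ccontr)
    assume "f b \<noteq> 0"
    define c where "c = (f b)\<^sup>2 * exp (2 * k * b)"
    have c: "0 < c" using \<open>f b \<noteq> 0\<close> by (simp add: c_def)
    \<comment> \<open>For this \<open>t\<close> the bound \<open>c + t \<le> t * exp B\<close> fails.\<close>
    define t where "t = c / exp B"
    have "0 < t" using c by (simp add: t_def)
    from osc[OF this] have "c + t \<le> c" by (simp add: c_def[symmetric] t_def)
    with \<open>0 < t\<close> show False by simp
  qed
qed

section \<open>The variational problem in terms of functions with derivatives\<close>

lemma set_integral_singleton: "(LBINT t:{a..a :: real}. g t) = (0 :: real)"
  unfolding set_lebesgue_integral_def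
  by (rule integral_eq_zero_AE, rule eventually_mono[OF AE_lborel_singleton[of a]]) (auto simp: indicator_def)

locale core_graph =
  fixes K :: "('v, 'e) metric_graph"
    and N :: nat
    and s :: "nat \<Rightarrow> 'v"
    and G :: "('v + nat, 'e + nat) metric_graph"
    and E_K :: "('e + nat) set"
    and \<mu> p :: real
  assumes K: "compact_metric_graph K"
    and edges_K_nonempty: "edges K \<noteq> {}"
    and N: "1 \<le> N"
    and s: "\<And>i. i < N \<Longrightarrow> s i \<in> vertices K"
    and G: "G = attach_half_lines K N s"
    and E_K: "E_K = Inl ` edges K"
    and \<mu>: "0 < \<mu>"
    and p: "2 < p" "p < 6"
begin

abbreviation J :: "'e + nat \<Rightarrow> real set" where
  "J \<equiv> edge_interval G"

definition edge_len :: "'e + nat \<Rightarrow> real" where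
  "edge_len e = real_of_ereal (len G e)"

lemma edges_G: "edges G = Inl ` edges K \<union> Inr ` {..<N}"
  by (simp add: G attach_half_lines_def Plus_def)

lemma finite_edges: "finite (edges G)" "finite E_K"
  using K by (auto simp: edges_G E_K compact_metric_graph_def)

lemma E_K_subset: "E_K \<subseteq> edges G"
  by (auto simp: edges_G E_K)

lemma E_K_nonempty: "E_K \<noteq> {}"
  using edges_K_nonempty by (simp add: E_K)

lemma len_G: "len G (Inl e) = len K e" "len G (Inr i) = \<infinity>"
  by (simp_all add: G attach_half_lines_def)

lemma tail_G: "tail (skeleton G) (Inl e) = Inl (tail (skeleton K) e)" "tail (skeleton G) (Inr i) = Inl (s i)"
  and head_G: "head (skeleton G) (Inl e) = Inl (head (skeleton K) e)"
  by (simp_all add: G attach_half_lines_def)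

lemma core_edge:
  assumes "e \<in> E_K"
  shows "0 < edge_len e" "len G e = ereal (edge_len e)" "J e = {0..edge_len e}"
proof -
  obtain e' where e': "e = Inl e'" "e' \<in> edges K" using assms by (auto simp: E_K)
  have "0 < len K e'" "len K e' < \<infinity>"
    using K e'(2) by (auto simp: compact_metric_graph_def is_metric_graph_def)
  then obtain l where l: "len K e' = ereal l" "0 < l" by (cases "len K e'") auto
  then have "edge_len e = l" by (simp add: edge_len_def e'(1) len_G)
  with l show "0 < edge_len e" "len G e = ereal (edge_len e)" "J e = {0..edge_len e}"
    by (auto simp: e'(1) len_G edge_interval_def)
qed

lemma ray_edge: "J (Inr i) = {0..}"
  by (auto simp: edge_interval_def len_G)

lemma edge_cases:
  assumes "e \<in> edges G"
  obtains "e \<in> E_K" | i where "e = Inr i" "i < N"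
  using assms by (auto simp: edges_G E_K)

lemma J_ray_or_segment:
  assumes "e \<in> edges G"
  shows "ray_or_segment (J e)"
  using assms
proof (cases rule: edge_cases)
  case 1
  then show ?thesis using core_edge(1,3) unfolding ray_or_segment_def by blast
next
  case (2 i)
  then show ?thesis by (simp only: ray_edge ray_or_segment_def) simp
qed

text \<open>\<open>w v\<close> is the common value of all edge ends at the vertex \<open>v\<close>.\<close>

definition glued :: "('e + nat \<Rightarrow> real \<Rightarrow> real) \<Rightarrow> bool" where
  "glued u \<longleftrightarrow> (\<exists>w. \<forall>e\<in>edges G. u e 0 = w (tail (skeleton G) e) \<and>
     (len G e < \<infinity> \<longrightarrow> u e (edge_len e) = w (head (skeleton G) e)))"

text \<open>A function in \<open>H\<^sup>1\<close> of the graph with a version of its derivative. This keeps the arbitrary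
  choice made by \<open>weak_deriv\<close> out of the variational argument.\<close>

definition state :: "('e + nat \<Rightarrow> real \<Rightarrow> real) \<Rightarrow> ('e + nat \<Rightarrow> real \<Rightarrow> real) \<Rightarrow> bool" where
  "state u g \<longleftrightarrow> (\<forall>e\<in>edges G. H1_pair (J e) (u e) (g e)) \<and> glued u"

definition sq_norm :: "('e + nat \<Rightarrow> real \<Rightarrow> real) \<Rightarrow> real" where
  "sq_norm u = (\<Sum>e\<in>edges G. LBINT x:J e. (u e x)\<^sup>2)"

definition pot :: "('e + nat \<Rightarrow> real \<Rightarrow> real) \<Rightarrow> real" where
  "pot u = (\<Sum>e\<in>E_K. LBINT x:J e. \<bar>u e x\<bar> powr p)"

definition state_energy :: "('e + nat \<Rightarrow> real \<Rightarrow> real) \<Rightarrow> ('e + nat \<Rightarrow> real \<Rightarrow> real) \<Rightarrow> real" where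
  "state_energy u g = sq_norm g / 2 - pot u / p"

lemma state_pair: "state u g \<Longrightarrow> e \<in> edges G \<Longrightarrow> H1_pair (J e) (u e) (g e)"
  by (simp add: state_def)

lemma state_L2:
  assumes "state u g" "e \<in> edges G"
  shows "Lq_on 2 (J e) (u e)" "Lq_on 2 (J e) (g e)"
  using state_pair[OF assms] by (simp_all add: H1_pair_def)

lemma state_continuous: "state u g \<Longrightarrow> e \<in> edges G \<Longrightarrow> continuous_on (J e) (u e)"
  by (rule H1_pair_continuous[OF J_ray_or_segment state_pair])

lemma Lq_norm_pow_eq: "Lq_norm_pow G (edges G) 2 u = sq_norm u" "Lq_norm_pow G E_K p u = pot u"
  by (simp_all add: Lq_norm_pow_def sq_norm_def pot_def)

lemma continuous_on_graph_iff:
  "continuous_on_graph G u \<longleftrightarrow> (\<forall>e\<in>edges G. continuous_on (J e) (u e)) \<and> glued u"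
  unfolding continuous_on_graph_def glued_def edge_len_def ..

lemma state_imp_H1_graph:
  assumes "state u g"
  shows "u \<in> H1_graph G" "energy G E_K p u = state_energy u g"
proof -
  have "H1_on (J e) (u e)" if "e \<in> edges G" for e
    by (rule H1_pair_imp_H1_on(1)[OF J_ray_or_segment[OF that] state_pair[OF assms that]])
  moreover have "glued u" using assms by (simp add: state_def)
  ultimately show "u \<in> H1_graph G"
    using state_continuous[OF assms] by (simp add: H1_graph_def continuous_on_graph_iff)
  have "sq_norm (\<lambda>e. weak_deriv (J e) (u e)) = sq_norm g"
    unfolding sq_norm_def
    by (intro sum.cong refl H1_pair_imp_H1_on(2)[OF J_ray_or_segment state_pair[OF assms]])
  then show "energy G E_K p u = state_energy u g"
    by (simp add: energy_def state_energy_def Lq_norm_pow_eq)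
qed

lemma H1_graph_imp_state:
  assumes "u \<in> H1_graph G"
  shows "state u (\<lambda>e. weak_deriv (J e) (u e))"
proof -
  have c: "\<forall>e\<in>edges G. continuous_on (J e) (u e)" "glued u" "\<forall>e\<in>edges G. H1_on (J e) (u e)"
    using assms by (auto simp: H1_graph_def continuous_on_graph_iff)
  then show ?thesis
    unfolding state_def by (intro conjI ballI H1_on_imp_pair J_ray_or_segment) auto
qed

lemma ground_energy_le:
  assumes "state u g" "sq_norm u = \<mu>"
  shows "ground_energy G E_K p \<mu> \<le> ereal (state_energy u g)"
proof -
  have "u \<in> H1_mass G \<mu>"
    using state_imp_H1_graph(1)[OF assms(1)] assms(2) by (simp add: H1_mass_def Lq_norm_pow_eq)
  then have "ground_energy G E_K p \<mu> \<le> ereal (energy G E_K p u)"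
    unfolding ground_energy_def by (rule INF_lower)
  then show ?thesis by (simp only: state_imp_H1_graph(2)[OF assms(1)])
qed

lemma H1_mass_imp_state:
  assumes "u \<in> H1_mass G \<mu>"
  obtains g where "state u g" "sq_norm u = \<mu>" "energy G E_K p u = state_energy u g"
proof
  have u: "u \<in> H1_graph G" "sq_norm u = \<mu>"
    using assms by (auto simp: H1_mass_def Lq_norm_pow_eq)
  show "state u (\<lambda>e. weak_deriv (J e) (u e))" by (rule H1_graph_imp_state[OF u(1)])
  then show "energy G E_K p u = state_energy u (\<lambda>e. weak_deriv (J e) (u e))" by (rule state_imp_H1_graph(2))
  show "sq_norm u = \<mu>" by (rule u(2))
qed

lemma ground_energy_approx:
  assumes "ground_energy G E_K p \<mu> < ereal a"
  shows "\<exists>u g. state u g \<and> sq_norm u = \<mu> \<and> state_energy u g < a"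
proof -
  obtain u where u: "u \<in> H1_mass G \<mu>" "ereal (energy G E_K p u) < ereal a"
    using assms unfolding ground_energy_def INF_less_iff by auto
  obtain g where "state u g" "sq_norm u = \<mu>" "energy G E_K p u = state_energy u g"
    by (rule H1_mass_imp_state[OF u(1)])
  with u(2) show ?thesis by auto
qed

lemma sq_norm_nonneg: "0 \<le> sq_norm u"
  unfolding sq_norm_def by (intro sum_nonneg L2_integral_nonneg)

lemma pot_nonneg: "0 \<le> pot u"
  unfolding pot_def set_lebesgue_integral_def
  by (intro sum_nonneg Bochner_Integration.integral_nonneg) simp

lemma edge_le_sq_norm:
  assumes "e \<in> edges G"
  shows "(LBINT x:J e. (u e x)\<^sup>2) \<le> sq_norm u"
  unfolding sq_norm_def
  by (rule member_le_sum[OF assms]) (simp_all add: finite_edges L2_integral_nonneg)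

lemma state_lincomb:
  assumes "state u g" "state v h"
  shows "state (\<lambda>e x. a * u e x + b * v e x) (\<lambda>e x. a * g e x + b * h e x)"
  unfolding state_def
proof (intro conjI ballI)
  fix e assume "e \<in> edges G"
  then show "H1_pair (J e) (\<lambda>x. a * u e x + b * v e x) (\<lambda>x. a * g e x + b * h e x)"
    using assms by (intro H1_pair_lincomb state_pair)
next
  obtain w where w: "\<forall>e\<in>edges G. u e 0 = w (tail (skeleton G) e) \<and>
     (len G e < \<infinity> \<longrightarrow> u e (edge_len e) = w (head (skeleton G) e))"
    using assms(1) unfolding state_def glued_def by (elim exE conjE)
  obtain w' where w': "\<forall>e\<in>edges G. v e 0 = w' (tail (skeleton G) e) \<and>
     (len G e < \<infinity> \<longrightarrow> v e (edge_len e) = w' (head (skeleton G) e))"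
    using assms(2) unfolding state_def glued_def by (elim exE conjE)
  show "glued (\<lambda>e x. a * u e x + b * v e x)"
    unfolding glued_def using w w' by (intro exI[of _ "\<lambda>y. a * w y + b * w' y"]) simp
qed

lemma sq_norm_parallelogram:
  assumes "\<And>e. e \<in> edges G \<Longrightarrow> Lq_on 2 (J e) (u e)" "\<And>e. e \<in> edges G \<Longrightarrow> Lq_on 2 (J e) (v e)"
  shows "sq_norm (\<lambda>e x. 1 / 2 * u e x + 1 / 2 * v e x) =
    sq_norm u / 2 + sq_norm v / 2 - sq_norm (\<lambda>e x. u e x - v e x) / 4"
proof -
  have "(LBINT x:J e. (1 / 2 * u e x + 1 / 2 * v e x)\<^sup>2) =
      (LBINT x:J e. (u e x)\<^sup>2) / 2 + (LBINT x:J e. (v e x)\<^sup>2) / 2 - (LBINT x:J e. (u e x - v e x)\<^sup>2) / 4"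
    if "e \<in> edges G" for e
  proof -
    have "X = a / 2 + b / 2 - Y / 4"
      if "X = (1 / 2)\<^sup>2 * a + 2 * (1 / 2) * (1 / 2) * c + (1 / 2)\<^sup>2 * b" "Y = 1\<^sup>2 * a + 2 * 1 * (- 1) * c + (- 1)\<^sup>2 * b"
      for X Y a b c :: real
      using that by (simp add: power2_eq_square field_simps)
    from this[OF L2_integral_lincomb[OF assms[OF that]] L2_integral_lincomb[OF assms[OF that]]]
    show ?thesis by simp
  qed
  then show ?thesis
    unfolding sq_norm_def
    by (simp add: sum.distrib sum_subtractf flip: sum_divide_distrib)
qed

lemma sq_norm_cmult: "sq_norm (\<lambda>e x. c * u e x) = c\<^sup>2 * sq_norm u"
  by (simp add: sq_norm_def power_mult_distrib sum_distrib_left)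

lemma pot_cmult: "0 \<le> c \<Longrightarrow> pot (\<lambda>e x. c * u e x) = c powr p * pot u"
  by (simp add: pot_def abs_mult powr_mult sum_distrib_left)

lemma pot_bound:
  assumes "state u g" and m: "sq_norm u \<le> m"
  shows "pot u \<le> (\<Sum>e\<in>E_K. (m / edge_len e + 2 * sqrt m * sqrt (sq_norm g)) powr ((p - 2) / 2) * m)"
  unfolding pot_def
proof (rule sum_mono)
  fix e assume e: "e \<in> E_K"
  then have eG: "e \<in> edges G" using E_K_subset by auto
  note c = core_edge[OF e]
  let ?a = "LBINT x:{0..edge_len e}. (u e x)\<^sup>2" and ?d = "LBINT x:{0..edge_len e}. (g e x)\<^sup>2"
  have H: "H1_pair {0..edge_len e} (u e) (g e)" using state_pair[OF assms(1) eG] by (simp only: c(3))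
  have a: "?a \<le> m" "?d \<le> sq_norm g"
    using edge_le_sq_norm[OF eG, of u] edge_le_sq_norm[OF eG, of g] m by (simp_all add: c(3))
  have a0: "0 \<le> ?a" "0 \<le> ?d" by (rule L2_integral_nonneg)+
  have m0: "0 \<le> m" using a(1) a0(1) by linarith
  have "(LBINT x:J e. \<bar>u e x\<bar> powr p) \<le> (?a / edge_len e + 2 * sqrt ?a * sqrt ?d) powr ((p - 2) / 2) * ?a"
    using H1_pair_Lp_bound[OF c(1) H p(1)] by (simp only: c(3))
  also have "\<dots> \<le> (m / edge_len e + 2 * sqrt m * sqrt (sq_norm g)) powr ((p - 2) / 2) * m"
  proof (intro mult_mono powr_mono2)
    show "?a / edge_len e + 2 * sqrt ?a * sqrt ?d \<le> m / edge_len e + 2 * sqrt m * sqrt (sq_norm g)"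
      using a a0 m0 c(1) by (intro add_mono divide_right_mono mult_mono real_sqrt_le_mono) auto
    show "0 \<le> ?a / edge_len e + 2 * sqrt ?a * sqrt ?d"
      using a0 c(1) by simp
  qed (use p a a0 in auto)
  finally show "(LBINT x:J e. \<bar>u e x\<bar> powr p) \<le> (m / edge_len e + 2 * sqrt m * sqrt (sq_norm g)) powr ((p - 2) / 2) * m" .
qed

lemma pot_zero_mass:
  assumes "state u g" "sq_norm u = 0"
  shows "pot u = 0"
  using pot_bound[OF assms(1), of 0] assms(2) pot_nonneg[of u] by simp

text \<open>Coercivity: this is where \<open>p < 6\<close> enters, through the exponent \<open>(p - 2) / 2 < 2\<close>.\<close>

lemma state_energy_coercive:
  "\<exists>C. \<forall>u g. state u g \<longrightarrow> sq_norm u \<le> \<mu> \<longrightarrow> sq_norm g / 4 - C \<le> state_energy u g"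
proof -
  let ?\<theta> = "(p - 2) / 2"
  define n where "n = real (card E_K)"
  have n: "0 < n" using finite_edges(2) E_K_nonempty by (simp add: n_def card_gt_0_iff)
  \<comment> \<open>Summed over the \<open>n\<close> core edges and multiplied by \<open>\<mu> / p\<close>, the quadratic terms add up to
    \<open>sq_norm g / 4\<close>, half of the kinetic energy.\<close>
  define \<epsilon> where "\<epsilon> = p / (4 * n * \<mu>)"
  have \<epsilon>: "0 < \<epsilon>" using p n \<mu> by (simp add: \<epsilon>_def)
  have "\<forall>e\<in>E_K. \<exists>C. \<forall>x\<ge>0. (\<mu> / edge_len e + 2 * sqrt \<mu> * x) powr ?\<theta> \<le> \<epsilon> * x\<^sup>2 + C"
  proof
    fix e assume "e \<in> E_K"
    then have "0 \<le> \<mu> / edge_len e" using core_edge(1) \<mu> by (simp add: less_imp_le)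
    then show "\<exists>C. \<forall>x\<ge>0. (\<mu> / edge_len e + 2 * sqrt \<mu> * x) powr ?\<theta> \<le> \<epsilon> * x\<^sup>2 + C"
      using p \<mu> \<epsilon> by (intro affine_powr_le_small_square) auto
  qed
  then obtain C where C: "\<forall>e\<in>E_K. \<forall>x\<ge>0. (\<mu> / edge_len e + 2 * sqrt \<mu> * x) powr ?\<theta> \<le> \<epsilon> * x\<^sup>2 + C e"
    unfolding bchoice_iff by (elim exE)
  show ?thesis
  proof (intro exI[of _ "(\<Sum>e\<in>E_K. C e) * \<mu> / p"] allI impI)
    fix u g assume u: "state u g" "sq_norm u \<le> \<mu>"
    define x where "x = sqrt (sq_norm g)"
    have x: "0 \<le> x" "x\<^sup>2 = sq_norm g" using sq_norm_nonneg[of g] by (simp_all add: x_def)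
    have "pot u \<le> (\<Sum>e\<in>E_K. (\<mu> / edge_len e + 2 * sqrt \<mu> * x) powr ?\<theta> * \<mu>)"
      using pot_bound[OF u] by (simp only: x_def)
    also have "\<dots> \<le> (\<Sum>e\<in>E_K. (\<epsilon> * x\<^sup>2 + C e) * \<mu>)"
    proof (intro sum_mono mult_right_mono)
      fix e assume "e \<in> E_K"
      with C x(1) show "(\<mu> / edge_len e + 2 * sqrt \<mu> * x) powr ?\<theta> \<le> \<epsilon> * x\<^sup>2 + C e" by blast
    qed (use \<mu> in simp)
    also have "\<dots> = n * (\<epsilon> * x\<^sup>2) * \<mu> + (\<Sum>e\<in>E_K. C e) * \<mu>"
      by (simp add: n_def sum.distrib distrib_right flip: sum_distrib_right)
    also have "n * (\<epsilon> * x\<^sup>2) * \<mu> = p * (sq_norm g / 4)"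
      using n \<mu> by (simp add: \<epsilon>_def x(2))
    finally have "pot u / p \<le> (p * (sq_norm g / 4) + (\<Sum>e\<in>E_K. C e) * \<mu>) / p"
      using p by (intro divide_right_mono) auto
    also have "\<dots> = sq_norm g / 4 + (\<Sum>e\<in>E_K. C e) * \<mu> / p"
      using p by (simp add: add_divide_distrib)
    finally show "sq_norm g / 4 - (\<Sum>e\<in>E_K. C e) * \<mu> / p \<le> state_energy u g"
      unfolding state_energy_def by simp
  qed
qed

lemma pot_continuous:
  assumes h: "\<And>e. e \<in> E_K \<Longrightarrow> continuous_on {0..edge_len e} (h e)" and \<epsilon>: "0 < \<epsilon>"
  shows "\<exists>\<delta>>0. \<forall>v. (\<forall>e\<in>E_K. continuous_on {0..edge_len e} (v e) \<and> (\<forall>x\<in>{0..edge_len e}. \<bar>v e x - h e x\<bar> < \<delta>)) \<longrightarrow>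
    \<bar>pot v - pot h\<bar> \<le> \<epsilon>"
proof -
  define n where "n = real (card E_K)"
  have n: "0 < n" using finite_edges(2) E_K_nonempty by (simp add: n_def card_gt_0_iff)
  have "\<forall>e\<in>E_K. \<exists>\<delta>. 0 < \<delta> \<and> (\<forall>f. continuous_on {0..edge_len e} f \<and> (\<forall>x\<in>{0..edge_len e}. \<bar>f x - h e x\<bar> < \<delta>) \<longrightarrow>
    \<bar>(LBINT x:{0..edge_len e}. \<bar>f x\<bar> powr p) - (LBINT x:{0..edge_len e}. \<bar>h e x\<bar> powr p)\<bar> \<le> \<epsilon> / n)"
    using p \<epsilon> n by (intro ballI Lp_integral_continuous core_edge h) auto
  then obtain \<delta> where \<delta>: "\<forall>e\<in>E_K. 0 < \<delta> e \<and> (\<forall>f. continuous_on {0..edge_len e} f \<and> (\<forall>x\<in>{0..edge_len e}. \<bar>f x - h e x\<bar> < \<delta> e) \<longrightarrow>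
    \<bar>(LBINT x:{0..edge_len e}. \<bar>f x\<bar> powr p) - (LBINT x:{0..edge_len e}. \<bar>h e x\<bar> powr p)\<bar> \<le> \<epsilon> / n)"
    unfolding bchoice_iff by (elim exE)
  define d where "d = Min (\<delta> ` E_K)"
  have d: "0 < d" "\<And>e. e \<in> E_K \<Longrightarrow> d \<le> \<delta> e"
    unfolding d_def using \<delta> finite_edges(2) E_K_nonempty by auto
  show ?thesis
  proof (intro exI[of _ d] conjI d(1) allI impI)
    fix v assume v: "\<forall>e\<in>E_K. continuous_on {0..edge_len e} (v e) \<and> (\<forall>x\<in>{0..edge_len e}. \<bar>v e x - h e x\<bar> < d)"
    have "\<bar>pot v - pot h\<bar> = \<bar>\<Sum>e\<in>E_K. (LBINT x:J e. \<bar>v e x\<bar> powr p) - (LBINT x:J e. \<bar>h e x\<bar> powr p)\<bar>"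
      by (simp only: pot_def sum_subtractf)
    also have "\<dots> \<le> (\<Sum>e\<in>E_K. \<bar>(LBINT x:J e. \<bar>v e x\<bar> powr p) - (LBINT x:J e. \<bar>h e x\<bar> powr p)\<bar>)"
      by (rule sum_abs)
    also have "\<dots> \<le> (\<Sum>e\<in>E_K. \<epsilon> / n)"
    proof (rule sum_mono)
      fix e assume e: "e \<in> E_K"
      have "\<forall>x\<in>{0..edge_len e}. \<bar>v e x - h e x\<bar> < \<delta> e"
        using v e d(2)[OF e] by (meson less_le_trans)
      then show "\<bar>(LBINT x:J e. \<bar>v e x\<bar> powr p) - (LBINT x:J e. \<bar>h e x\<bar> powr p)\<bar> \<le> \<epsilon> / n"
        unfolding core_edge(3)[OF e] using \<delta> v e by blast
    qed
    also have "\<dots> = \<epsilon>" using n by (simp add: n_def)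
    finally show "\<bar>pot v - pot h\<bar> \<le> \<epsilon>" .
  qed
qed

end

section \<open>Existence of a minimizer\<close>

locale negative_level = core_graph K N s G E_K \<mu> p
  for K :: "('v, 'e) metric_graph" and N s G E_K \<mu> p +
  fixes level :: real
  assumes level_le: "\<And>u g. state u g \<Longrightarrow> sq_norm u = \<mu> \<Longrightarrow> level \<le> state_energy u g"
    and level_negative: "level < 0"
begin

text \<open>The lower bound tested with the multiple of \<open>u\<close> that has mass \<open>\<mu>\<close>.\<close>

lemma level_le_rescaled:
  assumes u: "state u g" and m: "0 < sq_norm u" and a: "a = \<mu> / sq_norm u"
  shows "level \<le> a * sq_norm g / 2 - a powr (p / 2) * pot u / p"
proof -
  define c where "c = sqrt a"
  have a0: "0 < a" using m \<mu> by (simp add: a)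
  have c: "0 \<le> c" "c\<^sup>2 = a" using a0 by (simp_all add: c_def)
  have cp: "c powr p = a powr (p / 2)"
    using a0 by (simp add: c_def powr_half_sqrt[symmetric] powr_powr)
  have "state (\<lambda>e x. c * u e x + 0 * u e x) (\<lambda>e x. c * g e x + 0 * g e x)"
    by (rule state_lincomb[OF u u])
  then have st: "state (\<lambda>e x. c * u e x) (\<lambda>e x. c * g e x)" by simp
  have "sq_norm (\<lambda>e x. c * u e x) = \<mu>"
    unfolding sq_norm_cmult c(2) using m by (simp add: a)
  from level_le[OF st this] show ?thesis
    unfolding state_energy_def sq_norm_cmult c(2) pot_cmult[OF c(1)] cp .
qed

text \<open>For \<open>a \<ge> 1\<close> the factor \<open>a powr (p / 2)\<close> of the potential is at least \<open>a\<close>, so that scaling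
  the mass up by \<open>a\<close> multiplies a negative energy by at least \<open>a\<close>.\<close>

lemma level_le_subcritical_mass:
  assumes u: "state u g" and m: "sq_norm u \<le> \<mu>"
  shows "level \<le> state_energy u g" and "sq_norm u < \<mu> \<Longrightarrow> level < state_energy u g"
proof -
  have *: "level \<le> state_energy u g \<and> (sq_norm u < \<mu> \<longrightarrow> level < state_energy u g)"
  proof (cases "state_energy u g \<ge> 0")
    case True
    then show ?thesis using level_negative by linarith
  next
    case False
    have "sq_norm u \<noteq> 0"
    proof
      assume "sq_norm u = 0"
      then have "state_energy u g = sq_norm g / 2" using pot_zero_mass[OF u] by (simp add: state_energy_def)
      with False sq_norm_nonneg[of g] show False by simp
    qed
    then have m0: "0 < sq_norm u" using sq_norm_nonneg[of u] by simp
    define a where "a = \<mu> / sq_norm u"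
    have a: "1 \<le> a" using m m0 by (simp add: a_def)
    have "a \<le> a powr (p / 2)" using powr_mono[of 1 "p / 2" a] a p by simp
    then have "a * (pot u / p) \<le> a powr (p / 2) * (pot u / p)"
      using pot_nonneg[of u] p by (intro mult_right_mono) auto
    then have "level \<le> a * state_energy u g"
      using level_le_rescaled[OF u m0 a_def] by (simp add: state_energy_def right_diff_distrib)
    moreover have "a * state_energy u g \<le> 1 * state_energy u g"
      using a False by (intro mult_right_mono_neg) auto
    moreover have "a * state_energy u g < 1 * state_energy u g" if "sq_norm u < \<mu>"
      using that m0 False by (intro mult_strict_right_mono_neg) (auto simp: a_def)
    ultimately show ?thesis by linarith
  qed
  then show "level \<le> state_energy u g" and "sq_norm u < \<mu> \<Longrightarrow> level < state_energy u g" by auto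
qed

text \<open>The limit of a minimizing sequence: uniform on the initial pieces \<open>{0..b e}\<close> of the edges,
  which are the whole edge in the core, and strong in \<open>L\<^sup>2\<close> for the derivatives, which fixes the
  limit on the rest of each half-line.\<close>

lemma minimizer_exists:
  assumes approx: "\<And>a. level < a \<Longrightarrow> \<exists>u g. state u g \<and> sq_norm u = \<mu> \<and> state_energy u g < a"
  shows "\<exists>u g. state u g \<and> sq_norm u = \<mu> \<and> state_energy u g = level"
proof -
  obtain C where C: "\<forall>u g. state u g \<longrightarrow> sq_norm u \<le> \<mu> \<longrightarrow> sq_norm g / 4 - C \<le> state_energy u g"
    using state_energy_coercive by (elim exE)
  have "\<forall>n :: nat. \<exists>u g. state u g \<and> sq_norm u = \<mu> \<and> state_energy u g < level + 1 / (real n + 1)"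
    by (intro allI approx) simp
  then obtain u0 g0 where min0: "\<forall>n. state (u0 n) (g0 n) \<and> sq_norm (u0 n) = \<mu> \<and>
      state_energy (u0 n) (g0 n) < level + 1 / (real n + 1)"
    unfolding choice_iff by (elim exE)
  define b where "b e = (if e \<in> E_K then edge_len e else 1)" for e
  have b: "0 < b e" "{0..b e} \<subseteq> J e" if "e \<in> edges G" for e
    using that by (cases rule: edge_cases; auto simp: b_def core_edge ray_edge E_K)+
  \<comment> \<open>Coercivity bounds the kinetic energies, as all energies are below \<open>level + 1\<close>.\<close>
  define D where "D = 4 * (level + 1 + C)"
  have gD: "sq_norm (g0 n) \<le> D" for n
  proof -
    have "sq_norm (g0 n) / 4 - C \<le> state_energy (u0 n) (g0 n)" using C min0 by simp
    moreover have "state_energy (u0 n) (g0 n) < level + 1 / (real n + 1)" using min0 by simp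
    ultimately have "sq_norm (g0 n) / 4 - C < level + 1 / (real n + 1)" by (rule le_less_trans)
    also have "\<dots> \<le> level + 1" by simp
    finally show ?thesis unfolding D_def by argo
  qed
  have sub: "(LBINT x:{0..b e}. (f x)\<^sup>2) \<le> (LBINT x:J e. (f x)\<^sup>2)" if "e \<in> edges G" "Lq_on 2 (J e) f" for e f
    by (rule L2_mono_integral[OF that(2) b(2)[OF that(1)]]) simp
  have "\<exists>k h. strict_mono (k :: nat \<Rightarrow> nat) \<and> (\<forall>e\<in>edges G. continuous_on {0..b e} (h e) \<and>
    (\<forall>\<epsilon>>0. \<exists>N. \<forall>n x. n \<ge> N \<and> x \<in> {0..b e} \<longrightarrow> \<bar>u0 (k n) e x - h e x\<bar> < \<epsilon>))"
  proof (rule H1_bounded_uniform_subsequence_family[OF finite_edges(1) b(1)])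
    fix n e assume e: "e \<in> edges G"
    have st: "state (u0 n) (g0 n)" "sq_norm (u0 n) = \<mu>" using min0 by auto
    show "H1_pair {0..b e} (u0 n e) (g0 n e)"
      by (rule H1_pair_mono[OF state_pair[OF st(1) e] b(2)[OF e]]) simp
    show "(LBINT x:{0..b e}. (u0 n e x)\<^sup>2) \<le> \<mu>"
      using sub[OF e state_L2(1)[OF st(1) e]] edge_le_sq_norm[OF e, of "u0 n"] st(2) by linarith
    show "(LBINT x:{0..b e}. (g0 n e x)\<^sup>2) \<le> D"
      using sub[OF e state_L2(2)[OF st(1) e]] edge_le_sq_norm[OF e, of "g0 n"] gD[of n] by linarith
  qed
  then obtain k h where k: "strict_mono (k :: nat \<Rightarrow> nat)" and h: "\<forall>e\<in>edges G. continuous_on {0..b e} (h e) \<and>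
    (\<forall>\<epsilon>>0. \<exists>N. \<forall>n x. n \<ge> N \<and> x \<in> {0..b e} \<longrightarrow> \<bar>u0 (k n) e x - h e x\<bar> < \<epsilon>)"
    by (elim exE conjE)
  define U where "U n = u0 (k n)" for n
  define g where "g n = g0 (k n)" for n
  have st: "state (U n) (g n)" and mass: "sq_norm (U n) = \<mu>" for n
    using min0 by (simp_all add: U_def g_def)
  have state_energy_less: "state_energy (U n) (g n) < level + 1 / (real n + 1)" for n
  proof -
    have "state_energy (U n) (g n) < level + 1 / (real (k n) + 1)" using min0 by (simp add: U_def g_def)
    also have "1 / (real (k n) + 1) \<le> 1 / (real n + 1)"
      using seq_suble[OF k, of n] by (intro divide_left_mono) auto
    finally show ?thesis by simp
  qed
  have L2U: "Lq_on 2 (J e) (U n e)" and L2g: "Lq_on 2 (J e) (g n e)" if "e \<in> edges G" for n e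
    using state_L2[OF st that] by auto
  have state_energy_lim: "(\<lambda>n. state_energy (U n) (g n)) \<longlonglongrightarrow> level"
  proof (rule tendsto_sandwich[of "\<lambda>n. level" _ _ "\<lambda>n. level + 1 / (real n + 1)"])
    show "\<forall>\<^sub>F n in sequentially. level \<le> state_energy (U n) (g n)"
      using level_le[OF st mass] by (intro always_eventually allI)
    show "\<forall>\<^sub>F n in sequentially. state_energy (U n) (g n) \<le> level + 1 / (real n + 1)"
      using less_imp_le[OF state_energy_less] by (intro always_eventually allI)
    show "(\<lambda>n. level + 1 / (real n + 1)) \<longlonglongrightarrow> level" by real_asymp
  qed simp
  have unif: "\<forall>\<^sub>F n in sequentially. \<forall>e\<in>edges G. \<forall>x\<in>{0..b e}. \<bar>U n e x - h e x\<bar> < \<delta>" if "0 < \<delta>" for \<delta>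
  proof (rule eventually_ball_finite[OF finite_edges(1)], rule ballI)
    fix e assume "e \<in> edges G"
    from bspec[OF h this, THEN conjunct2, rule_format, OF that]
    obtain N where "\<forall>n x. n \<ge> N \<and> x \<in> {0..b e} \<longrightarrow> \<bar>u0 (k n) e x - h e x\<bar> < \<delta>"
      by (elim exE) blast
    then show "\<forall>\<^sub>F n in sequentially. \<forall>x\<in>{0..b e}. \<bar>U n e x - h e x\<bar> < \<delta>"
      unfolding eventually_sequentially U_def by blast
  qed
  have b_core: "b e = edge_len e" if "e \<in> E_K" for e using that by (simp add: b_def)
  have h_core: "continuous_on {0..edge_len e} (h e)" if "e \<in> E_K" for e
    using h that E_K_subset b_core[OF that] by (metis subsetD)
  have U_core: "continuous_on {0..edge_len e} (U n e)" if "e \<in> E_K" for e n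
    using state_continuous[OF st, of e n] that E_K_subset core_edge(3)[OF that] by (metis subsetD)

  \<comment> \<open>The derivatives form a Cauchy sequence: by the parallelogram law a large difference would
    push the energy of the midpoint, whose mass is at most \<open>\<mu>\<close>, below the infimum.\<close>
  have cauchy: "\<exists>N. \<forall>m\<ge>N. \<forall>n\<ge>N. sq_norm (\<lambda>e x. g m e x - g n e x) < \<eta>" if \<eta>: "0 < \<eta>" for \<eta>
  proof -
    have "0 < p * \<eta> / 64" using \<eta> p by simp
    from pot_continuous[OF h_core this] obtain \<delta> where \<delta>: "0 < \<delta>"
      and pc: "\<And>v. \<forall>e\<in>E_K. continuous_on {0..edge_len e} (v e) \<and> (\<forall>x\<in>{0..edge_len e}. \<bar>v e x - h e x\<bar> < \<delta>) \<Longrightarrow>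
        \<bar>pot v - pot h\<bar> \<le> p * \<eta> / 64"
      by blast
    have "\<forall>\<^sub>F n in sequentially. state_energy (U n) (g n) < level + \<eta> / 32"
      using order_tendstoD(2)[OF state_energy_lim, of "level + \<eta> / 32"] \<eta> by simp
    from eventually_conj[OF this unif[OF \<delta>]] obtain N where
      N1: "\<And>n. N \<le> n \<Longrightarrow> state_energy (U n) (g n) < level + \<eta> / 32" and
      N2: "\<And>n e x. N \<le> n \<Longrightarrow> e \<in> edges G \<Longrightarrow> x \<in> {0..b e} \<Longrightarrow> \<bar>U n e x - h e x\<bar> < \<delta>"
      unfolding eventually_sequentially by blast
    have N3: "\<bar>U n e x - h e x\<bar> < \<delta>" if "N \<le> n" "e \<in> E_K" "x \<in> {0..edge_len e}" for n e x
      using N2[OF that(1), of e x] that(2,3) E_K_subset by (auto simp: b_core)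
    have "sq_norm (\<lambda>e x. g m e x - g n e x) < \<eta>" if mn: "N \<le> m" "N \<le> n" for m n
    proof -
      let ?w = "\<lambda>e x. 1 / 2 * U m e x + 1 / 2 * U n e x" and ?w' = "\<lambda>e x. 1 / 2 * g m e x + 1 / 2 * g n e x"
      have stw: "state ?w ?w'" by (rule state_lincomb[OF st st])
      have "sq_norm ?w \<le> \<mu>"
      proof -
        have "sq_norm ?w = sq_norm (U m) / 2 + sq_norm (U n) / 2 - sq_norm (\<lambda>e x. U m e x - U n e x) / 4"
          by (rule sq_norm_parallelogram[of "U m" "U n", OF L2U L2U])
        then show ?thesis
          using mass[of m] mass[of n] sq_norm_nonneg[of "\<lambda>e x. U m e x - U n e x"] by argo
      qed
      then have lw: "level \<le> state_energy ?w ?w'" by (rule level_le_subcritical_mass(1)[OF stw])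
      have pw: "\<bar>pot ?w - pot h\<bar> \<le> p * \<eta> / 64"
      proof (intro pc ballI conjI)
        fix e assume e: "e \<in> E_K"
        show "continuous_on {0..edge_len e} (?w e)"
          by (intro continuous_on_add continuous_on_mult continuous_on_const U_core e)
        fix x assume x: "x \<in> {0..edge_len e}"
        show "\<bar>?w e x - h e x\<bar> < \<delta>"
          using N3[OF mn(1) e x] N3[OF mn(2) e x] by linarith
      qed
      have pU: "\<bar>pot (U i) - pot h\<bar> \<le> p * \<eta> / 64" if "N \<le> i" for i
        by (intro pc ballI conjI U_core N3[OF that])
      have "pot (U m) / 2 + pot (U n) / 2 - pot ?w \<le> p * \<eta> / 32"
        using pw pU[OF mn(1)] pU[OF mn(2)] by linarith
      then have "(pot (U m) / 2 + pot (U n) / 2 - pot ?w) / p \<le> p * \<eta> / 32 / p"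
        using p by (intro divide_right_mono) auto
      then have P: "pot (U m) / p / 2 + pot (U n) / p / 2 - pot ?w / p \<le> \<eta> / 32"
        using p by (simp add: add_divide_distrib diff_divide_distrib)
      have S: "sq_norm ?w' = sq_norm (g m) / 2 + sq_norm (g n) / 2 - sq_norm (\<lambda>e x. g m e x - g n e x) / 4"
        by (rule sq_norm_parallelogram[of "g m" "g n", OF L2g L2g])
      have arith: "x < \<eta>" if "level \<le> (dm / 2 + dn / 2 - x / 4) / 2 - w" "am / 2 + an / 2 - w \<le> \<eta> / 32"
          "dm / 2 - am < level + \<eta> / 32" "dn / 2 - an < level + \<eta> / 32" for x dm dn w am an :: real
        using that \<eta> by argo
      show ?thesis
        by (rule arith[OF lw[unfolded state_energy_def S] P N1[OF mn(1), unfolded state_energy_def] N1[OF mn(2), unfolded state_energy_def]])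
    qed
    then show ?thesis by blast
  qed
  have "\<forall>e\<in>edges G. \<exists>F. Lq_on 2 (J e) F \<and> (\<lambda>n. LBINT x:J e. (g n e x - F x)\<^sup>2) \<longlonglongrightarrow> 0"
  proof
    fix e assume e: "e \<in> edges G"
    have c: "\<exists>N. \<forall>m\<ge>N. \<forall>n\<ge>N. (LBINT x:J e. (g m e x - g n e x)\<^sup>2) < \<eta>" if \<eta>: "0 < \<eta>" for \<eta>
    proof -
      obtain N where N: "\<forall>m\<ge>N. \<forall>n\<ge>N. sq_norm (\<lambda>e x. g m e x - g n e x) < \<eta>"
        using cauchy[OF \<eta>] by (elim exE)
      have "(LBINT x:J e. (g m e x - g n e x)\<^sup>2) < \<eta>" if "N \<le> m" "N \<le> n" for m n
        using edge_le_sq_norm[OF e, of "\<lambda>e x. g m e x - g n e x"] N that by (meson le_less_trans)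
      then show ?thesis by blast
    qed
    show "\<exists>F. Lq_on 2 (J e) F \<and> (\<lambda>n. LBINT x:J e. (g n e x - F x)\<^sup>2) \<longlonglongrightarrow> 0"
      by (rule L2_complete[OF ray_or_segmentD(2,3)[OF J_ray_or_segment[OF e]] L2g[OF e] c]) blast+
  qed
  then obtain F where F: "\<forall>e\<in>edges G. Lq_on 2 (J e) (F e) \<and> (\<lambda>n. LBINT x:J e. (g n e x - F e x)\<^sup>2) \<longlonglongrightarrow> 0"
    unfolding bchoice_iff by (elim exE)
  then have L2F: "Lq_on 2 (J e) (F e)" and limF: "(\<lambda>n. LBINT x:J e. (g n e x - F e x)\<^sup>2) \<longlonglongrightarrow> 0"
    if "e \<in> edges G" for e
    using that by auto
  define u where "u e x = h e 0 + (LBINT t:{0..x}. F e t)" for e x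
  have ACu: "AC_on (J e) (u e) (F e)" if e: "e \<in> edges G" for e
  proof (rule AC_on_from_0, intro conjI)
    note I = J_ray_or_segment[OF e]
    fix x assume x: "x \<in> J e"
    show "0 \<le> x" using ray_or_segmentD(3)[OF I] x by auto
    show "set_integrable lborel {0..x} (F e)"
      by (intro L2_integrable L2_mono[OF L2F[OF e] ray_or_segment_prefix[OF I x]]) simp
    show "u e x = u e 0 + (LBINT t:{0..x}. F e t)" by (simp only: u_def set_integral_singleton add_0_right)
  qed
  have U_h: "(\<lambda>n. U n e x) \<longlonglongrightarrow> h e x" if "e \<in> edges G" "x \<in> {0..b e}" for e x
  proof (rule tendstoI)
    fix \<epsilon> :: real assume "0 < \<epsilon>"
    from unif[OF this] show "\<forall>\<^sub>F n in sequentially. dist (U n e x) (h e x) < \<epsilon>"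
      by eventually_elim (use that in \<open>simp add: dist_real_def\<close>)
  qed
  have U_u: "(\<lambda>n. U n e x) \<longlonglongrightarrow> u e x" if e: "e \<in> edges G" and x: "x \<in> J e" for e x
  proof -
    note I = J_ray_or_segment[OF e]
    have x0: "0 \<le> x" "0 \<in> J e" using ray_or_segmentD(3,4)[OF I] x by auto
    have s: "{0..x} \<subseteq> J e" by (rule ray_or_segment_prefix[OF I x])
    have b0: "0 \<in> {0..b e}" using b(1)[OF e] by simp
    have bound: "\<bar>U n e x - u e x - (U n e 0 - h e 0)\<bar> \<le> sqrt (x - 0) * sqrt (LBINT t:J e. (g n e t - F e t)\<^sup>2)" for n
    proof -
      have ACU: "AC_on (J e) (U n e) (g n e)" using state_pair[OF st e] by (simp add: H1_pair_def)
      have "U n e x - u e x - (U n e 0 - h e 0) = (LBINT t:{0..x}. g n e t - F e t)"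
        using AC_onD[OF ACU x0(2) x x0(1)] AC_onD(1)[OF ACu[OF e] x0(2) x x0(1)]
        by (subst set_integral_diff(2)) (simp_all add: u_def)
      then show ?thesis
        using L2_integral_abs_le_mono[OF L2_diff[OF L2g[OF e] L2F[OF e]] s x0(1), of n] by simp
    qed
    have "(\<lambda>n. sqrt (x - 0) * sqrt (LBINT t:J e. (g n e t - F e t)\<^sup>2)) \<longlonglongrightarrow> sqrt (x - 0) * sqrt 0"
      by (intro tendsto_mult tendsto_const tendsto_real_sqrt limF e)
    then have "(\<lambda>n. sqrt (x - 0) * sqrt (LBINT t:J e. (g n e t - F e t)\<^sup>2)) \<longlonglongrightarrow> 0" by simp
    then have "(\<lambda>n. U n e x - u e x - (U n e 0 - h e 0)) \<longlonglongrightarrow> 0"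
      by (rule Lim_null_comparison[rotated]) (intro always_eventually allI, unfold real_norm_def, rule bound)
    from tendsto_add[OF this tendsto_diff[OF U_h[OF e b0] tendsto_const[of "h e 0"]]]
    have "(\<lambda>n. U n e x - u e x) \<longlonglongrightarrow> 0" by simp
    then show ?thesis by (rule LIM_zero_cancel)
  qed
  have h_u: "h e x = u e x" if "e \<in> E_K" "x \<in> J e" for e x
  proof (rule LIMSEQ_unique)
    have e: "e \<in> edges G" using that(1) E_K_subset by auto
    show "(\<lambda>n. U n e x) \<longlonglongrightarrow> h e x"
      by (rule U_h[OF e]) (use that in \<open>simp only: b_core core_edge(3)\<close>)
    show "(\<lambda>n. U n e x) \<longlonglongrightarrow> u e x" by (rule U_u[OF e that(2)])
  qed
  have pot_hu: "pot h = pot u"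
    unfolding pot_def
    by (intro sum.cong refl set_lebesgue_integral_cong allI impI) (simp_all add: core_edge(3) h_u)
  have fatou: "Lq_on 2 (J e) (u e)" "sq_norm u \<le> \<mu>" if "e \<in> edges G" for e
  proof -
    have m: "set_borel_measurable lborel (J e) (u e)" if e: "e \<in> edges G" for e
      unfolding set_borel_measurable_def measurable_lborel2
      by (intro borel_measurable_continuous_on_indicator ray_or_segmentD(2) J_ray_or_segment e
          AC_L2_continuous[OF ray_or_segmentD(1)[OF J_ray_or_segment[OF e]] ACu[OF e] L2F[OF e]])
    have ae: "AE x in lborel. x \<in> J e \<longrightarrow> (\<lambda>n. U n e x) \<longlonglongrightarrow> u e x" if "e \<in> edges G" for e
      using U_u[OF that] by (intro AE_I2 impI)
    have B: "(\<Sum>e\<in>edges G. LBINT x:J e. (U n e x)\<^sup>2) \<le> \<mu>" for n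
      using mass[of n] by (simp only: sq_norm_def order_refl)
    show "Lq_on 2 (J e) (u e)"
      by (rule L2_fatou_sum(1)[where E = "edges G" and I = J and h = U and f = u and B = \<mu>,
            OF finite_edges(1) L2U m ae B that])
    show "sq_norm u \<le> \<mu>"
      unfolding sq_norm_def
      by (rule L2_fatou_sum(2)[where E = "edges G" and I = J and h = U and f = u and B = \<mu>,
            OF finite_edges(1) L2U m ae B])
  qed
  have "glued u"
  proof -
    have "\<forall>n. \<exists>w. \<forall>e\<in>edges G. U n e 0 = w (tail (skeleton G) e) \<and>
        (len G e < \<infinity> \<longrightarrow> U n e (edge_len e) = w (head (skeleton G) e))"
      using st unfolding state_def glued_def by blast
    then obtain w where w: "\<forall>n. \<forall>e\<in>edges G. U n e 0 = w n (tail (skeleton G) e) \<and>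
        (len G e < \<infinity> \<longrightarrow> U n e (edge_len e) = w n (head (skeleton G) e))"
      unfolding choice_iff by (elim exE)
    show ?thesis
      unfolding glued_def
    proof (intro exI[of _ "\<lambda>v. lim (\<lambda>n. w n v)"] ballI conjI impI)
      fix e assume e: "e \<in> edges G"
      have "(\<lambda>n. U n e 0) \<longlonglongrightarrow> u e 0"
        by (rule U_u[OF e ray_or_segmentD(4)[OF J_ray_or_segment[OF e]]])
      moreover have "(\<lambda>n. U n e 0) = (\<lambda>n. w n (tail (skeleton G) e))" using w e by auto
      ultimately show "u e 0 = lim (\<lambda>n. w n (tail (skeleton G) e))" by (simp add: limI)
      assume fin: "len G e < \<infinity>"
      have "e \<in> E_K" using e by (rule edge_cases) (use fin in \<open>auto simp: len_G\<close>)
      then have "edge_len e \<in> J e" using core_edge(1,3)[of e] by simp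
      then have "(\<lambda>n. U n e (edge_len e)) \<longlonglongrightarrow> u e (edge_len e)" by (rule U_u[OF e])
      moreover have "(\<lambda>n. U n e (edge_len e)) = (\<lambda>n. w n (head (skeleton G) e))" using w e fin by auto
      ultimately show "u e (edge_len e) = lim (\<lambda>n. w n (head (skeleton G) e))" by (simp add: limI)
    qed
  qed
  then have stu: "state u F"
    unfolding state_def H1_pair_def by (intro conjI ballI ACu fatou(1) L2F)
  have "(\<lambda>n. sq_norm (g n)) \<longlonglongrightarrow> sq_norm F"
    unfolding sq_norm_def by (intro tendsto_sum L2_norm_tendsto L2g L2F limF)
  moreover have "(\<lambda>n. pot (U n)) \<longlonglongrightarrow> pot u"
  proof (rule tendstoI)
    fix \<epsilon> :: real assume "0 < \<epsilon>"
    then have "0 < \<epsilon> / 2" by simp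
    from pot_continuous[OF h_core this] obtain \<delta> where \<delta>: "0 < \<delta>"
      and pc: "\<And>v. \<forall>e\<in>E_K. continuous_on {0..edge_len e} (v e) \<and> (\<forall>x\<in>{0..edge_len e}. \<bar>v e x - h e x\<bar> < \<delta>) \<Longrightarrow>
        \<bar>pot v - pot h\<bar> \<le> \<epsilon> / 2"
      by blast
    from unif[OF \<delta>] show "\<forall>\<^sub>F n in sequentially. dist (pot (U n)) (pot u) < \<epsilon>"
    proof eventually_elim
      case (elim n)
      have "\<bar>pot (U n) - pot h\<bar> \<le> \<epsilon> / 2"
      proof (intro pc ballI conjI U_core)
        fix e x assume "e \<in> E_K" "x \<in> {0..edge_len e}"
        then show "\<bar>U n e x - h e x\<bar> < \<delta>" using elim E_K_subset b_core[of e] by auto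
      qed
      with \<open>0 < \<epsilon>\<close> show ?case by (simp add: dist_real_def pot_hu)
    qed
  qed
  ultimately have "(\<lambda>n. state_energy (U n) (g n)) \<longlonglongrightarrow> state_energy u F"
    unfolding state_energy_def using p by (intro tendsto_diff tendsto_divide tendsto_const) auto
  then have state_energy_u: "state_energy u F = level" using state_energy_lim by (rule LIMSEQ_unique)
  obtain e0 where "e0 \<in> edges G" using E_K_nonempty E_K_subset by auto
  then have le: "sq_norm u \<le> \<mu>" by (rule fatou(2))
  have "\<not> sq_norm u < \<mu>"
  proof
    assume "sq_norm u < \<mu>"
    from level_le_subcritical_mass(2)[OF stu le this] state_energy_u show False by simp
  qed
  with le have "sq_norm u = \<mu>" by argo
  with stu state_energy_u show ?thesis by blast
qed

end

section \<open>The ground state energy is not positive\<close>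

text \<open>The integrand is the derivative of \<open>- (a x\<^sup>2 + b x + c) exp (- 2 \<epsilon> x)\<close>.\<close>

lemma ray_quadratic_exp_integral:
  fixes \<epsilon> a b c :: real
  assumes \<epsilon>: "0 < \<epsilon>"
  defines "f \<equiv> \<lambda>x. (2 * \<epsilon> * a * x\<^sup>2 + (2 * \<epsilon> * b - 2 * a) * x + (2 * \<epsilon> * c - b)) * exp (2 * - (\<epsilon> * x))"
  assumes nonneg: "\<And>x. 0 \<le> x \<Longrightarrow> 0 \<le> f x"
  shows "set_integrable lborel {0..} f" and "(LBINT x:{0..}. f x) = c"
proof -
  define F where "F x = - ((a * x\<^sup>2 + b * x + c) * exp (2 * - (\<epsilon> * x)))" for x
  have d: "DERIV F x :> f x" for x
  proof -
    have P: "DERIV (\<lambda>x. a * x\<^sup>2 + b * x + c) x :> 2 * a * x + b"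
      by (auto intro!: derivative_eq_intros)
    have E: "DERIV (\<lambda>x. exp (2 * - (\<epsilon> * x))) x :> exp (2 * - (\<epsilon> * x)) * (2 * - \<epsilon>)"
      by (auto intro!: derivative_eq_intros)
    have "DERIV F x :> - ((2 * a * x + b) * exp (2 * - (\<epsilon> * x)) + exp (2 * - (\<epsilon> * x)) * (2 * - \<epsilon>) * (a * x\<^sup>2 + b * x + c))"
      unfolding F_def[abs_def] by (intro DERIV_minus DERIV_mult P E)
    also have "- ((2 * a * x + b) * e + e * (2 * - \<epsilon>) * (a * x\<^sup>2 + b * x + c)) =
        (2 * \<epsilon> * a * x\<^sup>2 + (2 * \<epsilon> * b - 2 * a) * x + (2 * \<epsilon> * c - b)) * e" for e
      by (simp add: algebra_simps)
    finally show ?thesis unfolding f_def .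
  qed
  have c: "continuous_on UNIV f" unfolding f_def by (intro continuous_intros)
  have l2: "((\<lambda>x. x\<^sup>2 * exp (2 * - (\<epsilon> * x))) \<longlongrightarrow> 0) at_top" using \<epsilon> by real_asymp
  have l1: "((\<lambda>x. x * exp (2 * - (\<epsilon> * x))) \<longlongrightarrow> 0) at_top" using \<epsilon> by real_asymp
  have l0: "((\<lambda>x. exp (2 * - (\<epsilon> * x))) \<longlongrightarrow> 0) at_top" using \<epsilon> by real_asymp
  have "((\<lambda>x. - (a * (x\<^sup>2 * exp (2 * - (\<epsilon> * x))) + b * (x * exp (2 * - (\<epsilon> * x))) + c * exp (2 * - (\<epsilon> * x))))
      \<longlongrightarrow> - (a * 0 + b * 0 + c * 0)) at_top"
    by (intro tendsto_intros l2 l1 l0)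
  moreover have "- (a * (x\<^sup>2 * e) + b * (x * e) + c * e) = - ((a * x\<^sup>2 + b * x + c) * e)" for x e :: real
    by (simp add: algebra_simps)
  ultimately have lim: "(F \<longlongrightarrow> 0) at_top" by (simp add: F_def[abs_def])
  show "set_integrable lborel {0..} f" "(LBINT x:{0..}. f x) = c"
    using half_line_integral_FTC[OF c d nonneg lim] by (simp_all add: F_def)
qed

text \<open>The profile is a multiple of \<open>x exp (- \<epsilon> x)\<close>.\<close>

lemma ray_profile:
  assumes \<epsilon>: "0 < \<epsilon>" and m: "0 < m"
  shows "\<exists>f f'. H1_pair {0..} f f' \<and> f 0 = 0 \<and> (LBINT x:{0..}. (f x)\<^sup>2) = m \<and> (LBINT x:{0..}. (f' x)\<^sup>2) = \<epsilon>\<^sup>2 * m"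
proof -
  define q where "q x = x * exp (- (\<epsilon> * x))" for x
  define q' where "q' x = (1 - \<epsilon> * x) * exp (- (\<epsilon> * x))" for x
  have q2: "(q x)\<^sup>2 = (2 * \<epsilon> * (1 / (2 * \<epsilon>)) * x\<^sup>2 + (2 * \<epsilon> * (1 / (2 * \<epsilon>\<^sup>2)) - 2 * (1 / (2 * \<epsilon>))) * x +
      (2 * \<epsilon> * (1 / (4 * \<epsilon> ^ 3)) - 1 / (2 * \<epsilon>\<^sup>2))) * exp (2 * - (\<epsilon> * x))" for x
  proof -
    have "2 * \<epsilon> * (1 / (2 * \<epsilon>)) = 1" "2 * \<epsilon> * (1 / (2 * \<epsilon>\<^sup>2)) - 2 * (1 / (2 * \<epsilon>)) = 0"
      "2 * \<epsilon> * (1 / (4 * \<epsilon> ^ 3)) - 1 / (2 * \<epsilon>\<^sup>2) = 0"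
      using \<epsilon> by (simp_all add: power2_eq_square power3_eq_cube)
    then show ?thesis unfolding q_def power_mult_distrib exp_double by simp
  qed
  have q'2: "(q' x)\<^sup>2 = (2 * \<epsilon> * (\<epsilon> / 2) * x\<^sup>2 + (2 * \<epsilon> * (- 1 / 2) - 2 * (\<epsilon> / 2)) * x +
      (2 * \<epsilon> * (1 / (4 * \<epsilon>)) - - 1 / 2)) * exp (2 * - (\<epsilon> * x))" for x
  proof -
    have "2 * \<epsilon> * (1 / (4 * \<epsilon>)) - - 1 / 2 = 1" using \<epsilon> by simp
    then show ?thesis
      unfolding q'_def power_mult_distrib exp_double by (simp add: power2_eq_square algebra_simps)
  qed
  note iq = ray_quadratic_exp_integral[OF \<epsilon>, of "1 / (2 * \<epsilon>)" "1 / (2 * \<epsilon>\<^sup>2)" "1 / (4 * \<epsilon> ^ 3)",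
      folded q2, OF zero_le_power2]
  note iq' = ray_quadratic_exp_integral[OF \<epsilon>, of "\<epsilon> / 2" "- 1 / 2" "1 / (4 * \<epsilon>)",
      folded q'2, OF zero_le_power2]
  have int_q: "set_integrable lborel {0..} (\<lambda>x. (q x)\<^sup>2)" "(LBINT x:{0..}. (q x)\<^sup>2) = 1 / (4 * \<epsilon> ^ 3)"
    by (rule iq)+
  have int_q': "set_integrable lborel {0..} (\<lambda>x. (q' x)\<^sup>2)" "(LBINT x:{0..}. (q' x)\<^sup>2) = 1 / (4 * \<epsilon>)"
    by (rule iq')+
  have cq': "continuous_on UNIV q'" unfolding q'_def[abs_def] by (intro continuous_intros)
  have cq: "continuous_on UNIV q" unfolding q_def[abs_def] by (intro continuous_intros)
  have d: "(q has_real_derivative q' x) (at x)" for x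
    unfolding q_def[abs_def] q'_def by (auto intro!: derivative_eq_intros simp: algebra_simps)
  have meas: "set_borel_measurable lborel {0..} k" if "continuous_on UNIV k" for k :: "real \<Rightarrow> real"
    using borel_measurable_continuous_on_indicator[of "{0..}" k] continuous_on_subset[OF that]
    by (simp add: set_borel_measurable_def)
  have H: "H1_pair {0..} q q'"
    unfolding H1_pair_def Lq_on_2_iff
    by (intro conjI AC_of_continuous_deriv d cq' meas cq int_q(1) int_q'(1))
  define A where "A = sqrt (4 * \<epsilon> ^ 3 * m)"
  have A: "A\<^sup>2 = 4 * \<epsilon> ^ 3 * m" using \<epsilon> m by (simp add: A_def)
  show ?thesis
  proof (rule exI[of _ "\<lambda>x. A * q x"], rule exI[of _ "\<lambda>x. A * q' x"], intro conjI)
    show "H1_pair {0..} (\<lambda>x. A * q x) (\<lambda>x. A * q' x)" by (rule H1_pair_cmult[OF H])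
    show "A * q 0 = 0" by (simp add: q_def)
    have "(LBINT x:{0..}. (A * q x)\<^sup>2) = A\<^sup>2 * (1 / (4 * \<epsilon> ^ 3))"
      by (simp only: power_mult_distrib set_integral_mult_right int_q(2))
    then show "(LBINT x:{0..}. (A * q x)\<^sup>2) = m" using \<epsilon> by (simp add: A)
    have "(LBINT x:{0..}. (A * q' x)\<^sup>2) = A\<^sup>2 * (1 / (4 * \<epsilon>))"
      by (simp only: power_mult_distrib set_integral_mult_right int_q'(2))
    also have "\<dots> = \<epsilon>\<^sup>2 * m"
      unfolding A using \<epsilon> by (simp add: power2_eq_square power3_eq_cube)
    finally show "(LBINT x:{0..}. (A * q' x)\<^sup>2) = \<epsilon>\<^sup>2 * m" .
  qed
qed

lemma H1_pair_zero: "H1_pair I (\<lambda>x. 0) (\<lambda>x. 0)"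
  by (simp add: H1_pair_def AC_on_def Lq_on_2_iff set_borel_measurable_def set_integrable_def)

context core_graph
begin

text \<open>Slowly decaying functions supported on one half-line do not feel the nonlinearity.\<close>

lemma ground_energy_nonpos: "ground_energy G E_K p \<mu> \<le> 0"
proof (rule ccontr)
  assume "\<not> ground_energy G E_K p \<mu> \<le> 0"
  then obtain c where c: "0 < ereal c" "ereal c < ground_energy G E_K p \<mu>"
    using ereal_dense2[of 0 "ground_energy G E_K p \<mu>"] by (auto simp: not_le)
  \<comment> \<open>With this scale the kinetic term \<open>\<epsilon>\<^sup>2 * \<mu> / 2\<close> is \<open>c / 2\<close>.\<close>
  define \<epsilon> where "\<epsilon> = sqrt (c / \<mu>)"
  have \<epsilon>: "0 < \<epsilon>" "\<epsilon>\<^sup>2 * \<mu> = c" using c(1) \<mu> by (auto simp: \<epsilon>_def)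
  obtain f f' where f: "H1_pair {0..} f f'" "f 0 = 0" "(LBINT x:{0..}. (f x)\<^sup>2) = \<mu>"
      "(LBINT x:{0..}. (f' x)\<^sup>2) = \<epsilon>\<^sup>2 * \<mu>"
    using ray_profile[OF \<epsilon>(1) \<mu>] by (elim exE conjE)
  define e0 :: "'e + nat" where "e0 = Inr 0"
  have e0: "e0 \<in> edges G" "e0 \<notin> E_K" "J e0 = {0..}" using N by (auto simp: e0_def edges_G E_K ray_edge)
  define u where "u e = (if e = e0 then f else (\<lambda>x. 0))" for e
  define g where "g e = (if e = e0 then f' else (\<lambda>x. 0))" for e
  have st: "state u g"
    unfolding state_def
  proof (intro conjI ballI)
    show "H1_pair (J e) (u e) (g e)" for e
      using f(1) H1_pair_zero by (simp add: u_def g_def e0(3))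
    show "glued u"
      unfolding glued_def
    proof (intro exI[of _ "\<lambda>_. 0"] ballI conjI impI)
      fix e
      show "u e 0 = 0" using f(2) by (simp add: u_def)
      show "u e (edge_len e) = 0" if "len G e < \<infinity>"
        using that by (auto simp: u_def e0_def len_G)
    qed
  qed
  have "(\<Sum>e\<in>edges G. LBINT x:J e. (u e x)\<^sup>2) = (\<Sum>e\<in>edges G. if e = e0 then \<mu> else 0)"
    using f(3) by (intro sum.cong refl) (simp add: u_def e0(3))
  then have mass: "sq_norm u = \<mu>" using e0(1) finite_edges(1) by (simp add: sq_norm_def)
  have "(\<Sum>e\<in>edges G. LBINT x:J e. (g e x)\<^sup>2) = (\<Sum>e\<in>edges G. if e = e0 then c else 0)"
    using f(4) \<epsilon>(2) by (intro sum.cong refl) (simp add: g_def e0(3))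
  then have "sq_norm g = c" using e0(1) finite_edges(1) by (simp add: sq_norm_def)
  moreover have "0 \<le> pot u / p" using pot_nonneg[of u] p by simp
  ultimately have "state_energy u g < c" using c(1) by (simp add: state_energy_def)
  then have "ereal (state_energy u g) < ereal c" by simp
  also note c(2)
  also have "ground_energy G E_K p \<mu> \<le> ereal (state_energy u g)" by (rule ground_energy_le[OF st mass])
  finally show False by simp
qed

end

section \<open>Minimizers have no zeros\<close>

lemma powr_ge_tangent:
  fixes r y :: real
  assumes "1 \<le> r" "y \<le> 0"
  shows "1 + y * (r - 1) \<le> r powr y"
proof -
  have "y * (r - 1) \<le> y * ln r"
    using assms by (intro mult_left_mono_neg ln_le_minus_one) auto
  also have "1 + y * ln r \<le> exp (y * ln r)" by (rule exp_ge_add_one_self)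
  finally show ?thesis using assms by (simp add: powr_def)
qed

context negative_level
begin

text \<open>The competitors \<open>sqrt (u\<^sup>2 + t \<eta>\<^sup>2)\<close>, rescaled to mass \<open>\<mu>\<close>. Here \<open>\<eta>\<close> is \<open>1\<close> on the core and
  \<open>exp (- x)\<close> on the half-lines. The potential energy only increases and mass and kinetic energy
  are explicit, so that minimality bounds the defects uniformly in \<open>t\<close>.\<close>

lemma minimizer_zero_spreads:
  assumes u: "state u g" "sq_norm u = \<mu>" "state_energy u g = level"
    and e: "e \<in> edges G" and ab: "a \<in> J e" "b \<in> J e" and zero: "u e a = 0"
  shows "u e b = 0"
proof -
  define \<kappa> :: "'e + nat \<Rightarrow> real" where "\<kappa> e = (if e \<in> E_K then 0 else 1)" for e
  have L\<eta>: "Lq_on 2 (J e) (\<lambda>x. exp (- (\<kappa> e * x)))" if "e \<in> edges G" for e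
    using that
  proof (cases rule: edge_cases)
    case 1
    then show ?thesis using L2_const[of 0 "edge_len e" 1] by (simp add: \<kappa>_def core_edge(3))
  next
    case (2 i)
    then have "\<kappa> e = 1" "J e = {0..}" by (auto simp: \<kappa>_def E_K ray_edge)
    then show ?thesis using exp_decay_L2(1) by simp
  qed
  define A where "A = (\<Sum>e\<in>edges G. (\<kappa> e)\<^sup>2 * (LBINT x:J e. (exp (- (\<kappa> e * x)))\<^sup>2))"
  define B where "B = (\<Sum>e\<in>edges G. LBINT x:J e. (exp (- (\<kappa> e * x)))\<^sup>2)"
  have B0: "0 \<le> B" unfolding B_def by (intro sum_nonneg L2_integral_nonneg)
  define q where "q = p / 2 - 1"
  define C where "C = A + 2 * (B / \<mu>) * (q * (pot u / p) - level)"
  have total: "(\<Sum>e\<in>edges G. LBINT x:J e. (defect (\<kappa> e) t (u e) (g e) x)\<^sup>2) \<le> C" if t: "0 < t" for t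
  proof -
    define v where "v e x = sqrt ((u e x)\<^sup>2 + t * (exp (- (\<kappa> e * x)))\<^sup>2)" for e x
    note comp = competitor_H1_pair[OF J_ray_or_segment state_pair[OF u(1)] t L\<eta>]
    have "\<forall>e\<in>edges G. \<exists>v'. H1_pair (J e) (v e) v' \<and> (LBINT x:J e. (v' x)\<^sup>2) =
      (LBINT x:J e. (g e x)\<^sup>2) + t * (\<kappa> e)\<^sup>2 * (LBINT x:J e. (exp (- (\<kappa> e * x)))\<^sup>2)
        - t * (LBINT x:J e. (defect (\<kappa> e) t (u e) (g e) x)\<^sup>2)"
      unfolding v_def[abs_def] by (intro ballI comp(1))
    then obtain v' where v': "\<forall>e\<in>edges G. H1_pair (J e) (v e) (v' e) \<and> (LBINT x:J e. (v' e x)\<^sup>2) =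
      (LBINT x:J e. (g e x)\<^sup>2) + t * (\<kappa> e)\<^sup>2 * (LBINT x:J e. (exp (- (\<kappa> e * x)))\<^sup>2)
        - t * (LBINT x:J e. (defect (\<kappa> e) t (u e) (g e) x)\<^sup>2)"
      unfolding bchoice_iff by (elim exE)
    define R where "R = (\<Sum>e\<in>edges G. LBINT x:J e. (defect (\<kappa> e) t (u e) (g e) x)\<^sup>2)"
    have kin: "sq_norm v' = sq_norm g + t * A - t * R"
    proof -
      have "sq_norm v' = (\<Sum>e\<in>edges G. (LBINT x:J e. (g e x)\<^sup>2) + t * ((\<kappa> e)\<^sup>2 * (LBINT x:J e. (exp (- (\<kappa> e * x)))\<^sup>2))
        - t * (LBINT x:J e. (defect (\<kappa> e) t (u e) (g e) x)\<^sup>2))"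
        unfolding sq_norm_def
      proof (rule sum.cong[OF refl])
        fix e assume "e \<in> edges G"
        from bspec[OF v' this, THEN conjunct2]
        show "(LBINT x:J e. (v' e x)\<^sup>2) = (LBINT x:J e. (g e x)\<^sup>2)
          + t * ((\<kappa> e)\<^sup>2 * (LBINT x:J e. (exp (- (\<kappa> e * x)))\<^sup>2))
          - t * (LBINT x:J e. (defect (\<kappa> e) t (u e) (g e) x)\<^sup>2)" by (simp only: mult.assoc)
      qed
      then show ?thesis
        by (simp only: sum.distrib sum_subtractf sum_distrib_left[symmetric] sq_norm_def A_def R_def)
    qed
    have mass: "sq_norm v = \<mu> + t * B"
    proof -
      have "sq_norm v = (\<Sum>e\<in>edges G. (LBINT x:J e. (u e x)\<^sup>2) + t * (LBINT x:J e. (exp (- (\<kappa> e * x)))\<^sup>2))"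
        unfolding sq_norm_def v_def[abs_def] by (intro sum.cong refl comp(2))
      then show ?thesis
        using u(2) by (simp only: sum.distrib sum_distrib_left[symmetric] sq_norm_def B_def)
    qed
    have "glued v"
    proof -
      obtain w where w: "\<forall>e\<in>edges G. u e 0 = w (tail (skeleton G) e) \<and>
         (len G e < \<infinity> \<longrightarrow> u e (edge_len e) = w (head (skeleton G) e))"
        using u(1) unfolding state_def glued_def by (elim exE conjE)
      show ?thesis
        unfolding glued_def
      proof (intro exI[of _ "\<lambda>y. sqrt ((w y)\<^sup>2 + t)"] ballI conjI impI)
        fix e assume e: "e \<in> edges G"
        show "v e 0 = sqrt ((w (tail (skeleton G) e))\<^sup>2 + t)" using w e by (simp add: v_def)
        assume fin: "len G e < \<infinity>"
        have "e \<in> E_K" using e by (rule edge_cases) (use fin in \<open>auto simp: len_G\<close>)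
        then show "v e (edge_len e) = sqrt ((w (head (skeleton G) e))\<^sup>2 + t)"
          using w e fin by (simp add: v_def \<kappa>_def)
      qed
    qed
    then have stv: "state v v'" unfolding state_def using v' by blast
    have pot: "pot u \<le> pot v"
      unfolding pot_def
    proof (intro sum_mono set_integral_mono)
      fix e assume e: "e \<in> E_K"
      then have eG: "e \<in> edges G" using E_K_subset by auto
      show "set_integrable lborel (J e) (\<lambda>x. \<bar>u e x\<bar> powr p)" "set_integrable lborel (J e) (\<lambda>x. \<bar>v e x\<bar> powr p)"
        unfolding core_edge(3)[OF e]
        using state_continuous[OF u(1) eG] state_continuous[OF stv eG] p
        by (auto intro!: abs_powr_integrable simp: core_edge(3)[OF e])
      fix x
      have "\<bar>u e x\<bar> = sqrt ((u e x)\<^sup>2)" by simp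
      also have "\<dots> \<le> v e x" unfolding v_def using t by (intro real_sqrt_le_mono) simp
      finally show "\<bar>u e x\<bar> powr p \<le> \<bar>v e x\<bar> powr p" using p by (intro powr_mono2) auto
    qed
    \<comment> \<open>The factor by which the mass has grown; minimality is tested after scaling it away.\<close>
    define r where "r = 1 + t * (B / \<mu>)"
    have r: "1 \<le> r" using t B0 \<mu> by (simp add: r_def)
    have mr: "sq_norm v = \<mu> * r" unfolding mass r_def using \<mu> by (simp add: distrib_left)
    have m0: "0 < sq_norm v" unfolding mr using \<mu> r by simp
    have inv: "\<mu> / sq_norm v = 1 / r" unfolding mr using \<mu> by simp
    have "level \<le> (1 / r) * sq_norm v' / 2 - (1 / r) powr (p / 2) * pot v / p"
      using level_le_rescaled[OF stv m0 refl] unfolding inv .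
    then have "r * level \<le> r * ((1 / r) * sq_norm v' / 2 - (1 / r) powr (p / 2) * pot v / p)"
      using r by (intro mult_left_mono) auto
    also have "\<dots> = sq_norm v' / 2 - (r * (1 / r) powr (p / 2)) * (pot v / p)"
      using r by (simp add: right_diff_distrib)
    also have "r * (1 / r) powr (p / 2) = r powr (- q)"
    proof -
      have "r powr 1 = r" using r by simp
      moreover have "(1 / r) powr (p / 2) = r powr (- (p / 2))"
        using r by (simp add: powr_divide powr_minus_divide)
      ultimately have "r * (1 / r) powr (p / 2) = r powr 1 * r powr (- (p / 2))" by (simp only:)
      also have "\<dots> = r powr (1 + - (p / 2))" by (rule powr_add[symmetric])
      finally show ?thesis by (simp add: q_def)
    qed
    also have "sq_norm v' / 2 - r powr (- q) * (pot v / p) \<le> sq_norm v' / 2 - (1 + - q * (r - 1)) * (pot u / p)"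
    proof -
      have "(1 + - q * (r - 1)) * (pot u / p) \<le> r powr (- q) * (pot u / p)"
        using powr_ge_tangent[OF r, of "- q"] pot_nonneg[of u] p
        by (intro mult_right_mono) (auto simp: q_def)
      also have "\<dots> \<le> r powr (- q) * (pot v / p)"
        using pot p by (intro mult_left_mono divide_right_mono) auto
      finally show ?thesis by simp
    qed
    finally have main: "r * level \<le> (sq_norm g + t * A - t * R) / 2 - (1 + - q * (r - 1)) * (pot u / p)"
      unfolding kin .
    have kin_u: "sq_norm g / 2 = level + pot u / p" using u(3) by (simp add: state_energy_def)
    have "t * R \<le> t * (A + 2 * (B / \<mu>) * (q * (pot u / p) - level))"
    proof -
      have "t * R' \<le> t * (A' + 2 * \<beta> * (q' * P - l))"
        if "(1 + t * \<beta>) * l \<le> (D + t * A' - t * R') / 2 - (1 + - q' * (1 + t * \<beta> - 1)) * P" "D / 2 = l + P"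
        for R' A' \<beta> q' P l D :: real
      proof -
        have "D = 2 * l + 2 * P" using that(2) by simp
        then show ?thesis using that(1) by (simp add: field_simps)
      qed
      then show ?thesis using main[unfolded r_def] kin_u .
    qed
    then have "R \<le> C" using t by (simp add: C_def)
    then show ?thesis by (simp only: R_def)
  qed
  show ?thesis
  proof (rule zero_spreads[OF J_ray_or_segment[OF e] state_pair[OF u(1) e] _ _ _ ab zero])
    show "0 \<le> \<kappa> e" by (simp add: \<kappa>_def)
    fix t :: real assume t: "0 < t"
    show "Lq_on 2 (J e) (defect (\<kappa> e) t (u e) (g e))"
      by (rule competitor_H1_pair(3)[OF J_ray_or_segment[OF e] state_pair[OF u(1) e] t L\<eta>[OF e]])
    have "(LBINT x:J e. (defect (\<kappa> e) t (u e) (g e) x)\<^sup>2)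
        \<le> (\<Sum>e\<in>edges G. LBINT x:J e. (defect (\<kappa> e) t (u e) (g e) x)\<^sup>2)"
      by (rule member_le_sum[OF e]) (simp_all add: finite_edges L2_integral_nonneg)
    also have "\<dots> \<le> C" by (rule total[OF t])
    finally show "(LBINT x:J e. (defect (\<kappa> e) t (u e) (g e) x)\<^sup>2) \<le> C" .
  qed
qed

end

subsection \<open>Propagation along the graph\<close>

lemma connected_invariant:
  fixes H :: "('v, 'e) pre_digraph"
  assumes H: "Digraph_Component.connected H"
    and inv: "\<And>e. e \<in> arcs H \<Longrightarrow> Q (tail H e) \<longleftrightarrow> Q (head H e)"
    and xy: "x \<in> verts H" "y \<in> verts H"
  shows "Q x \<longleftrightarrow> Q y"
proof -
  have "(x, y) \<in> rtrancl_on (verts H) ((arcs_ends H)\<^sup>s)"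
    using H xy unfolding connected_conv by blast
  then show ?thesis
  proof (induction rule: rtrancl_on_induct)
    case (step y z)
    then obtain e where "e \<in> arcs H" "(y, z) = (tail H e, head H e) \<or> (z, y) = (tail H e, head H e)"
      by (auto simp: symcl_def arcs_ends_conv)
    with inv[of e] step.IH show ?case by auto
  qed simp
qed

context core_graph
begin

text \<open>A property of the edge ends that is inherited from one end of an edge to the other holds
  everywhere or nowhere, by connectedness of the core.\<close>

lemma vertex_dichotomy:
  assumes step: "\<And>e. e \<in> E_K \<Longrightarrow> Q (tail (skeleton G) e) \<longleftrightarrow> Q (head (skeleton G) e)"
  shows "(\<forall>e\<in>edges G. Q (tail (skeleton G) e)) \<or> (\<forall>e\<in>edges G. \<not> Q (tail (skeleton G) e))"
proof -
  have mg: "wf_digraph (skeleton K)" "Digraph_Component.connected (skeleton K)"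
    using K by (auto simp: compact_metric_graph_def is_metric_graph_def)
  have "Q (Inl (tail (skeleton K) e)) \<longleftrightarrow> Q (Inl (head (skeleton K) e))" if "e \<in> edges K" for e
    using step[of "Inl e"] that by (simp add: E_K tail_G head_G)
  then have same: "Q (Inl x) \<longleftrightarrow> Q (Inl y)" if "x \<in> vertices K" "y \<in> vertices K" for x y
    by (rule connected_invariant[OF mg(2) _ that, of "\<lambda>x. Q (Inl x)"])
  have tail: "\<exists>x\<in>vertices K. tail (skeleton G) e = Inl x" if "e \<in> edges G" for e
    using that wf_digraph.tail_in_verts[OF mg(1)] s by (auto simp: edges_G tail_G)
  show ?thesis using same tail by metis
qed

lemma state_constant_sign:
  assumes u: "state u g" and nz: "\<And>e x. e \<in> edges G \<Longrightarrow> x \<in> J e \<Longrightarrow> u e x \<noteq> 0"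
  shows "strictly_positive G u \<or> strictly_positive G (\<lambda>e x. - u e x)"
proof -
  obtain w where w: "\<forall>e\<in>edges G. u e 0 = w (tail (skeleton G) e) \<and>
      (len G e < \<infinity> \<longrightarrow> u e (edge_len e) = w (head (skeleton G) e))"
    using u unfolding state_def glued_def by (elim exE conjE)
  have sign: "0 < u e x \<longleftrightarrow> 0 < u e 0" if e: "e \<in> edges G" and x: "x \<in> J e" for e x
  proof -
    note I = J_ray_or_segment[OF e]
    have c: "Topological_Spaces.connected (u e ` J e)"
      using state_continuous[OF u e] ray_or_segmentD(1)[OF I]
      by (intro connected_continuous_image) (simp_all add: is_interval_connected_1)
    have "0 \<notin> u e ` J e" using nz[OF e] by force
    moreover have "u e x \<in> u e ` J e" "u e 0 \<in> u e ` J e"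
      using x ray_or_segmentD(4)[OF I] by auto
    ultimately show ?thesis
      using connectedD_interval[OF c, of "u e x" "u e 0" 0] connectedD_interval[OF c, of "u e 0" "u e x" 0]
      by (metis less_imp_le not_less)
  qed
  have "(\<forall>e\<in>edges G. 0 < w (tail (skeleton G) e)) \<or> (\<forall>e\<in>edges G. \<not> 0 < w (tail (skeleton G) e))"
  proof (rule vertex_dichotomy)
    fix e assume e: "e \<in> E_K"
    then have eG: "e \<in> edges G" using E_K_subset by auto
    have "edge_len e \<in> J e" "len G e < \<infinity>" using core_edge[OF e] by auto
    with sign[OF eG this(1)] w eG show "0 < w (tail (skeleton G) e) \<longleftrightarrow> 0 < w (head (skeleton G) e)"
      by auto
  qed
  then show ?thesis
  proof (elim disjE)
    assume pos: "\<forall>e\<in>edges G. 0 < w (tail (skeleton G) e)"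
    have "strictly_positive G u"
      unfolding strictly_positive_def
    proof (intro ballI)
      fix e x assume ex: "e \<in> edges G" "x \<in> J e"
      have "0 < u e 0" using pos w ex(1) by simp
      then show "0 < u e x" using sign[OF ex] by simp
    qed
    then show ?thesis ..
  next
    assume neg: "\<forall>e\<in>edges G. \<not> 0 < w (tail (skeleton G) e)"
    have "strictly_positive G (\<lambda>e x. - u e x)"
      unfolding strictly_positive_def
    proof (intro ballI)
      fix e x assume ex: "e \<in> edges G" "x \<in> J e"
      have "\<not> 0 < u e 0" using neg w ex(1) by simp
      then show "0 < - u e x" using sign[OF ex] nz[OF ex] by simp
    qed
    then show ?thesis ..
  qed
qed

end

context negative_level
begin

lemma minimizer_nonzero:
  assumes u: "state u g" "sq_norm u = \<mu>" "state_energy u g = level"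
    and e: "e \<in> edges G" and x: "x \<in> J e"
  shows "u e x \<noteq> 0"
proof
  assume zero: "u e x = 0"
  note spread = minimizer_zero_spreads[OF u]
  have J0: "0 \<in> J e" if "e \<in> edges G" for e by (rule ray_or_segmentD(4)[OF J_ray_or_segment[OF that]])
  obtain w where w: "\<forall>e\<in>edges G. u e 0 = w (tail (skeleton G) e) \<and>
      (len G e < \<infinity> \<longrightarrow> u e (edge_len e) = w (head (skeleton G) e))"
    using u(1) unfolding state_def glued_def by (elim exE conjE)
  have "(\<forall>e\<in>edges G. w (tail (skeleton G) e) = 0) \<or> (\<forall>e\<in>edges G. w (tail (skeleton G) e) \<noteq> 0)"
  proof (rule vertex_dichotomy)
    fix e assume e: "e \<in> E_K"
    then have eG: "e \<in> edges G" using E_K_subset by auto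
    have l: "edge_len e \<in> J e" "len G e < \<infinity>" using core_edge[OF e] by auto
    have "u e 0 = 0 \<longleftrightarrow> u e (edge_len e) = 0"
      using spread[OF eG J0[OF eG] l(1)] spread[OF eG l(1) J0[OF eG]] by blast
    then show "w (tail (skeleton G) e) = 0 \<longleftrightarrow> w (head (skeleton G) e) = 0" using w eG l(2) by simp
  qed
  moreover have "w (tail (skeleton G) e) = 0" using spread[OF e x J0[OF e] zero] w e by simp
  ultimately have all: "u e 0 = 0" if "e \<in> edges G" for e using w e that by auto
  have "sq_norm u = 0"
    unfolding sq_norm_def
  proof (rule sum.neutral, rule ballI)
    fix e assume e: "e \<in> edges G"
    have "(LBINT x:J e. (u e x)\<^sup>2) = (LBINT x:J e. 0)"
      using spread[OF e J0[OF e] _ all[OF e]] ray_or_segmentD(2)[OF J_ray_or_segment[OF e]]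
      by (intro set_lebesgue_integral_cong) auto
    then show "(LBINT x:J e. (u e x)\<^sup>2) = 0" by simp
  qed
  with u(2) \<mu> show False by simp
qed

end

theorem theorem3p1:
  fixes K :: "('v, 'e) metric_graph"
    and N :: nat
    and s :: "nat \<Rightarrow> 'v"
    and G :: "('v + nat, 'e + nat) metric_graph"
    and E_K :: "('e + nat) set"
    and \<mu> p :: real
  assumes "compact_metric_graph K"
    and "edges K \<noteq> {}"
    and "1 \<le> N"
    and "\<And>i. i < N \<Longrightarrow> s i \<in> vertices K"
    and "G = attach_half_lines K N s"
    and "E_K = Inl ` edges K"
    and "0 < \<mu>"
    and "2 < p" and "p < 6"
  shows "ground_energy G E_K p \<mu> \<le> 0 \<and>
    (ground_energy G E_K p \<mu> < 0 \<longrightarrow>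
       (\<exists>u. is_minimizer G E_K p \<mu> u) \<and>
       (\<forall>u. is_minimizer G E_K p \<mu> u \<longrightarrow>
          strictly_positive G u \<or> strictly_positive G (\<lambda>e x. - u e x)))"
proof -
  interpret core_graph K N s G E_K \<mu> p
    by (rule core_graph.intro) (rule assms, assumption?)+
  show ?thesis
  proof (rule conjI[OF ground_energy_nonpos], rule impI)
    assume neg: "ground_energy G E_K p \<mu> < 0"
    obtain C where C: "\<forall>u g. state u g \<longrightarrow> sq_norm u \<le> \<mu> \<longrightarrow> sq_norm g / 4 - C \<le> state_energy u g"
      using state_energy_coercive by (elim exE)
    have "ereal (- C) \<le> ground_energy G E_K p \<mu>"
      unfolding ground_energy_def
    proof (rule INF_greatest)
      fix u assume "u \<in> H1_mass G \<mu>"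
      then obtain g where g: "state u g" "sq_norm u = \<mu>" "energy G E_K p u = state_energy u g"
        by (rule H1_mass_imp_state)
      have "sq_norm g / 4 - C \<le> state_energy u g" using C g(1,2) by simp
      then show "ereal (- C) \<le> ereal (energy G E_K p u)"
        using sq_norm_nonneg[of g] by (simp add: g(3))
    qed
    with neg obtain level where level: "ground_energy G E_K p \<mu> = ereal level"
      by (cases "ground_energy G E_K p \<mu>") auto
    interpret negative_level K N s G E_K \<mu> p level
    proof
      show "level \<le> state_energy u g" if "state u g" "sq_norm u = \<mu>" for u g
        using ground_energy_le[OF that] by (simp add: level)
      show "level < 0" using neg by (simp add: level zero_ereal_def)
    qed
    show "(\<exists>u. is_minimizer G E_K p \<mu> u) \<and>
       (\<forall>u. is_minimizer G E_K p \<mu> u \<longrightarrow>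
          strictly_positive G u \<or> strictly_positive G (\<lambda>e x. - u e x))"
    proof (intro conjI allI impI)
      have "\<exists>u g. state u g \<and> sq_norm u = \<mu> \<and> state_energy u g = level"
        by (rule minimizer_exists, rule ground_energy_approx) (simp add: level)
      then obtain u g where u: "state u g" "sq_norm u = \<mu>" "state_energy u g = level"
        by (elim exE conjE)
      have "is_minimizer G E_K p \<mu> u"
        using state_imp_H1_graph[OF u(1)] u(2,3)
        by (simp add: is_minimizer_def H1_mass_def Lq_norm_pow_eq level)
      then show "\<exists>u. is_minimizer G E_K p \<mu> u" by blast
    next
      fix u assume "is_minimizer G E_K p \<mu> u"
      then have m: "u \<in> H1_mass G \<mu>" "energy G E_K p u = level"
        by (simp_all add: is_minimizer_def level)
      obtain g where g: "state u g" "sq_norm u = \<mu>" "energy G E_K p u = state_energy u g"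
        by (rule H1_mass_imp_state[OF m(1)])
      have "state_energy u g = level" using g(3) m(2) by simp
      from state_constant_sign[OF g(1) minimizer_nonzero[OF g(1,2) this]]
      show "strictly_positive G u \<or> strictly_positive G (\<lambda>e x. - u e x)" .
    qed
  qed
qed

end
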